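(* Let $(X_n)$ be the size (number of internal nodes) of a random symmetric trie, i.e. $X_0=X_1=0$ and $X_n\stackrel{d}{=}X_{I_n}+X^*_{n-I_n}+1$ for $n\ge2$, where $I_n\sim\mathrm{Binom}(n,1/2)$ and $(X^*_k)$ is an independent copy of $(X_k)$ independent of $I_n$. Let $\chi_k=\frac{2k\pi i}{\log2}$ and define \[ G_0:=\frac14+2\sum_{j\ge1}\frac{(-1)^j(j-1)}{2^j-1},\qquad G_k:=-\frac{\chi_k\Gamma(-1+\chi_k)(1+\chi_k)^2}{4}+2\sum_{j\ge1}\frac{(-1)^jj\,(j(j+\chi_k)-1)\Gamma(j+\chi_k)}{(j+1)!\,(2^j-1)}\quad(k\ne0). \] Then \[ \frac{\mathbb{V}(X_n)}{n}=\frac1{\log2}\sum_{k\in\mathbb{Z}}G_kn^{-\chi_k}+o(1), \] and $G_0/\log 2\approx0.845858623076001$. *)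

theory Defs
  imports "HOL-Probability.Probability" "HOL-Real_Asymp.Real_Asymp"
begin

text \<open>
  The library's \<open>indep_var\<close> requires both random variables to have the same value type. This is its
  characterization \<open>indep_var_eq\<close> with two value types.
\<close>

definition (in prob_space) indep_pair ::
    "'b measure \<Rightarrow> ('a \<Rightarrow> 'b) \<Rightarrow> 'c measure \<Rightarrow> ('a \<Rightarrow> 'c) \<Rightarrow> bool" where
  "indep_pair S X T Y \<longleftrightarrow>
     random_variable S X \<and> random_variable T Y \<and>
     indep_set (sigma_sets (space M) {X -` A \<inter> space M | A. A \<in> sets S})
               (sigma_sets (space M) {Y -` A \<inter> space M | A. A \<in> sets T})"

text \<open>
  Sizes of random symmetric tries, with \<open>X'\<close> the independent copy and \<open>I\<close> the splitting variables.
  The sequences \<open>(X k)\<close> and \<open>(X' k)\<close> are compared as processes: no joint distribution of the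
  \<open>X k\<close> among themselves is prescribed. The two independence assumptions together say that the
  three objects \<open>I n\<close>, \<open>(X k)\<close> and \<open>(X' k)\<close> are mutually independent.
\<close>

abbreviation nat_process :: "(nat \<Rightarrow> nat) measure" where
  "nat_process \<equiv> (\<Pi>\<^sub>M k\<in>UNIV. count_space UNIV)"

locale symmetric_trie_size = prob_space M
  for M :: "'a measure"
  and X :: "nat \<Rightarrow> 'a \<Rightarrow> nat"
  and X' :: "nat \<Rightarrow> 'a \<Rightarrow> nat"
  and I :: "nat \<Rightarrow> 'a \<Rightarrow> nat" +
  assumes X_0: "AE \<omega> in M. X 0 \<omega> = 0"
    and X_1: "AE \<omega> in M. X 1 \<omega> = 0"
    and X'_copy: "distr M nat_process (\<lambda>\<omega> k. X' k \<omega>) = distr M nat_process (\<lambda>\<omega> k. X k \<omega>)"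
    and X'_indep: "indep_var nat_process (\<lambda>\<omega> k. X k \<omega>) nat_process (\<lambda>\<omega> k. X' k \<omega>)"
    and I_binomial: "\<And>n. n \<ge> 2 \<Longrightarrow>
      distr M (count_space UNIV) (I n) = measure_pmf (binomial_pmf n (1/2))"
    and I_indep: "\<And>n. n \<ge> 2 \<Longrightarrow>
      indep_pair (count_space UNIV) (I n)
        (nat_process \<Otimes>\<^sub>M nat_process) (\<lambda>\<omega>. (\<lambda>k. X k \<omega>, \<lambda>k. X' k \<omega>))"
    and X_rec: "\<And>n. n \<ge> 2 \<Longrightarrow>
      distr M (count_space UNIV) (X n) =
      distr M (count_space UNIV) (\<lambda>\<omega>. X (I n \<omega>) \<omega> + X' (n - I n \<omega>) \<omega> + 1)"

definition trie_chi :: "int \<Rightarrow> complex" where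
  "trie_chi k = 2 * of_int k * of_real pi * \<i> / of_real (ln 2)"

definition trie_G0_term :: "nat \<Rightarrow> real" where
  "trie_G0_term j = (-1) ^ j * (real j - 1) / (2 ^ j - 1)"

definition trie_G0 :: real where
  "trie_G0 = 1/4 + 2 * (\<Sum>i. trie_G0_term (Suc i))"

definition trie_G_term :: "int \<Rightarrow> nat \<Rightarrow> complex" where
  "trie_G_term k j =
     (-1) ^ j * of_nat j * (of_nat j * (of_nat j + trie_chi k) - 1) * Gamma (of_nat j + trie_chi k)
     / (fact (j + 1) * (2 ^ j - 1))"

definition trie_G :: "int \<Rightarrow> complex" where
  "trie_G k =
     (if k = 0 then of_real trie_G0
      else - (trie_chi k * Gamma (-1 + trie_chi k) * (1 + trie_chi k)\<^sup>2 / 4)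
           + 2 * (\<Sum>i. trie_G_term k (Suc i)))"

text \<open>The series defining the coefficients converge, so \<open>suminf\<close> has its intended meaning.\<close>

lemma norm_Gamma_le_Gamma_Re:
  fixes z :: complex
  assumes "Re z > 0"
  shows "norm (Gamma z) \<le> Gamma (Re z)"
proof (rule LIMSEQ_le)
  show "(\<lambda>n. norm (Gamma_series z n)) \<longlonglongrightarrow> norm (Gamma z)"
    by (intro tendsto_norm Gamma_series_LIMSEQ)
  show "Gamma_series (Re z) \<longlonglongrightarrow> Gamma (Re z)"
    by (rule Gamma_series_LIMSEQ)
  have "norm (Gamma_series z n) \<le> Gamma_series (Re z) n" for n
  proof -
    have "pochhammer (Re z) (n+1) = (\<Prod>i<n+1. Re z + of_nat i)"
      by (simp add: pochhammer_prod atLeast0LessThan)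
    also have "\<dots> \<le> (\<Prod>i<n+1. norm (z + of_nat i))"
    proof (rule prod_mono)
      fix i
      show "0 \<le> Re z + of_nat i \<and> Re z + of_nat i \<le> norm (z + of_nat i)"
        using assms complex_Re_le_cmod[of "z + of_nat i"] by simp
    qed
    also have "\<dots> = norm (pochhammer z (n+1))"
      by (simp add: pochhammer_prod atLeast0LessThan prod_norm norm_mult)
    finally have *: "pochhammer (Re z) (n+1) \<le> norm (pochhammer z (n+1))" .
    have "pochhammer (Re z) (n+1) > 0"
      using assms by (intro pochhammer_pos)
    with * show ?thesis
      unfolding Gamma_series_def norm_divide norm_mult
      by (intro frac_le mult_mono) (auto simp: norm_fact)
  qed
  then show "\<exists>N. \<forall>n\<ge>N. norm (Gamma_series z n) \<le> Gamma_series (Re z) n"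
    by blast
qed

lemma summable_trie_G0_term: "summable (\<lambda>i. trie_G0_term (Suc i))"
proof (rule summable_norm_cancel)
  have "norm (trie_G0_term (Suc i)) = real i / (2 ^ Suc i - 1)" for i
    using one_le_power[of "2::real" "Suc i"]
    by (simp add: trie_G0_term_def abs_mult power_abs del: power_Suc)
  moreover have "summable (\<lambda>i. real i / (2 ^ Suc i - 1))"
  proof (rule summable_comparison_test_bigo)
    show "summable (\<lambda>i. norm (1 / real i ^ 2))"
      using inverse_power_summable[of 2, where ?'a = real] by (simp add: inverse_eq_divide)
    show "(\<lambda>i. real i / (2 ^ Suc i - 1)) \<in> O(\<lambda>i. 1 / real i ^ 2)"
      by real_asymp
  qed
  ultimately show "summable (\<lambda>i. norm (trie_G0_term (Suc i)))"
    by (simp only:)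
qed

lemma norm_trie_G_term_le:
  assumes "j \<ge> 1"
  shows "norm (trie_G_term k j) \<le> (real j * (real j + norm (trie_chi k)) + 1) / (2 ^ j - 1)"
proof -
  let ?c = "trie_chi k"
  have Re: "Re ?c = 0"
    by (simp add: trie_chi_def)
  have "norm (Gamma (of_nat j + ?c)) \<le> Gamma (real j)"
    using norm_Gamma_le_Gamma_Re[of "of_nat j + ?c"] assms by (simp add: Re)
  also have "\<dots> = fact (j - 1)"
    using assms Gamma_fact[of "j - 1", where ?'a = real] by (simp add: of_nat_diff)
  finally have G: "norm (Gamma (of_nat j + ?c)) \<le> fact (j - 1)" .
  have "real j * norm (Gamma (of_nat j + ?c)) \<le> real j * fact (j - 1)"
    using G by (intro mult_left_mono) auto
  also have "\<dots> = fact j"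
    using assms by (simp add: fact_reduce)
  also have "\<dots> \<le> fact (j + 1)"
    by (rule fact_mono) simp
  finally have A: "real j * norm (Gamma (of_nat j + ?c)) / fact (j + 1) \<le> 1"
    by (simp add: divide_le_eq)
  have "norm (of_nat j * (of_nat j + ?c) - 1) \<le> norm (of_nat j * (of_nat j + ?c)) + 1"
    using norm_triangle_ineq4[of "of_nat j * (of_nat j + ?c)" 1] by simp
  also have "norm (of_nat j * (of_nat j + ?c)) \<le> real j * (real j + norm ?c)"
    unfolding norm_mult using norm_triangle_ineq[of "of_nat j" ?c]
    by (intro mult_mono) auto
  finally have B: "norm (of_nat j * (of_nat j + ?c) - 1) \<le> real j * (real j + norm ?c) + 1"
    by simp
  have D: "norm ((2::complex) ^ j - 1) = 2 ^ j - 1"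
  proof -
    have "(2::complex) ^ j - 1 = of_real (2 ^ j - 1)"
      by simp
    then show ?thesis
      by (metis abs_of_nonneg diff_ge_0_iff_ge norm_of_real one_le_numeral one_le_power)
  qed
  have "norm (trie_G_term k j) =
      (real j * norm (Gamma (of_nat j + ?c)) / fact (j + 1)) *
      norm (of_nat j * (of_nat j + ?c) - 1) / (2 ^ j - 1)"
    unfolding trie_G_term_def norm_divide norm_mult D
    by (simp add: norm_power norm_fact del: fact_Suc)
  also have "\<dots> \<le> 1 * (real j * (real j + norm ?c) + 1) / (2 ^ j - 1)"
    by (intro divide_right_mono mult_mono A B) auto
  finally show ?thesis
    by simp
qed

lemma summable_trie_G_term: "summable (\<lambda>i. trie_G_term k (Suc i))"
proof (rule summable_comparison_test)
  define c where "c = norm (trie_chi k)"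
  show "\<exists>N. \<forall>i\<ge>N. norm (trie_G_term k (Suc i)) \<le> (real (Suc i) * (real (Suc i) + c) + 1) / (2 ^ Suc i - 1)"
    using norm_trie_G_term_le[of "Suc _" k] unfolding c_def by auto
  show "summable (\<lambda>i. (real (Suc i) * (real (Suc i) + c) + 1) / (2 ^ Suc i - 1))"
  proof (rule summable_comparison_test_bigo)
    show "summable (\<lambda>i. norm (1 / real i ^ 2))"
      using inverse_power_summable[of 2, where ?'a = real] by (simp add: inverse_eq_divide)
    define f g where "f = (\<lambda>i. (real (Suc i) * real (Suc i) + 1) / (2 ^ Suc i - 1))"
      and "g = (\<lambda>i. real (Suc i) / (2 ^ Suc i - 1))"
    have "f \<in> O(\<lambda>i. 1 / real i ^ 2)"
      unfolding f_def by real_asymp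
    moreover have "g \<in> O(\<lambda>i. 1 / real i ^ 2)"
      unfolding g_def by real_asymp
    ultimately have "(\<lambda>i. f i + c * g i) \<in> O(\<lambda>i. 1 / real i ^ 2)"
      by (cases "c = 0") (auto intro: sum_in_bigo)
    moreover have "f i + c * g i = (real (Suc i) * (real (Suc i) + c) + 1) / (2 ^ Suc i - 1)" for i
      unfolding f_def g_def times_divide_eq_right add_divide_distrib[symmetric]
      by (rule arg_cong2[where f = "(/)"]) (simp_all add: algebra_simps)
    ultimately show
      "(\<lambda>i. (real (Suc i) * (real (Suc i) + c) + 1) / (2 ^ Suc i - 1)) \<in> O(\<lambda>i. 1 / real i ^ 2)"
      by (simp only:)
  qed
qed

end

theory Submission
  imports Defs
begin

text \<open>
  The trie size counts the binary words \<open>w\<close> shared by at least two of the \<open>n\<close> strings. Summing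
  the covariances of the corresponding indicators over pairs of words solves the moment recurrences
  explicitly. Pairs of comparable words contribute as in the Poisson model. For incomparable words,
  decoupling the \<open>n\<close> balls one at a time shows that the covariance of the events that at most one
  ball falls into disjoint cells of probabilities \<open>p = a / n\<close> and \<open>r = b / n\<close> is
  \<open>- a\<^sup>2 b\<^sup>2 exp (- a - b) / n\<close> to leading order, with a bound that is uniform and summable over dyadic
  scales. By dominated convergence the variance divided by \<open>n\<close> is asymptotic to a continuous function
  of \<open>n\<close> that is invariant under doubling, a sum over dyadic scales of one fixed function.
  Its Fourier coefficients in \<open>log 2 n\<close> are Mellin transforms of that function at the points
  \<open>trie_chi k\<close>; expanding in powers gives Gamma integrals, which sum up to \<open>trie_G k\<close>. The coefficients
  decay quadratically, and a continuous periodic function is determined by its Fourier coefficients.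
\<close>


section \<open>Law of the trie size\<close>

text \<open>No strings or words live on the probability space: the hypotheses relate laws only. The
  sums over words are therefore candidates, which are checked to satisfy the moment recurrences and
  are identified with the moments by uniqueness. Finiteness of the moments is not given; it has to
  be extracted from a recursion in which the law at \<open>n\<close> reappears on the right for the
  splits 0 and \<open>n\<close>. Covariances avoid subtracting the squared mean from the second
  moment, two quantities of order \<open>n^2\<close> whose difference is of order \<open>n\<close>.
  Near the level \<open>log 2 n\<close> there are about \<open>n^2\<close> incomparable pairs with a
  covariance of order \<open>1/n\<close> each, so Poissonization alone, which makes these
  covariances vanish, would miss a contribution of leading order. Grouping pairs by the difference
  of their levels, the geometric sum over positive differences produces the denominators
  \<open>2^j - 1\<close>. Difference 0 is kept apart: without such a denominator the integrated
  power series diverges. It yields the closed-form term of \<open>trie_G\<close>, and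
  \<open>1/4\<close> for \<open>k = 0\<close>.\<close>

context symmetric_trie_size
begin

lemma process_measurable:
  "(\<lambda>\<omega> k. X k \<omega>) \<in> measurable M nat_process" "(\<lambda>\<omega> k. X' k \<omega>) \<in> measurable M nat_process"
  using indep_var_rv1[OF X'_indep] indep_var_rv2[OF X'_indep] by auto

lemma X_measurable [measurable]: "X k \<in> measurable M (count_space UNIV)"
  using measurable_compose[OF process_measurable(1), of "\<lambda>f. f k"] by simp

lemma X'_measurable [measurable]: "X' k \<in> measurable M (count_space UNIV)"
  using measurable_compose[OF process_measurable(2), of "\<lambda>f. f k"] by simp

definition law :: "nat \<Rightarrow> nat pmf" where
  "law n = Abs_pmf (distr M (count_space UNIV) (X n))"

lemma measure_pmf_law: "measure_pmf (law n) = distr M (count_space UNIV) (X n)"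
proof -
  interpret N: prob_space "distr M (count_space UNIV) (X n)"
    by (rule prob_space_distr) simp
  have "AE x in distr M (count_space UNIV) (X n). measure (distr M (count_space UNIV) (X n)) {x} \<noteq> 0"
    using N.AE_support_countable by (auto intro!: exI[of _ UNIV])
  then show ?thesis
    unfolding law_def by (intro Abs_pmf_inverse) (auto intro: N.prob_space_axioms)
qed

lemma pmf_law: "pmf (law n) t = prob {\<omega>\<in>space M. X n \<omega> = t}"
proof -
  have "pmf (law n) t = measure (distr M (count_space UNIV) (X n)) {t}"
    by (simp add: pmf.rep_eq measure_pmf_law)
  also have "\<dots> = prob {\<omega>\<in>space M. X n \<omega> = t}"
    by (subst measure_distr) (auto intro!: arg_cong[where f = prob])
  finally show ?thesis .
qed

lemma prob_X': "prob {\<omega>\<in>space M. X' n \<omega> = t} = pmf (law n) t"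
proof -
  let ?S = "{f::nat\<Rightarrow>nat. f n = t}"
  have S: "?S \<in> sets nat_process"
  proof -
    have "(\<lambda>f. f n) -` {t} \<inter> space nat_process \<in> sets nat_process"
      by (intro measurable_sets[OF measurable_component_singleton]) auto
    then show ?thesis by (simp add: space_PiM vimage_def)
  qed
  have "prob {\<omega>\<in>space M. X' n \<omega> = t} = measure (distr M nat_process (\<lambda>\<omega> k. X' k \<omega>)) ?S"
    by (subst measure_distr[OF process_measurable(2) S]) (auto intro!: arg_cong[where f = prob])
  also have "\<dots> = prob {\<omega>\<in>space M. X n \<omega> = t}"
    unfolding X'_copy
    by (subst measure_distr[OF process_measurable(1) S]) (auto intro!: arg_cong[where f = prob])
  finally show ?thesis by (simp add: pmf_law)
qed

text \<open>Mutual independence comes in two layers: \<open>I n\<close> is independent of the pair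
  of processes, and within the pair the two processes are independent. Evaluating both layers on
  cylinder sets gives a product of three point masses.\<close>

lemma prob_split:
  assumes n: "n \<ge> 2"
  shows "prob {\<omega>\<in>space M. I n \<omega> = j \<and> X k \<omega> = a \<and> X' l \<omega> = b}
       = pmf (binomial_pmf n (1/2)) j * pmf (law k) a * pmf (law l) b"
proof -
  let ?T = "nat_process \<Otimes>\<^sub>M nat_process" and ?Z = "\<lambda>\<omega>. (\<lambda>k. X k \<omega>, \<lambda>k. X' k \<omega>)"
  let ?B = "{(f,g). f k = a \<and> g l = b} :: ((nat \<Rightarrow> nat) \<times> (nat \<Rightarrow> nat)) set"
  have comp: "{f::nat\<Rightarrow>nat. f k = a} \<in> sets nat_process" for k a
  proof -
    have "(\<lambda>f. f k) -` {a} \<inter> space nat_process \<in> sets nat_process"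
      by (intro measurable_sets[OF measurable_component_singleton]) auto
    then show ?thesis by (simp add: space_PiM vimage_def)
  qed
  have B: "?B \<in> sets ?T"
  proof -
    have "?B = {f. f k = a} \<times> {g. g l = b}" by auto
    then show ?thesis using comp by auto
  qed
  have I_rv: "I n \<in> measurable M (count_space UNIV)"
    and ind: "indep_set (sigma_sets (space M) {I n -` A \<inter> space M |A. A \<in> sets (count_space UNIV)})
               (sigma_sets (space M) {?Z -` A \<inter> space M |A. A \<in> sets ?T})"
    using I_indep[OF n] by (auto simp: indep_pair_def)
  have "{\<omega>\<in>space M. I n \<omega> = j \<and> X k \<omega> = a \<and> X' l \<omega> = b}
      = (I n -` {j} \<inter> space M) \<inter> (?Z -` ?B \<inter> space M)" by auto
  also have "prob \<dots> = prob (I n -` {j} \<inter> space M) * prob (?Z -` ?B \<inter> space M)"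
    by (rule indep_setD[OF ind]) (use B in \<open>auto intro!: sigma_sets.Basic\<close>)
  also have "prob (I n -` {j} \<inter> space M) = pmf (binomial_pmf n (1/2)) j"
  proof -
    have "prob (I n -` {j} \<inter> space M) = measure (distr M (count_space UNIV) (I n)) {j}"
      using I_rv by (subst measure_distr) auto
    then show ?thesis by (simp add: I_binomial[OF n] pmf.rep_eq)
  qed
  also have "prob (?Z -` ?B \<inter> space M)
      = prob ((\<lambda>\<omega> k. X k \<omega>) -` {f. f k = a} \<inter> space M) * prob ((\<lambda>\<omega> k. X' k \<omega>) -` {g. g l = b} \<inter> space M)"
  proof -
    have "?Z -` ?B \<inter> space M = ((\<lambda>\<omega> k. X k \<omega>) -` {f. f k = a} \<inter> space M) \<inter>
        ((\<lambda>\<omega> k. X' k \<omega>) -` {g. g l = b} \<inter> space M)" by auto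
    also have "prob \<dots> = prob ((\<lambda>\<omega> k. X k \<omega>) -` {f. f k = a} \<inter> space M) * prob ((\<lambda>\<omega> k. X' k \<omega>) -` {g. g l = b} \<inter> space M)"
    proof (rule indep_setD)
      show "indep_set (sigma_sets (space M) {(\<lambda>\<omega> k. X k \<omega>) -` A \<inter> space M |A. A \<in> sets nat_process})
          (sigma_sets (space M) {(\<lambda>\<omega> k. X' k \<omega>) -` A \<inter> space M |A. A \<in> sets nat_process})"
        using X'_indep unfolding indep_var_eq by blast
    qed (rule sigma_sets.Basic, use comp in blast)+
    finally show ?thesis .
  qed
  also have "((\<lambda>\<omega> k. X k \<omega>) -` {f. f k = a} \<inter> space M) = {\<omega>\<in>space M. X k \<omega> = a}" by auto
  also have "((\<lambda>\<omega> k. X' k \<omega>) -` {g. g l = b} \<inter> space M) = {\<omega>\<in>space M. X' l \<omega> = b}" by auto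
  finally show ?thesis by (simp add: pmf_law[symmetric] prob_X')
qed

lemma I_measurable: "n \<ge> 2 \<Longrightarrow> I n \<in> measurable M (count_space UNIV)"
  using I_indep[of n] by (simp add: indep_pair_def)

lemma law_rec:
  assumes n: "n \<ge> 2"
  shows "law n = bind_pmf (binomial_pmf n (1/2))
           (\<lambda>j. map_pmf (\<lambda>(a, b). a + b + 1) (pair_pmf (law j) (law (n - j))))"
proof (rule pmf_eqI)
  fix t
  \<comment> \<open>Given \<open>I n = j\<close> and \<open>X j = a\<close>, the other summand must
    equal \<open>t - 1 - a\<close>. The range \<open>a < t\<close> keeps this subtraction of
    naturals exact and makes the family empty for \<open>t = 0\<close>.\<close>
  let ?E = "\<lambda>(j, a). {\<omega>\<in>space M. I n \<omega> = j \<and> X j \<omega> = a \<and> X' (n - j) \<omega> = t - 1 - a}"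
  let ?J = "{..n} \<times> {..<t}"
  note [measurable] = I_measurable[OF n]
  have AE_I: "AE \<omega> in M. I n \<omega> \<le> n"
  proof -
    have "AE j in distr M (count_space UNIV) (I n). j \<le> n"
      unfolding I_binomial[OF n] by (auto simp: AE_measure_pmf_iff set_pmf_binomial_eq)
    then show ?thesis by (subst (asm) AE_distr_iff) auto
  qed
  have Ym: "(\<lambda>\<omega>. X (I n \<omega>) \<omega> + X' (n - I n \<omega>) \<omega> + 1) \<in> measurable M (count_space UNIV)"
  proof -
    have a: "(\<lambda>\<omega>. X (I n \<omega>) \<omega>) \<in> measurable M (count_space UNIV)"
      by (rule measurable_compose_countable[where f = "\<lambda>i \<omega>. X i \<omega>" and g = "I n"]) auto
    have b: "(\<lambda>\<omega>. X' (n - I n \<omega>) \<omega>) \<in> measurable M (count_space UNIV)"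
      by (rule measurable_compose_countable[where f = "\<lambda>i \<omega>. X' (n - i) \<omega>" and g = "I n"]) auto
    show ?thesis using a b by measurable
  qed
  have "pmf (law n) t = measure (distr M (count_space UNIV) (X n)) {t}"
    by (simp add: pmf.rep_eq measure_pmf_law)
  also have "\<dots> = prob {\<omega>\<in>space M. X (I n \<omega>) \<omega> + X' (n - I n \<omega>) \<omega> + 1 = t}"
    unfolding X_rec[OF n] by (subst measure_distr[OF Ym]) (auto intro!: arg_cong[where f = prob])
  also have "\<dots> = prob (\<Union>(?E ` ?J))"
  proof (rule finite_measure_eq_AE)
    show "AE x in M. (x \<in> {\<omega> \<in> space M. X (I n \<omega>) \<omega> + X' (n - I n \<omega>) \<omega> + 1 = t}) = (x \<in> \<Union> (?E ` ?J))"
      using AE_I by eventually_elim auto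
    show "{\<omega> \<in> space M. X (I n \<omega>) \<omega> + X' (n - I n \<omega>) \<omega> + 1 = t} \<in> events"
      using measurable_sets[OF Ym, of "{t}"] by (simp add: vimage_def Int_def conj_commute)
  qed auto
  also have "\<dots> = (\<Sum>x\<in>?J. prob (?E x))"
    by (rule finite_measure_finite_Union) (auto simp: disjoint_family_on_def)
  also have "\<dots> = (\<Sum>j\<le>n. \<Sum>a<t. pmf (binomial_pmf n (1/2)) j * (pmf (law j) a * pmf (law (n - j)) (t - 1 - a)))"
    unfolding sum.cartesian_product by (intro sum.cong) (auto simp: prob_split[OF n])
  also have "\<dots> = (\<Sum>j\<le>n. pmf (binomial_pmf n (1/2)) j *
      pmf (map_pmf (\<lambda>(a, b). a + b + 1) (pair_pmf (law j) (law (n - j)))) t)"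
  proof (intro sum.cong refl)
    fix j
    have "pmf (map_pmf (\<lambda>(a, b). a + b + 1) (pair_pmf (law j) (law (n - j)))) t
        = measure (pair_pmf (law j) (law (n - j))) ((\<lambda>a. (a, t - 1 - a)) ` {..<t})"
      unfolding pmf_map by (intro arg_cong[where f = "measure _"]) auto
    also have "\<dots> = (\<Sum>a<t. pmf (law j) a * pmf (law (n - j)) (t - 1 - a))"
      by (subst measure_measure_pmf_finite) (auto simp: sum.reindex inj_on_def pmf_pair)
    finally show "(\<Sum>a<t. pmf (binomial_pmf n (1/2)) j * (pmf (law j) a * pmf (law (n - j)) (t - 1 - a)))
      = pmf (binomial_pmf n (1/2)) j * pmf (map_pmf (\<lambda>(a, b). a + b + 1) (pair_pmf (law j) (law (n - j)))) t"
      by (simp add: sum_distrib_left)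
  qed
  also have "\<dots> = pmf (bind_pmf (binomial_pmf n (1/2))
           (\<lambda>j. map_pmf (\<lambda>(a, b). a + b + 1) (pair_pmf (law j) (law (n - j))))) t"
    unfolding pmf_bind
    by (subst integral_measure_pmf[of "{..n}"]) (auto simp: set_pmf_binomial_eq mult.commute)
  finally show "pmf (law n) t = \<dots>" .
qed

lemma law_0: "law 0 = return_pmf 0" and law_1: "law 1 = return_pmf 0"
proof -
  have "law n = return_pmf 0" if "AE \<omega> in M. X n \<omega> = 0" for n
  proof -
    have "AE x in measure_pmf (law n). x = 0"
      unfolding measure_pmf_law using that by (subst AE_distr_iff) auto
    then have "set_pmf (law n) \<subseteq> {0}" by (auto simp: AE_measure_pmf_iff)
    then show ?thesis by (simp add: set_pmf_subset_singleton)
  qed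
  then show "law 0 = return_pmf 0" "law 1 = return_pmf 0" using X_0 X_1 by auto
qed

end

section \<open>Finiteness of the second moment and the moment recurrences\<close>

lemma nn_integral_split_law:
  assumes "L n = bind_pmf (binomial_pmf n (1/2))
      (\<lambda>j. map_pmf (\<lambda>(a, b). a + b + 1) (pair_pmf (L j) (L (n - j))))"
  shows "(\<integral>\<^sup>+x. f x \<partial>measure_pmf (L n)) = (\<Sum>j\<le>n. ennreal (real (n choose j) / 2 ^ n) *
           (\<integral>\<^sup>+a. \<integral>\<^sup>+b. f (a + b + 1) \<partial>measure_pmf (L (n - j)) \<partial>measure_pmf (L j)))"
proof -
  have "(\<integral>\<^sup>+x. f x \<partial>measure_pmf (L n)) = (\<integral>\<^sup>+j. \<integral>\<^sup>+a. \<integral>\<^sup>+b. f (a + b + 1)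
      \<partial>measure_pmf (L (n - j)) \<partial>measure_pmf (L j) \<partial>measure_pmf (binomial_pmf n (1/2)))"
    by (subst assms) (simp add: nn_integral_pair_pmf')
  also have "\<dots> = (\<Sum>j\<le>n. (\<integral>\<^sup>+a. \<integral>\<^sup>+b. f (a + b + 1) \<partial>measure_pmf (L (n - j)) \<partial>measure_pmf (L j))
      * ennreal (pmf (binomial_pmf n (1/2)) j))"
    by (rule nn_integral_measure_pmf_support) (auto simp: set_pmf_binomial_eq)
  also have "\<dots> = (\<Sum>j\<le>n. ennreal (real (n choose j) / 2 ^ n) *
           (\<integral>\<^sup>+a. \<integral>\<^sup>+b. f (a + b + 1) \<partial>measure_pmf (L (n - j)) \<partial>measure_pmf (L j)))"
  proof (intro sum.cong refl)
    fix j assume "j \<in> {..n}"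
    then have "(1/2::real) ^ j * (1/2) ^ (n - j) = 1 / 2 ^ n"
      by (simp flip: power_add add: power_one_over)
    then have "pmf (binomial_pmf n (1/2)) j = real (n choose j) / 2 ^ n"
      by (simp add: mult.assoc)
    then show "(\<integral>\<^sup>+a. \<integral>\<^sup>+b. f (a + b + 1) \<partial>measure_pmf (L (n - j)) \<partial>measure_pmf (L j))
      * ennreal (pmf (binomial_pmf n (1/2)) j) = ennreal (real (n choose j) / 2 ^ n) *
           (\<integral>\<^sup>+a. \<integral>\<^sup>+b. f (a + b + 1) \<partial>measure_pmf (L (n - j)) \<partial>measure_pmf (L j))"
      by (simp only: mult.commute)
  qed
  finally show ?thesis .
qed

lemma min_square_split:
  fixes a b T :: nat
  shows "(real (min (a + b + 1) T))\<^sup>2 \<le> 3 * ((real (min a T))\<^sup>2 + (real (min b T))\<^sup>2 + 1)"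
proof -
  define x y where "x = real (min a T)" and "y = real (min b T)"
  have "real (min (a + b + 1) T) \<le> x + y + 1" by (auto simp: x_def y_def)
  then have "(real (min (a + b + 1) T))\<^sup>2 \<le> (x + y + 1)\<^sup>2" by (intro power_mono) auto
  also have "\<dots> \<le> 3 * (x\<^sup>2 + y\<^sup>2 + 1)"
    using zero_le_power2[of "x - y"] zero_le_power2[of "x - 1"] zero_le_power2[of "y - 1"]
    by (simp add: power2_eq_square algebra_simps)
  finally show ?thesis by (simp add: x_def y_def)
qed

text \<open>The inequality reduces to \<open>(x - 2)^2 >= 0\<close>. The factor 3/2 on the square,
  in place of the 3 in \<open>min_square_split\<close>, is what later keeps the coefficient of the
  unknown moment below 1.\<close>

lemma min_square_Suc:
  fixes a T :: nat
  shows "(real (min (a + 1) T))\<^sup>2 \<le> 3/2 * (real (min a T))\<^sup>2 + 3"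
proof -
  define x where "x = real (min a T)"
  have "real (min (a + 1) T) \<le> x + 1" by (auto simp: x_def)
  then have "(real (min (a + 1) T))\<^sup>2 \<le> (x + 1)\<^sup>2" by (intro power_mono) auto
  also have "\<dots> \<le> 3/2 * x\<^sup>2 + 3"
    using zero_le_power2[of "x - 2"] by (simp add: power2_eq_square algebra_simps)
  finally show ?thesis by (simp add: x_def)
qed

text \<open>Retains just the recursion of the laws, so that the moments can be treated as properties
  of a sequence of distributions.\<close>

locale trie_law =
  fixes L :: "nat \<Rightarrow> nat pmf"
  assumes L_0: "L 0 = return_pmf 0" and L_1: "L (Suc 0) = return_pmf 0"
    and L_rec: "\<And>n. n \<ge> 2 \<Longrightarrow> L n = bind_pmf (binomial_pmf n (1/2))
      (\<lambda>j. map_pmf (\<lambda>(a, b). a + b + 1) (pair_pmf (L j) (L (n - j))))"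
begin

text \<open>The splits \<open>j = 0\<close> and \<open>j = n\<close> bring back the unknown moment
  of \<open>L n\<close>, so induction alone gives nothing. Each of them has weight at most 1/4 and
  returns at most 3/2 of the moment, together at most 3/4 of it, which can be absorbed on the left
  provided it is finite. Truncation at \<open>T\<close> makes it finite, and the resulting bound
  does not depend on \<open>T\<close>. Nonnegative integrals allow all this before integrability is
  known.\<close>

lemma truncated_second_moment_bound:
  "\<exists>C\<ge>0. \<forall>T::nat. (\<integral>\<^sup>+x. ennreal ((real (min x T))\<^sup>2) \<partial>measure_pmf (L n)) \<le> ennreal C"
proof (induction n rule: less_induct)
  case (less n)
  show ?case
  proof (cases "n \<ge> 2")
    case False
    then consider "n = 0" | "n = Suc 0" by linarith
    then show ?thesis by cases (auto simp: L_0 L_1 nn_integral_return_pmf intro!: exI[of _ 0])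
  next
    case n: True
    define e where "e = (\<lambda>T j. \<integral>\<^sup>+x. ennreal ((real (min x T))\<^sup>2) \<partial>measure_pmf (L j))"
    obtain C where C: "\<And>j. j < n \<Longrightarrow> C j \<ge> (0::real)" "\<And>j T. j < n \<Longrightarrow> e T j \<le> ennreal (C j)"
      using less unfolding e_def by metis
    define K where "K = (\<Sum>j\<in>{1..<n}. 3 * (C j + C (n - j) + 1))"
    have K0: "K \<ge> 0" unfolding K_def by (intro sum_nonneg) (auto simp: C(1))
    define b where "b = (\<lambda>j. real (n choose j) / 2 ^ n)"
    have b01: "0 \<le> b j" "b j \<le> 1" for j
    proof -
      have "n choose j \<le> 2 ^ n" by (cases "j \<le> n") (auto simp: binomial_le_pow2)
      then have "real (n choose j) \<le> 2 ^ n" by (metis of_nat_le_iff of_nat_numeral of_nat_power)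
      then show "0 \<le> b j" "b j \<le> 1" by (auto simp: b_def)
    qed
    have b4: "b 0 \<le> 1/4" "b n \<le> 1/4"
    proof -
      have "(2::real)^2 \<le> 2 ^ n" using n by (intro power_increasing) auto
      then show "b 0 \<le> 1/4" "b n \<le> 1/4" by (auto simp: b_def field_simps)
    qed
    define Y where "Y = (\<lambda>T j. \<integral>\<^sup>+a. \<integral>\<^sup>+b. ennreal ((real (min (a + b + 1) T))\<^sup>2)
        \<partial>measure_pmf (L (n - j)) \<partial>measure_pmf (L j))"
    have edge: "(\<integral>\<^sup>+a. ennreal ((real (min (a + 1) T))\<^sup>2) \<partial>measure_pmf (L n)) \<le> ennreal (3/2) * e T n + 3" for T
    proof -
      have "(\<integral>\<^sup>+a. ennreal ((real (min (a + 1) T))\<^sup>2) \<partial>measure_pmf (L n))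
        \<le> (\<integral>\<^sup>+a. ennreal (3/2) * ennreal ((real (min a T))\<^sup>2) + 3 \<partial>measure_pmf (L n))"
      proof (intro nn_integral_mono)
        fix a
        show "ennreal ((real (min (a + 1) T))\<^sup>2) \<le> ennreal (3/2) * ennreal ((real (min a T))\<^sup>2) + 3"
        proof -
          have "ennreal (3/2 * (real (min a T))\<^sup>2 + 3) = ennreal (3/2 * (real (min a T))\<^sup>2) + ennreal 3"
            by (rule ennreal_plus) auto
          also have "ennreal (3/2 * (real (min a T))\<^sup>2) = ennreal (3/2) * ennreal ((real (min a T))\<^sup>2)"
            by (rule ennreal_mult) auto
          finally show ?thesis
            using ennreal_leI[OF min_square_Suc[of a T]] by simp
        qed
      qed
      also have "\<dots> = ennreal (3/2) * e T n + 3"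
        unfolding e_def by (simp add: nn_integral_add nn_integral_cmult)
      finally show ?thesis .
    qed
    have inner: "Y T j \<le> ennreal (3 * (C j + C (n - j) + 1))" if "j \<in> {1..<n}" for T j
    proof -
      have "Y T j \<le> (\<integral>\<^sup>+a. \<integral>\<^sup>+b. 3 * (ennreal ((real (min a T))\<^sup>2) + ennreal ((real (min b T))\<^sup>2) + 1)
        \<partial>measure_pmf (L (n - j)) \<partial>measure_pmf (L j))"
        unfolding Y_def
      proof (intro nn_integral_mono)
        fix a b
        have "ennreal (3 * ((real (min a T))\<^sup>2 + (real (min b T))\<^sup>2 + 1))
          = 3 * (ennreal ((real (min a T))\<^sup>2) + ennreal ((real (min b T))\<^sup>2) + 1)"
          by (subst ennreal_mult) (auto simp: ennreal_plus)
        then show "ennreal ((real (min (a + b + 1) T))\<^sup>2) \<le> 3 * (ennreal ((real (min a T))\<^sup>2) + ennreal ((real (min b T))\<^sup>2) + 1)"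
          using ennreal_leI[OF min_square_split[of a b T]] by simp
      qed
      also have "\<dots> = 3 * (e T j + e T (n - j) + 1)"
        unfolding e_def by (simp add: nn_integral_add nn_integral_cmult)
      also have "\<dots> \<le> 3 * (ennreal (C j) + ennreal (C (n - j)) + 1)"
        using that C(2)[of j T] C(2)[of "n - j" T] by (intro mult_left_mono add_mono) auto
      also have "\<dots> = ennreal (3 * (C j + C (n - j) + 1))"
        using that C(1)[of j] C(1)[of "n - j"] by (subst ennreal_mult) (auto simp: ennreal_plus)
      finally show ?thesis .
    qed
    have main: "e T n \<le> ennreal (4 * (2 + K))" for T
    proof -
      have fin: "e T n < \<top>"
      proof -
        have "e T n \<le> (\<integral>\<^sup>+x. ennreal ((real T)\<^sup>2) \<partial>measure_pmf (L n))"
          unfolding e_def by (intro nn_integral_mono ennreal_leI power_mono) auto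
        also have "\<dots> < \<top>" by simp
        finally show ?thesis .
      qed
      then obtain r where r: "r \<ge> 0" "e T n = ennreal r"
        by (cases "e T n") auto
      have "e T n = (\<Sum>j\<le>n. ennreal (b j) * Y T j)"
        unfolding e_def Y_def b_def by (rule nn_integral_split_law[OF L_rec[OF n]])
      also have "{..n} = {0, n} \<union> {1..<n}" using n by auto
      also have "(\<Sum>j\<in>{0, n} \<union> {1..<n}. ennreal (b j) * Y T j)
          = ennreal (b 0) * Y T 0 + ennreal (b n) * Y T n + (\<Sum>j\<in>{1..<n}. ennreal (b j) * Y T j)"
        using n by (subst sum.union_disjoint) auto
      also have "\<dots> \<le> ennreal (1/4) * (ennreal (3/2) * e T n + 3) + ennreal (1/4) * (ennreal (3/2) * e T n + 3)
          + (\<Sum>j\<in>{1..<n}. ennreal (3 * (C j + C (n - j) + 1)))"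
      proof (intro add_mono mult_mono sum_mono ennreal_leI b4)
        show "Y T 0 \<le> ennreal (3/2) * e T n + 3" "Y T n \<le> ennreal (3/2) * e T n + 3"
          using edge[of T] by (simp_all add: Y_def L_0 nn_integral_return_pmf)
        fix j assume j: "j \<in> {1..<n}"
        have "ennreal (b j) * Y T j \<le> 1 * ennreal (3 * (C j + C (n - j) + 1))"
          using inner[OF j] b01(2)[of j] by (intro mult_mono) (auto intro: ennreal_le_1[THEN iffD2])
        then show "ennreal (b j) * Y T j \<le> ennreal (3 * (C j + C (n - j) + 1))" by simp
      qed auto
      also have "(\<Sum>j\<in>{1..<n}. ennreal (3 * (C j + C (n - j) + 1))) = ennreal K"
        unfolding K_def by (intro sum_ennreal) (auto simp: C(1))
      also have "ennreal (1/4) * (ennreal (3/2) * e T n + 3) = ennreal (1/4 * (3/2 * r + 3))"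
      proof -
        have "ennreal (1/4 * (3/2 * r + 3)) = ennreal (1/4) * ennreal (3/2 * r + 3)"
          by (rule ennreal_mult) (use r(1) in auto)
        also have "ennreal (3/2 * r + 3) = ennreal (3/2 * r) + ennreal 3"
          by (rule ennreal_plus) (use r(1) in auto)
        also have "ennreal (3/2 * r) = ennreal (3/2) * ennreal r"
          by (rule ennreal_mult) (use r(1) in auto)
        finally show ?thesis by (simp add: r(2))
      qed
      also have "ennreal (1/4 * (3/2 * r + 3)) + ennreal (1/4 * (3/2 * r + 3)) + ennreal K
          = ennreal (3/4 * r + 3/2 + K)"
        using r(1) K0 by (simp flip: ennreal_plus)
      \<comment> \<open>Absorbing \<open>3/4 * r\<close> on the left leaves a bound for
        \<open>r\<close> from which \<open>T\<close> has disappeared.\<close>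
      finally have "r \<le> 3/4 * r + 3/2 + K" using r(1) K0 unfolding r(2) by (subst (asm) ennreal_le_iff) auto
      then show ?thesis unfolding r(2) using K0 by (intro ennreal_leI) simp
    qed
    then show ?thesis using K0 unfolding e_def by (intro exI[of _ "4 * (2 + K)"]) auto
  qed
qed

text \<open>Fatou's lemma removes the truncation, because the bound is uniform in
  \<open>T\<close>.\<close>

lemma second_moment_finite: "(\<integral>\<^sup>+x. ennreal ((real x)\<^sup>2) \<partial>measure_pmf (L n)) < \<top>"
proof -
  obtain C where C: "C \<ge> 0" "\<And>T::nat. (\<integral>\<^sup>+x. ennreal ((real (min x T))\<^sup>2) \<partial>measure_pmf (L n)) \<le> ennreal C"
    using truncated_second_moment_bound[of n] by blast
  have "(\<integral>\<^sup>+x. ennreal ((real x)\<^sup>2) \<partial>measure_pmf (L n))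
      = (\<integral>\<^sup>+x. liminf (\<lambda>T. ennreal ((real (min x T))\<^sup>2)) \<partial>measure_pmf (L n))"
  proof (intro nn_integral_cong)
    fix x
    have "(\<lambda>T. ennreal ((real (min x T))\<^sup>2)) \<longlonglongrightarrow> ennreal ((real x)\<^sup>2)"
      by (rule tendsto_eventually) (auto simp: eventually_sequentially intro!: exI[of _ x])
    then show "ennreal ((real x)\<^sup>2) = liminf (\<lambda>T. ennreal ((real (min x T))\<^sup>2))"
      by (intro lim_imp_Liminf[symmetric]) auto
  qed
  also have "\<dots> \<le> liminf (\<lambda>T. \<integral>\<^sup>+x. ennreal ((real (min x T))\<^sup>2) \<partial>measure_pmf (L n))"
    by (rule nn_integral_liminf) simp
  also have "\<dots> \<le> ennreal C"
    using C(2) by (intro Liminf_le) auto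
  also have "\<dots> < \<top>" by simp
  finally show ?thesis .
qed

definition m1 :: "nat \<Rightarrow> real" where "m1 n = measure_pmf.expectation (L n) real"
definition m2 :: "nat \<Rightarrow> real" where "m2 n = measure_pmf.expectation (L n) (\<lambda>x. (real x)\<^sup>2)"

lemma integrable_moments:
  "integrable (measure_pmf (L n)) (\<lambda>x. (real x)\<^sup>2)" "integrable (measure_pmf (L n)) real"
proof -
  show *: "integrable (measure_pmf (L n)) (\<lambda>x. (real x)\<^sup>2)"
    using second_moment_finite[of n] by (intro integrableI_bounded) auto
  show "integrable (measure_pmf (L n)) real"
  proof (rule Bochner_Integration.integrable_bound[OF *])
    show "AE x in measure_pmf (L n). norm (real x) \<le> norm ((real x)\<^sup>2)"
    proof (rule AE_I2)
      fix x :: nat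
      have "real x * 1 \<le> real x * real x" by (cases x) (auto simp del: mult_1_right mult_Suc mult_Suc_right)
      then show "norm (real x) \<le> norm ((real x)\<^sup>2)" by (simp add: power2_eq_square)
    qed
  qed simp
qed

lemma m1_nonneg: "m1 n \<ge> 0" and m2_nonneg: "m2 n \<ge> 0"
  unfolding m1_def m2_def by (auto intro!: integral_nonneg)

lemma nn_m1: "(\<integral>\<^sup>+x. ennreal (real x) \<partial>measure_pmf (L n)) = ennreal (m1 n)"
  unfolding m1_def by (rule nn_integral_eq_integral) (auto intro: integrable_moments)

lemma nn_m2: "(\<integral>\<^sup>+x. ennreal ((real x)\<^sup>2) \<partial>measure_pmf (L n)) = ennreal (m2 n)"
  unfolding m2_def by (rule nn_integral_eq_integral) (auto intro: integrable_moments)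

lemma m1_rec:
  assumes n: "n \<ge> 2"
  shows "m1 n = (\<Sum>j\<le>n. real (n choose j) / 2 ^ n * (m1 j + m1 (n - j) + 1))"
proof -
  have "ennreal (m1 n) = (\<Sum>j\<le>n. ennreal (real (n choose j) / 2 ^ n) *
      (\<integral>\<^sup>+a. \<integral>\<^sup>+b. ennreal (real a) + ennreal (real b) + 1 \<partial>measure_pmf (L (n - j)) \<partial>measure_pmf (L j)))"
    unfolding nn_m1[symmetric] nn_integral_split_law[OF L_rec[OF n]]
    by (simp add: ennreal_plus add_ac)
  also have "\<dots> = (\<Sum>j\<le>n. ennreal (real (n choose j) / 2 ^ n) * (ennreal (m1 j) + ennreal (m1 (n - j)) + 1))"
    by (simp add: nn_integral_add nn_m1)
  also have "\<dots> = (\<Sum>j\<le>n. ennreal (real (n choose j) / 2 ^ n * (m1 j + m1 (n - j) + 1)))"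
    by (intro sum.cong refl, subst ennreal_mult) (auto simp: ennreal_mult ennreal_plus m1_nonneg)
  also have "\<dots> = ennreal (\<Sum>j\<le>n. real (n choose j) / 2 ^ n * (m1 j + m1 (n - j) + 1))"
    by (intro sum_ennreal) (auto simp: m1_nonneg)
  finally show ?thesis
    by (subst (asm) ennreal_inj) (auto intro!: sum_nonneg simp: m1_nonneg)
qed

lemma m2_rec:
  assumes n: "n \<ge> 2"
  shows "m2 n = (\<Sum>j\<le>n. real (n choose j) / 2 ^ n *
    (m2 j + m2 (n - j) + 1 + 2 * m1 j * m1 (n - j) + 2 * m1 j + 2 * m1 (n - j)))"
proof -
  have sq: "ennreal ((real (a + b + 1))\<^sup>2) = ennreal ((real a)\<^sup>2) + ennreal ((real b)\<^sup>2) + 1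
      + 2 * ennreal (real a) * ennreal (real b) + 2 * ennreal (real a) + 2 * ennreal (real b)" for a b
  proof -
    have "(real (a + b + 1))\<^sup>2 = (real a)\<^sup>2 + (real b)\<^sup>2 + 1 + 2 * real a * real b + 2 * real a + 2 * real b"
      by (simp add: power2_eq_square algebra_simps)
    then show ?thesis by (simp only:) (simp add: ennreal_plus ennreal_mult)
  qed
  have "ennreal (m2 n) = (\<Sum>j\<le>n. ennreal (real (n choose j) / 2 ^ n) *
      (\<integral>\<^sup>+a. \<integral>\<^sup>+b. ennreal ((real a)\<^sup>2) + ennreal ((real b)\<^sup>2) + 1
      + 2 * ennreal (real a) * ennreal (real b) + 2 * ennreal (real a) + 2 * ennreal (real b) \<partial>measure_pmf (L (n - j)) \<partial>measure_pmf (L j)))"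
    unfolding nn_m2[symmetric] nn_integral_split_law[OF L_rec[OF n]] sq ..
  also have "\<dots> = (\<Sum>j\<le>n. ennreal (real (n choose j) / 2 ^ n) *
     (ennreal (m2 j) + ennreal (m2 (n - j)) + 1 + 2 * ennreal (m1 j) * ennreal (m1 (n - j))
       + 2 * ennreal (m1 j) + 2 * ennreal (m1 (n - j))))"
    by (simp add: nn_integral_add nn_integral_cmult nn_integral_multc nn_m1 nn_m2)
  also have "\<dots> = (\<Sum>j\<le>n. ennreal (real (n choose j) / 2 ^ n *
    (m2 j + m2 (n - j) + 1 + 2 * m1 j * m1 (n - j) + 2 * m1 j + 2 * m1 (n - j))))"
    by (intro sum.cong refl, subst ennreal_mult) (auto simp: ennreal_mult ennreal_plus m1_nonneg m2_nonneg)
  also have "\<dots> = ennreal (\<Sum>j\<le>n. real (n choose j) / 2 ^ n *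
    (m2 j + m2 (n - j) + 1 + 2 * m1 j * m1 (n - j) + 2 * m1 j + 2 * m1 (n - j)))"
    by (intro sum_ennreal) (auto simp: m1_nonneg m2_nonneg)
  finally show ?thesis
    by (subst (asm) ennreal_inj) (auto intro!: sum_nonneg simp: m1_nonneg m2_nonneg)
qed

lemma m_0: "m1 0 = 0" "m2 0 = 0" "m1 (Suc 0) = 0" "m2 (Suc 0) = 0"
  by (simp_all add: m1_def m2_def L_0 L_1)

end

section \<open>Occupancy probabilities of cells\<close>

text \<open>
  For a ball landing in a cell with probability \<open>p\<close>, \<open>few n p\<close> is the probability that at most
  one of \<open>n\<close> independent balls does; \<open>few2 n p r\<close> is the probability that this happens simultaneously
  for two disjoint cells.
\<close>

definition few :: "nat \<Rightarrow> real \<Rightarrow> real" where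
  "few n p = (1 - p) ^ n + real n * p * (1 - p) ^ (n - 1)"

definition few2 :: "nat \<Rightarrow> real \<Rightarrow> real \<Rightarrow> real" where
  "few2 n p r = (1 - p - r) ^ n + real n * (p + r) * (1 - p - r) ^ (n - 1)
      + real n * (real n - 1) * p * r * (1 - p - r) ^ (n - 2)"

definition few_cov :: "nat \<Rightarrow> real \<Rightarrow> real \<Rightarrow> real" where
  "few_cov n p r = few2 n p r - few n p * few n r"

text \<open>This is the mixed partial derivative in \<open>a\<close> and \<open>b\<close> of the
  binomial formula for \<open>(a + b)^n\<close>. The truncated exponents do no harm: wherever a
  subtraction would leave the naturals, the coefficient in front is 0.\<close>

lemma binomial_sum_mixed:
  fixes a b :: real
  shows "(\<Sum>j\<le>n. real (n choose j) * (real j * a ^ (j - 1)) * (real (n - j) * b ^ (n - j - 1)))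
       = real n * (real n - 1) * (a + b) ^ (n - 2)"
proof -
  consider "n = 0" | "n = Suc 0" | k where "n = Suc (Suc k)"
    by (metis not0_implies_Suc)
  then show ?thesis
  proof cases
    case (3 k)
    have "(\<Sum>j\<le>n. real (n choose j) * (real j * a ^ (j - 1)) * (real (n - j) * b ^ (n - j - 1)))
      = (\<Sum>j\<le>Suc k. real (Suc (Suc k) choose Suc j) * (real (Suc j) * a ^ j) * (real (Suc k - j) * b ^ (Suc k - j - 1)))"
      unfolding 3 by (subst sum.atMost_Suc_shift) simp
    also have "\<dots> = (\<Sum>j\<le>k. real (Suc (Suc k) choose Suc j) * (real (Suc j) * a ^ j) * (real (Suc k - j) * b ^ (k - j)))"
      by (subst sum.atMost_Suc) (auto intro!: sum.cong)
    also have "\<dots> = (\<Sum>j\<le>k. real n * (real n - 1) * (real (k choose j) * a ^ j * b ^ (k - j)))"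
    proof (intro sum.cong refl)
      fix j assume j: "j \<in> {..k}"
      have "Suc j * (Suc (Suc k) choose Suc j) * (Suc k - j) = Suc (Suc k) * ((Suc k choose j) * (Suc k - j))"
        by (simp only: Suc_times_binomial mult.assoc)
      also have "(Suc k choose j) * (Suc k - j) = Suc k * (k choose j)"
        using binomial_absorb_comp[of "Suc k" j] by (simp add: mult.commute)
      finally have "real (Suc j) * real (Suc (Suc k) choose Suc j) * real (Suc k - j)
          = real (Suc (Suc k)) * (real (Suc k) * real (k choose j))"
        by (metis of_nat_mult)
      moreover have "real n * (real n - 1) = real (Suc (Suc k)) * real (Suc k)" by (simp add: 3)
      ultimately have "real (Suc j) * real (Suc (Suc k) choose Suc j) * real (Suc k - j)
          = real n * (real n - 1) * real (k choose j)" by (simp only: mult.assoc)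
      then have "(real (Suc j) * real (Suc (Suc k) choose Suc j) * real (Suc k - j)) * (a ^ j * b ^ (k - j))
          = (real n * (real n - 1) * real (k choose j)) * (a ^ j * b ^ (k - j))" by (rule arg_cong)
      then show "real (Suc (Suc k) choose Suc j) * (real (Suc j) * a ^ j) * (real (Suc k - j) * b ^ (k - j))
          = real n * (real n - 1) * (real (k choose j) * a ^ j * b ^ (k - j))"
        by (simp only: mult_ac)
    qed
    also have "\<dots> = real n * (real n - 1) * (a + b) ^ (n - 2)"
      by (simp add: sum_distrib_left[symmetric] binomial_ring 3)
    finally show ?thesis .
  qed auto
qed

text \<open>Each ball chooses a side by a fair coin. A cell of probability \<open>p\<close> inside
  the left side and one of probability \<open>r\<close> inside the right side are, seen from the
  root, disjoint cells of probabilities \<open>p / 2\<close> and \<open>r / 2\<close>.\<close>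

lemma few_thinning2:
  "(\<Sum>j\<le>n. real (n choose j) / 2 ^ n * (few j p * few (n - j) r)) = few2 n (p / 2) (r / 2)"
proof -
  define a b where "a = 1 - p" and "b = 1 - r"
  have s1: "(\<Sum>j\<le>n. real (n choose j) * a ^ j * b ^ (n - j)) = (a + b) ^ n"
    by (simp add: binomial_ring)
  have s2: "(\<Sum>j\<le>n. real (n choose j) * (real j * a ^ (j - 1)) * b ^ (n - j)) = real n * (a + b) ^ (n - 1)"
    using binomial_deriv1[of n a b] by (simp add: mult_ac)
  have s3: "(\<Sum>j\<le>n. real (n choose j) * a ^ j * (real (n - j) * b ^ (n - j - 1))) = real n * (a + b) ^ (n - 1)"
  proof -
    have "(\<Sum>j\<le>n. real (n choose j) * a ^ j * (real (n - j) * b ^ (n - j - 1)))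
        = (\<Sum>j\<le>n. real (n choose j) * (real j * b ^ (j - 1)) * a ^ (n - j))"
      by (rule sum.reindex_bij_witness[of _ "\<lambda>j. n - j" "\<lambda>j. n - j"]) (auto simp: binomial_symmetric[symmetric])
    then show ?thesis using binomial_deriv1[of n b a] by (simp add: mult_ac add_ac)
  qed
  have "(\<Sum>j\<le>n. real (n choose j) * (few j p * few (n - j) r))
    = (\<Sum>j\<le>n. real (n choose j) * a ^ j * b ^ (n - j)
        + p * (real (n choose j) * (real j * a ^ (j - 1)) * b ^ (n - j))
        + r * (real (n choose j) * a ^ j * (real (n - j) * b ^ (n - j - 1)))
        + p * r * (real (n choose j) * (real j * a ^ (j - 1)) * (real (n - j) * b ^ (n - j - 1))))"
    unfolding few_def a_def b_def by (intro sum.cong refl) (simp add: algebra_simps)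
  also have "\<dots> = (a + b) ^ n + p * (real n * (a + b) ^ (n - 1)) + r * (real n * (a + b) ^ (n - 1))
      + p * r * (real n * (real n - 1) * (a + b) ^ (n - 2))"
    unfolding sum.distrib sum_distrib_left[symmetric] s1 s2 s3 binomial_sum_mixed ..
  finally have *: "(\<Sum>j\<le>n. real (n choose j) * (few j p * few (n - j) r)) = \<dots>" .
  have "a + b = 2 * (1 - p / 2 - r / 2)" by (simp add: a_def b_def)
  then have ab: "(a + b) ^ k = 2 ^ k * (1 - p / 2 - r / 2) ^ k" for k
    by (simp only: power_mult_distrib)
  consider "n = 0" | "n = Suc 0" | k where "n = Suc (Suc k)"
    by (metis not0_implies_Suc)
  then have "((a + b) ^ n + p * (real n * (a + b) ^ (n - 1)) + r * (real n * (a + b) ^ (n - 1))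
      + p * r * (real n * (real n - 1) * (a + b) ^ (n - 2))) / 2 ^ n = few2 n (p / 2) (r / 2)"
    unfolding ab few2_def by cases (auto simp: field_simps)
  moreover have "(\<Sum>j\<le>n. real (n choose j) / 2 ^ n * (few j p * few (n - j) r))
     = (\<Sum>j\<le>n. real (n choose j) * (few j p * few (n - j) r)) / 2 ^ n"
    by (simp add: sum_divide_distrib)
  ultimately show ?thesis using * by simp
qed

lemma few_0 [simp]: "few n 0 = 1"
  by (simp add: few_def)

lemma few_thinning: "(\<Sum>j\<le>n. real (n choose j) / 2 ^ n * few j p) = few n (p / 2)"
  using few_thinning2[of n p 0] by (simp add: few2_def few_def)

text \<open>
  Coefficients modulo \<open>x\<^sup>2, y\<^sup>2\<close> of \<open>F\<^sup>m G\<^sup>l\<close>, where \<open>F = (1 - p + p x) (1 - r + r y)\<close> describes a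
  ball which may fall into both cells independently and \<open>G = 1 - p - r + p x + r y\<close> a ball for which
  the cells exclude each other. Since \<open>F - G = p r (1 - x) (1 - y)\<close>, replacing one factor \<open>G\<close> by \<open>F\<close>
  changes the sum of the four coefficients by \<open>p r\<close> times the coefficient of \<open>x y\<close>.
\<close>

definition pow_deriv :: "real \<Rightarrow> nat \<Rightarrow> real" where
  "pow_deriv x m = real m * x ^ (m - 1)"

definition pow_deriv2 :: "real \<Rightarrow> nat \<Rightarrow> real" where
  "pow_deriv2 x m = real m * (real m - 1) * x ^ (m - 2)"

lemma pow_deriv_simps: "pow_deriv x 0 = 0" "pow_deriv x (Suc m) = x * pow_deriv x m + x ^ m"
  by (cases m; simp add: pow_deriv_def algebra_simps)+

lemma pow_deriv2_simps: "pow_deriv2 x 0 = 0" "pow_deriv2 x (Suc m) = x * pow_deriv2 x m + 2 * pow_deriv x m"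
proof -
  show "pow_deriv2 x 0 = 0" by (simp add: pow_deriv2_def)
  consider "m = 0" | "m = Suc 0" | k where "m = Suc (Suc k)"
    by (metis not0_implies_Suc)
  then show "pow_deriv2 x (Suc m) = x * pow_deriv2 x m + 2 * pow_deriv x m"
    by cases (auto simp: pow_deriv2_def pow_deriv_def algebra_simps)
qed

definition mixed_coeff :: "real \<Rightarrow> real \<Rightarrow> nat \<Rightarrow> nat \<Rightarrow> real" where
  "mixed_coeff p r m l = p * r *
     (pow_deriv (1 - p) m * pow_deriv (1 - r) m * (1 - p - r) ^ l
      + (1 - p) ^ m * (1 - r) ^ m * pow_deriv2 (1 - p - r) l
      + pow_deriv (1 - p) m * (1 - r) ^ m * pow_deriv (1 - p - r) l
      + (1 - p) ^ m * pow_deriv (1 - r) m * pow_deriv (1 - p - r) l)"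

definition mixed_few :: "real \<Rightarrow> real \<Rightarrow> nat \<Rightarrow> nat \<Rightarrow> real" where
  "mixed_few p r m l = (1 - p) ^ m * (1 - r) ^ m * (1 - p - r) ^ l
     + p * (pow_deriv (1 - p) m * (1 - r) ^ m * (1 - p - r) ^ l
            + (1 - p) ^ m * (1 - r) ^ m * pow_deriv (1 - p - r) l)
     + r * ((1 - p) ^ m * pow_deriv (1 - r) m * (1 - p - r) ^ l
            + (1 - p) ^ m * (1 - r) ^ m * pow_deriv (1 - p - r) l)
     + mixed_coeff p r m l"

lemma mixed_few_step:
  "mixed_few p r m (Suc l) - mixed_few p r (Suc m) l = - (p * r * mixed_coeff p r m l)"
proof -
  define u v w where "u = 1 - p" and "v = 1 - r" and "w = 1 - p - r"
  define U V W U' V' W' W2 where "U = u ^ m" and "V = v ^ m" and "W = w ^ l" and "U' = pow_deriv u m"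
    and "V' = pow_deriv v m" and "W' = pow_deriv w l" and "W2 = pow_deriv2 w l"
  show ?thesis
    unfolding mixed_few_def mixed_coeff_def pow_deriv_simps pow_deriv2_simps power_Suc u_def[symmetric]
      v_def[symmetric] w_def[symmetric] U_def[symmetric] V_def[symmetric] W_def[symmetric]
      U'_def[symmetric] V'_def[symmetric] W'_def[symmetric] W2_def[symmetric]
    unfolding u_def v_def w_def by (simp add: algebra_simps)
qed

text \<open>All factors equal to \<open>G\<close> give \<open>few2\<close>, all factors equal to
  \<open>F\<close> give the product of the two \<open>few\<close>; the difference telescopes along
  the mixed products.\<close>

lemma few_cov_eq: "few_cov n p r = - (p * r * (\<Sum>m<n. mixed_coeff p r m (n - Suc m)))"
proof -
  have "mixed_few p r 0 n - mixed_few p r n 0 = (\<Sum>m<n. mixed_few p r m (n - m) - mixed_few p r (Suc m) (n - Suc m))"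
    by (subst sum_lessThan_telescope') simp
  also have "\<dots> = (\<Sum>m<n. - (p * r * mixed_coeff p r m (n - Suc m)))"
  proof (intro sum.cong refl)
    fix m assume "m \<in> {..<n}"
    then have "n - m = Suc (n - Suc m)" by auto
    then show "mixed_few p r m (n - m) - mixed_few p r (Suc m) (n - Suc m) = - (p * r * mixed_coeff p r m (n - Suc m))"
      using mixed_few_step[of p r m "n - Suc m"] by simp
  qed
  finally have "mixed_few p r 0 n - mixed_few p r n 0 = - (p * r * (\<Sum>m<n. mixed_coeff p r m (n - Suc m)))"
    by (simp add: sum_negf sum_distrib_left)
  moreover have "mixed_few p r 0 n = few2 n p r"
    by (simp add: mixed_few_def mixed_coeff_def few2_def pow_deriv_def pow_deriv2_def algebra_simps)
  moreover have "mixed_few p r n 0 = few n p * few n r"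
    by (simp add: mixed_few_def mixed_coeff_def few_def pow_deriv_def pow_deriv2_def algebra_simps)
  ultimately show ?thesis by (simp add: few_cov_def)
qed

text \<open>The four terms of \<open>mixed_coeff\<close> carry the counts \<open>m^2\<close>,
  \<open>l (l - 1)\<close>, \<open>m l\<close> and \<open>m l\<close>, which add up to
  \<open>(m + l)^2 - l\<close>. Their powers are products of \<open>u\<close>, \<open>v\<close> and
  \<open>w\<close> with \<open>w <= u v\<close>, so each term with a nonzero count lies between
  \<open>w^(m + l)\<close> and \<open>(u v)^(m + l - 2)\<close>.\<close>

lemma mixed_coeff_bounds:
  assumes p: "0 \<le> p" "0 \<le> r" "p + r \<le> 1"
  shows "mixed_coeff p r m l \<le> p * r * (real (m + l))\<^sup>2 * ((1 - p) * (1 - r)) ^ (m + l - 2)"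
    and "mixed_coeff p r m l \<ge> p * r * ((real (m + l))\<^sup>2 - real l) * (1 - p - r) ^ (m + l)"
proof -
  define u v w where "u = 1 - p" and "v = 1 - r" and "w = 1 - p - r"
  have w: "0 \<le> w" "w \<le> 1" "0 \<le> u" "u \<le> 1" "0 \<le> v" "v \<le> 1" using p by (auto simp: u_def v_def w_def)
  have wuv: "w \<le> u * v" using p by (simp add: u_def v_def w_def algebra_simps)
  have uv: "0 \<le> u * v" "u * v \<le> 1" using w by (auto intro: mult_le_one)
  have wu: "w \<le> u" "w \<le> v" using p by (auto simp: u_def v_def w_def)
  define T where "T = (u * v) ^ (m + l - 2)"
  define S where "S = w ^ (m + l)"
  have mono: "x ^ i * y ^ j \<le> z ^ k" if "0 \<le> x" "0 \<le> y" "x \<le> z" "y \<le> z" "z \<le> 1" "i + j \<ge> k" for x y z :: real and i j k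
  proof -
    have "x ^ i * y ^ j \<le> z ^ i * z ^ j" using that by (intro mult_mono power_mono) auto
    also have "\<dots> = z ^ (i + j)" by (simp add: power_add)
    also have "\<dots> \<le> z ^ k" using that by (intro power_decreasing) auto
    finally show ?thesis .
  qed
  have mono': "w ^ k \<le> x ^ i * y ^ j" if "w \<le> x" "w \<le> y" "i + j \<le> k" for x y :: real and i j k
  proof -
    have "w ^ k \<le> w ^ (i + j)" using that w by (intro power_decreasing) auto
    also have "\<dots> \<le> x ^ i * y ^ j" unfolding power_add using that w by (intro mult_mono power_mono) auto
    finally show ?thesis .
  qed
  have c: "mixed_coeff p r m l = p * r *
     (real m * real m * ((u * v) ^ (m - 1) * w ^ l)
      + real l * (real l - 1) * ((u * v) ^ m * w ^ (l - 2))
      + real m * real l * (u ^ (m - 1) * (v ^ m * w ^ (l - 1)))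
      + real m * real l * (v ^ (m - 1) * (u ^ m * w ^ (l - 1))))"
    by (simp add: mixed_coeff_def pow_deriv_def pow_deriv2_def u_def v_def w_def power_mult_distrib mult_ac)
  have l: "real l * (real l - 1) \<ge> 0" by (cases l) auto
  have U1: "real m * real m * ((u * v) ^ (m - 1) * w ^ l) \<le> real m * real m * T"
    unfolding T_def using w wuv uv by (cases "m = 0") (auto intro!: mult_left_mono mono)
  have U2: "real l * (real l - 1) * ((u * v) ^ m * w ^ (l - 2)) \<le> real l * (real l - 1) * T"
  proof (cases "l \<ge> 2")
    case True
    then show ?thesis unfolding T_def using w wuv uv l by (intro mult_left_mono mono) auto
  next
    case False
    then have "l = 0 \<or> l = 1" by auto
    then show ?thesis by auto
  qed
  have U3: "real m * real l * (x ^ (m - 1) * (y ^ m * w ^ (l - 1))) \<le> real m * real l * T"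
    if "x * y = u * v" "0 \<le> x" "0 \<le> y" "y \<le> 1" for x y
  proof (cases "m = 0 \<or> l = 0")
    case False
    \<comment> \<open>After pairing the factors as \<open>x y = u v\<close>, a single
      \<open>y\<close> is left over, which is bounded by 1.\<close>
    have "x ^ (m - 1) * (y ^ m * w ^ (l - 1)) = (u * v) ^ (m - 1) * w ^ (l - 1) * y"
      using False by (cases m) (auto simp: power_mult_distrib mult_ac that(1)[symmetric])
    also have "\<dots> \<le> T * 1"
      unfolding T_def using that False w wuv uv by (intro mult_mono mono) auto
    finally show ?thesis by (intro mult_left_mono) auto
  qed auto
  have "mixed_coeff p r m l \<le> p * r * (real m * real m * T + real l * (real l - 1) * T + real m * real l * T + real m * real l * T)"
    unfolding c using p w by (intro mult_left_mono add_mono U1 U2 U3) (auto simp: mult.commute)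
  also have "\<dots> = p * r * ((real (m + l))\<^sup>2 - real l) * T" by (simp add: power2_eq_square algebra_simps)
  also have "\<dots> \<le> p * r * (real (m + l))\<^sup>2 * T"
    using p w by (intro mult_right_mono mult_left_mono) (auto simp: T_def)
  finally show "mixed_coeff p r m l \<le> p * r * (real (m + l))\<^sup>2 * ((1 - p) * (1 - r)) ^ (m + l - 2)"
    by (simp add: T_def u_def v_def)
  have L3: "S \<le> x ^ (m - 1) * (y ^ m * w ^ (l - 1))" if "x * y = u * v" "w \<le> y" "m > 0" for x y
  proof -
    have "S \<le> w ^ (m - 1 + (l - 1)) * w"
      unfolding S_def power_Suc2[symmetric] using that w by (intro power_decreasing) auto
    also have "\<dots> \<le> ((u * v) ^ (m - 1) * w ^ (l - 1)) * y"
      using that w wuv uv by (intro mult_mono mono') auto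
    also have "\<dots> = x ^ (m - 1) * (y ^ m * w ^ (l - 1))"
      using that(3) by (cases m) (auto simp: power_mult_distrib mult_ac that(1)[symmetric])
    finally show ?thesis .
  qed
  have B1: "real m * real m * S \<le> real m * real m * ((u * v) ^ (m - 1) * w ^ l)"
    unfolding S_def using w wuv by (intro mult_left_mono mono') auto
  have B2: "real l * (real l - 1) * S \<le> real l * (real l - 1) * ((u * v) ^ m * w ^ (l - 2))"
    unfolding S_def using w wuv l by (intro mult_left_mono mono') auto
  have B3: "real m * real l * S \<le> real m * real l * (u ^ (m - 1) * (v ^ m * w ^ (l - 1)))"
    "real m * real l * S \<le> real m * real l * (v ^ (m - 1) * (u ^ m * w ^ (l - 1)))"
    using L3[of u v] L3[of v u] wu mult.commute[of v u] by (cases "m = 0"; auto intro!: mult_left_mono)+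
  have "p * r * ((real (m + l))\<^sup>2 - real l) * S =
     p * r * (real m * real m * S + real l * (real l - 1) * S + real m * real l * S + real m * real l * S)"
    by (simp add: power2_eq_square algebra_simps)
  also have "\<dots> \<le> mixed_coeff p r m l"
    unfolding c
    using p by (intro mult_left_mono[OF add_mono[OF add_mono[OF add_mono]]] B1 B2 B3) auto
  finally show "mixed_coeff p r m l \<ge> p * r * ((real (m + l))\<^sup>2 - real l) * (1 - p - r) ^ (m + l)"
    by (simp add: S_def w_def)
qed

text \<open>Each of the \<open>n\<close> summands of \<open>few_cov_eq\<close> has
  \<open>m + l = n - 1\<close>, hence the exponent \<open>n - 3\<close> above. The count
  \<open>(n - 1)^2 - l\<close> is at least \<open>(n - 1) (n - 2)\<close>, hence the product
  \<open>n (n - 1) (n - 2)\<close> below.\<close>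

lemma few_cov_bounds:
  assumes p: "0 \<le> p" "0 \<le> r" "p + r \<le> 1" and n: "n \<ge> 1"
  shows "- few_cov n p r \<le> (p * r)\<^sup>2 * real n ^ 3 * ((1 - p) * (1 - r)) ^ (n - 3)"
    and "- few_cov n p r \<ge> (p * r)\<^sup>2 * (real n * (real n - 1) * (real n - 2)) * (1 - p - r) ^ n"
proof -
  have pr: "p * r \<ge> 0" using p by auto
  have "(\<Sum>m<n. mixed_coeff p r m (n - Suc m)) \<le> (\<Sum>m<n. p * r * (real n)\<^sup>2 * ((1 - p) * (1 - r)) ^ (n - 3))"
  proof (rule sum_mono)
    fix m assume "m \<in> {..<n}"
    then have m: "m + (n - Suc m) = n - 1" by auto
    have "mixed_coeff p r m (n - Suc m) \<le> p * r * (real (n - 1))\<^sup>2 * ((1 - p) * (1 - r)) ^ (n - 3)"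
      using mixed_coeff_bounds(1)[OF p, of m "n - Suc m"] unfolding m by (simp add: numeral_3_eq_3)
    also have "\<dots> \<le> p * r * (real n)\<^sup>2 * ((1 - p) * (1 - r)) ^ (n - 3)"
      using p by (intro mult_right_mono mult_left_mono power_mono) auto
    finally show "mixed_coeff p r m (n - Suc m) \<le> p * r * (real n)\<^sup>2 * ((1 - p) * (1 - r)) ^ (n - 3)" .
  qed
  from mult_left_mono[OF this pr]
  show "- few_cov n p r \<le> (p * r)\<^sup>2 * real n ^ 3 * ((1 - p) * (1 - r)) ^ (n - 3)"
    by (simp add: few_cov_eq power2_eq_square power3_eq_cube mult_ac)
  have "(\<Sum>m<n. p * r * ((real n - 1) * (real n - 2)) * (1 - p - r) ^ n) \<le> (\<Sum>m<n. mixed_coeff p r m (n - Suc m))"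
  proof (rule sum_mono)
    fix m assume mn: "m \<in> {..<n}"
    then have m: "m + (n - Suc m) = n - 1" by auto
    have "(real n - 1) * (real n - 2) = (real (n - 1))\<^sup>2 - real (n - 1)"
      using n by (simp add: of_nat_diff power2_eq_square algebra_simps)
    also have "\<dots> \<le> (real (n - 1))\<^sup>2 - real (n - Suc m)" by auto
    finally have 1: "(real n - 1) * (real n - 2) \<le> (real (n - 1))\<^sup>2 - real (n - Suc m)" .
    have 2: "(1 - p - r) ^ n \<le> (1 - p - r) ^ (n - 1)" using p by (intro power_decreasing) auto
    have 3: "0 \<le> (real (n - 1))\<^sup>2 - real (n - Suc m)"
    proof -
      have "real (n - Suc m) \<le> real (n - 1)" by auto
      also have "\<dots> \<le> (real (n - 1))\<^sup>2" by (cases "n - 1") (auto simp: power2_eq_square algebra_simps)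
      finally show ?thesis by simp
    qed
    have "p * r * ((real n - 1) * (real n - 2)) * (1 - p - r) ^ n
       \<le> p * r * ((real (n - 1))\<^sup>2 - real (n - Suc m)) * (1 - p - r) ^ (n - 1)"
      using p 1 2 3 by (intro mult_mono mult_left_mono) auto
    also have "\<dots> \<le> mixed_coeff p r m (n - Suc m)"
      using mixed_coeff_bounds(2)[OF p, of m "n - Suc m"] unfolding m by simp
    finally show "p * r * ((real n - 1) * (real n - 2)) * (1 - p - r) ^ n \<le> mixed_coeff p r m (n - Suc m)" .
  qed
  from mult_left_mono[OF this pr]
  show "- few_cov n p r \<ge> (p * r)\<^sup>2 * (real n * (real n - 1) * (real n - 2)) * (1 - p - r) ^ n"
    by (simp add: few_cov_eq power2_eq_square mult_ac)
qed

lemma few_eq: "n \<ge> 1 \<Longrightarrow> few n p = (1 - p) ^ (n - 1) * (1 + (real n - 1) * p)"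
  by (cases n) (auto simp: few_def algebra_simps)

text \<open>With \<open>m = n - 1\<close>, Bernoulli's inequality for \<open>1 + p\<close> gives the
  bound 1 through \<open>(1 - p^2)^m\<close>, and Bernoulli's inequality for \<open>1 - p\<close>
  gives the lower bound \<open>1 - (m p)^2\<close>.\<close>

lemma few_bounds:
  assumes "0 \<le> p" "p \<le> 1"
  shows "0 \<le> few n p" "few n p \<le> 1" "1 - few n p \<le> (real n * p)\<^sup>2"
proof -
  show "0 \<le> few n p" unfolding few_def using assms by auto
  have "few n p \<le> 1 \<and> 1 - few n p \<le> (real n * p)\<^sup>2"
  proof (cases n)
    case 0
    then show ?thesis by (simp add: few_def)
  next
    case (Suc m)
    have f: "few n p = (1 - p) ^ m * (1 + real m * p)"
      by (simp add: Suc few_def algebra_simps)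
    have 1: "1 + real m * p \<le> (1 + p) ^ m" using Bernoulli_inequality[of p m] assms by simp
    have "few n p \<le> (1 - p) ^ m * (1 + p) ^ m"
      unfolding f using assms by (intro mult_left_mono 1) auto
    also have "\<dots> = (1 - p * p) ^ m" by (simp add: power_mult_distrib[symmetric] algebra_simps)
    also have "\<dots> \<le> 1" using assms by (intro power_le_one) (auto simp: mult_le_one)
    finally have a: "few n p \<le> 1" .
    have 2: "1 - real m * p \<le> (1 - p) ^ m" using Bernoulli_inequality[of "-p" m] assms by simp
    have "1 - (real m * p)\<^sup>2 = (1 - real m * p) * (1 + real m * p)" by (simp add: power2_eq_square algebra_simps)
    also have "\<dots> \<le> few n p" unfolding f using assms by (intro mult_right_mono 2) auto
    finally have "1 - few n p \<le> (real m * p)\<^sup>2" by simp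
    also have "\<dots> \<le> (real n * p)\<^sup>2" using assms by (intro power_mono mult_right_mono) (auto simp: Suc)
    finally show ?thesis using a by simp
  qed
  then show "few n p \<le> 1" "1 - few n p \<le> (real n * p)\<^sup>2" by auto
qed

text \<open>The lower bound for \<open>- few_cov\<close> is nonnegative: the two events are
  negatively correlated, and only the other side has to be estimated.\<close>

lemma few_cov_abs_le:
  assumes "0 \<le> p" "0 \<le> r" "p + r \<le> 1"
  shows "\<bar>few_cov n p r\<bar> \<le> (p * r)\<^sup>2 * real n ^ 3"
proof (cases "n = 0")
  case True
  then show ?thesis by (simp add: few_cov_def few2_def few_def)
next
  case False
  then have n: "n \<ge> 1" by simp
  have "real n * (real n - 1) * (real n - 2) \<ge> 0"
  proof (cases "n = 1")
    case False
    then have "n \<ge> 2" using n by auto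
    then show ?thesis by (intro mult_nonneg_nonneg) auto
  qed auto
  then have "0 \<le> (p * r)\<^sup>2 * (real n * (real n - 1) * (real n - 2)) * (1 - p - r) ^ n"
    using assms by auto
  also have "\<dots> \<le> - few_cov n p r" by (rule few_cov_bounds(2)[OF assms n])
  finally have neg: "few_cov n p r \<le> 0" by simp
  have "- few_cov n p r \<le> (p * r)\<^sup>2 * real n ^ 3 * ((1 - p) * (1 - r)) ^ (n - 3)"
    by (rule few_cov_bounds(1)[OF assms n])
  also have "\<dots> \<le> (p * r)\<^sup>2 * real n ^ 3 * 1"
    using assms by (intro mult_left_mono power_le_one mult_le_one) auto
  finally show ?thesis using neg by simp
qed

text \<open>Here both cells lie inside the same side, in contrast to \<open>few_thinning2\<close>.
  The three sums are the binomial formula at \<open>(a, 1)\<close> and its first two derivatives in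
  \<open>a\<close>.\<close>

lemma few2_thinning: "(\<Sum>j\<le>n. real (n choose j) / 2 ^ n * few2 j p r) = few2 n (p / 2) (r / 2)"
proof -
  define a where "a = 1 - p - r"
  have s1: "(\<Sum>j\<le>n. real (n choose j) * a ^ j) = (a + 1) ^ n"
    using binomial_ring[of a 1 n] by simp
  have s2: "(\<Sum>j\<le>n. real (n choose j) * (real j * a ^ (j - 1))) = real n * (a + 1) ^ (n - 1)"
    using binomial_deriv1[of n a 1] by (simp add: mult_ac)
  have s3: "(\<Sum>j\<le>n. real (n choose j) * (real j * (real j - 1) * a ^ (j - 2))) = real n * (real n - 1) * (a + 1) ^ (n - 2)"
  proof -
    have e: "real j * (real j - 1) = real j * real (j - 1)" for j by (cases j) auto
    show ?thesis unfolding e using binomial_deriv2[of n a 1] by (simp add: mult_ac)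
  qed
  have "(\<Sum>j\<le>n. real (n choose j) * few2 j p r)
    = (\<Sum>j\<le>n. real (n choose j) * a ^ j + (p + r) * (real (n choose j) * (real j * a ^ (j - 1)))
        + p * r * (real (n choose j) * (real j * (real j - 1) * a ^ (j - 2))))"
    unfolding few2_def a_def by (intro sum.cong refl) (simp add: algebra_simps)
  also have "\<dots> = (a + 1) ^ n + (p + r) * (real n * (a + 1) ^ (n - 1))
      + p * r * (real n * (real n - 1) * (a + 1) ^ (n - 2))"
    unfolding sum.distrib sum_distrib_left[symmetric] s1 s2 s3 ..
  finally have *: "(\<Sum>j\<le>n. real (n choose j) * few2 j p r) = \<dots>" .
  have "a + 1 = 2 * (1 - p / 2 - r / 2)" by (simp add: a_def)
  then have ab: "(a + 1) ^ k = 2 ^ k * (1 - p / 2 - r / 2) ^ k" for k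
    by (simp only: power_mult_distrib)
  consider "n = 0" | "n = Suc 0" | k where "n = Suc (Suc k)"
    by (metis not0_implies_Suc)
  then have "((a + 1) ^ n + (p + r) * (real n * (a + 1) ^ (n - 1))
      + p * r * (real n * (real n - 1) * (a + 1) ^ (n - 2))) / 2 ^ n = few2 n (p / 2) (r / 2)"
    unfolding ab few2_def by cases (auto simp: field_simps)
  moreover have "(\<Sum>j\<le>n. real (n choose j) / 2 ^ n * few2 j p r)
     = (\<Sum>j\<le>n. real (n choose j) * few2 j p r) / 2 ^ n"
    by (simp add: sum_divide_distrib)
  ultimately show ?thesis using * by simp
qed

section \<open>Probabilities of shared words under the first split\<close>

definition many :: "nat \<Rightarrow> nat \<Rightarrow> real" where
  "many n k = 1 - few n (1 / 2 ^ k)"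

text \<open>For \<open>k, l >= 1\<close> this is the probability that two given incomparable words
  of lengths \<open>k\<close> and \<open>l\<close> are both shared. Complementing both events leaves
  their covariance unchanged, so \<open>few_cov\<close> may stand in for the covariance of the
  shared events.\<close>

definition many2 :: "nat \<Rightarrow> nat \<Rightarrow> nat \<Rightarrow> real" where
  "many2 n k l = few_cov n (1 / 2 ^ k) (1 / 2 ^ l) + many n k * many n l"

lemma many_nonneg: "0 \<le> many n k" and many_le: "many n k \<le> (real n / 2 ^ k)\<^sup>2"
  using few_bounds[of "1 / 2 ^ k" n] by (auto simp: many_def)

lemma sum_split_weights: "(\<Sum>j\<le>n. real (n choose j) / 2 ^ n) = 1"
  using few_thinning[of n 0] by simp

lemma few_thinning': "(\<Sum>j\<le>n. real (n choose j) / 2 ^ n * few (n - j) r) = few n (r / 2)"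
  using few_thinning2[of n 0 r] by (simp add: few2_def few_def)

lemma many2_eq: "many2 n k l = 1 - few n (1 / 2 ^ k) - few n (1 / 2 ^ l) + few2 n (1 / 2 ^ k) (1 / 2 ^ l)"
  by (simp add: many2_def many_def few_cov_def algebra_simps)

lemma many_thinning: "(\<Sum>j\<le>n. real (n choose j) / 2 ^ n * many j k) = many n (Suc k)"
proof -
  have "(\<Sum>j\<le>n. real (n choose j) / 2 ^ n * many j k)
      = (\<Sum>j\<le>n. real (n choose j) / 2 ^ n) - (\<Sum>j\<le>n. real (n choose j) / 2 ^ n * few j (1 / 2 ^ k))"
    unfolding sum_subtractf[symmetric] by (intro sum.cong refl) (simp add: many_def algebra_simps)
  then show ?thesis
    unfolding sum_split_weights few_thinning by (simp add: many_def mult.commute)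
qed

lemma many2_thinning: "(\<Sum>j\<le>n. real (n choose j) / 2 ^ n * many2 j k l) = many2 n (Suc k) (Suc l)"
proof -
  have "(\<Sum>j\<le>n. real (n choose j) / 2 ^ n * many2 j k l)
      = (\<Sum>j\<le>n. real (n choose j) / 2 ^ n) - (\<Sum>j\<le>n. real (n choose j) / 2 ^ n * few j (1 / 2 ^ k))
        - (\<Sum>j\<le>n. real (n choose j) / 2 ^ n * few j (1 / 2 ^ l))
        + (\<Sum>j\<le>n. real (n choose j) / 2 ^ n * few2 j (1 / 2 ^ k) (1 / 2 ^ l))"
    unfolding sum_subtractf[symmetric] sum.distrib[symmetric]
    by (intro sum.cong refl) (simp add: many2_eq algebra_simps)
  then show ?thesis
    unfolding sum_split_weights few_thinning few2_thinning by (simp add: many2_eq mult.commute)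
qed

text \<open>Two words with different first letters become, after removal of these letters, one word
  for each side of the split; \<open>many2_thinning\<close> covers two words with the same first
  letter.\<close>

lemma many_split: "(\<Sum>j\<le>n. real (n choose j) / 2 ^ n * (many j k * many (n - j) l)) = many2 n (Suc k) (Suc l)"
proof -
  have "(\<Sum>j\<le>n. real (n choose j) / 2 ^ n * (many j k * many (n - j) l))
      = (\<Sum>j\<le>n. real (n choose j) / 2 ^ n) - (\<Sum>j\<le>n. real (n choose j) / 2 ^ n * few j (1 / 2 ^ k))
        - (\<Sum>j\<le>n. real (n choose j) / 2 ^ n * few (n - j) (1 / 2 ^ l))
        + (\<Sum>j\<le>n. real (n choose j) / 2 ^ n * (few j (1 / 2 ^ k) * few (n - j) (1 / 2 ^ l)))"
    unfolding sum_subtractf[symmetric] sum.distrib[symmetric]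
    by (intro sum.cong refl) (simp add: many_def algebra_simps)
  then show ?thesis
    unfolding sum_split_weights few_thinning few_thinning' few_thinning2 by (simp add: many2_eq mult.commute)
qed

lemma many_0: "n \<ge> 2 \<Longrightarrow> many n 0 = 1" "many 0 k = 0" "many (Suc 0) k = 0"
  by (auto simp: many_def few_def power_0_left)

lemma summable_on_product_real:
  fixes f :: "'a \<Rightarrow> real" and g :: "'b \<Rightarrow> real"
  assumes "f summable_on A" "g summable_on B" "\<And>x. x \<in> A \<Longrightarrow> f x \<ge> 0" "\<And>x. x \<in> B \<Longrightarrow> g x \<ge> 0"
  shows "(\<lambda>(x, y). f x * g y) summable_on A \<times> B"
proof (rule summable_on_SigmaI)
  fix x assume "x \<in> A"
  show "((\<lambda>y. (case (x, y) of (x, y) \<Rightarrow> f x * g y)) has_sum f x * infsum g B) B"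
    using has_sum_cmult_right[of g B "infsum g B" "f x"] assms(2) by simp
qed (use assms in \<open>auto intro!: summable_on_cmult_left\<close>)

lemma has_sum_product_real:
  fixes f :: "'a \<Rightarrow> real" and g :: "'b \<Rightarrow> real"
  assumes "(f has_sum S) A" "(g has_sum T) B" "\<And>x. x \<in> A \<Longrightarrow> f x \<ge> 0" "\<And>x. x \<in> B \<Longrightarrow> g x \<ge> 0"
  shows "((\<lambda>(x, y). f x * g y) has_sum S * T) (A \<times> B)"
proof (rule has_sum_SigmaI)
  show "(\<lambda>(x, y). f x * g y) summable_on A \<times> B"
    using assms by (intro summable_on_product_real) (auto dest: has_sum_imp_summable)
  show "((\<lambda>y. (case (x, y) of (x, y) \<Rightarrow> f x * g y)) has_sum f x * T) B" for x
    using has_sum_cmult_right[OF assms(2), of "f x"] by simp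
  show "((\<lambda>x. f x * T) has_sum S * T) A"
    using has_sum_cmult_left[OF assms(1)] by simp
qed

lemma summable_on_geometric_pairs:
  assumes "0 \<le> x" "x < (1::real)"
  shows "(\<lambda>(k, l). x ^ (k + l)) summable_on (UNIV :: (nat \<times> nat) set)"
proof -
  have "(\<lambda>k. x ^ k) summable_on UNIV"
    using assms by (subst summable_on_UNIV_nonneg_real_iff) (auto intro: summable_geometric)
  then have "(\<lambda>(k, l). x ^ k * x ^ l) summable_on UNIV \<times> UNIV"
    using assms by (intro summable_on_product_real) auto
  then show ?thesis by (simp add: power_add)
qed

section \<open>Exact mean and variance\<close>

lemma has_sum_linear_combination:
  fixes f :: "'i \<Rightarrow> 'a \<Rightarrow> real"
  assumes "finite J" "\<And>j. j \<in> J \<Longrightarrow> (f j has_sum S j) A"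
  shows "((\<lambda>x. \<Sum>j\<in>J. c j * f j x) has_sum (\<Sum>j\<in>J. c j * S j)) A"
  using assms by (induction J rule: finite_induct) (auto intro!: has_sum_add has_sum_cmult_right)

text \<open>Because \<open>2 max k l >= k + l\<close>, decay in the larger level becomes geometric
  decay in the sum of the levels. The price is the rate \<open>sqrt (1/2)\<close>; the gain is
  summability over all pairs.\<close>

lemma inverse_power_max_le:
  "(1/2::real) ^ max k l \<le> sqrt (1/2) ^ (k + l)"
proof -
  have "(1/2::real) ^ max k l = (sqrt (1/2) ^ 2) ^ max k l" by simp
  also have "\<dots> = sqrt (1/2) ^ (2 * max k l)" by (rule power_mult[symmetric])
  also have "\<dots> \<le> sqrt (1/2) ^ (k + l)" by (intro power_decreasing) auto
  finally show ?thesis .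
qed

definition mean_term :: "nat \<Rightarrow> nat \<Rightarrow> real" where
  "mean_term n k = 2 ^ k * many n k"

text \<open>Among the \<open>2^(k + l)\<close> pairs of words of lengths \<open>k\<close> and
  \<open>l\<close>, the comparable ones are determined by the longer word. Removing them leaves the
  number of incomparable pairs, each with the same covariance.\<close>

definition cov_term :: "nat \<Rightarrow> nat \<times> nat \<Rightarrow> real" where
  "cov_term n = (\<lambda>(k, l). (2 ^ (k + l) - 2 ^ max k l) * few_cov n (1 / 2 ^ k) (1 / 2 ^ l))"

text \<open>For comparable words the event of the longer one implies that of the shorter one. Their
  covariance is the probability of the former times the complementary probability of the
  latter.\<close>

definition nested_term :: "nat \<Rightarrow> nat \<times> nat \<Rightarrow> real" where
  "nested_term n = (\<lambda>(k, l). 2 ^ max k l * many n (max k l) * few n (1 / 2 ^ min k l))"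

definition trie_mean :: "nat \<Rightarrow> real" where
  "trie_mean n = infsum (mean_term n) UNIV"

definition trie_var :: "nat \<Rightarrow> real" where
  "trie_var n = infsum (\<lambda>x. cov_term n x + nested_term n x) UNIV"

lemma mean_term_nonneg: "0 \<le> mean_term n k"
  by (simp add: mean_term_def many_nonneg)

lemma mean_term_le: "mean_term n k \<le> (real n)\<^sup>2 * (1/2) ^ k"
proof -
  have "mean_term n k \<le> 2 ^ k * (real n / 2 ^ k)\<^sup>2"
    unfolding mean_term_def by (intro mult_left_mono many_le) auto
  also have "\<dots> = (real n)\<^sup>2 * (1/2) ^ k" by (simp add: power2_eq_square field_simps)
  finally show ?thesis .
qed

lemma mean_term_has_sum: "(mean_term n has_sum trie_mean n) UNIV"
proof -
  have "summable (\<lambda>k. (real n)\<^sup>2 * (1/2) ^ k)" by (intro summable_mult summable_geometric) auto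
  then have "(\<lambda>k. (real n)\<^sup>2 * (1/2) ^ k) summable_on (UNIV :: nat set)"
    by (subst summable_on_UNIV_nonneg_real_iff) auto
  then have "mean_term n summable_on UNIV"
    by (rule summable_on_comparison_test) (auto simp: mean_term_le mean_term_nonneg)
  then show ?thesis by (simp add: trie_mean_def)
qed

lemma cov_term_bound: "\<bar>cov_term n (k, l)\<bar> \<le> real n ^ 3 * (1/2) ^ (k + l)"
proof (cases "k = 0 \<or> l = 0")
  case True
  then show ?thesis by (auto simp: cov_term_def)
next
  case False
  \<comment> \<open>The covariance estimate needs \<open>p + r <= 1\<close>. This fails when one
    word is empty, but there the weight is 0; otherwise both cells have probability at most
    1/2.\<close>
  have "(2::real) ^ 1 \<le> 2 ^ k" "(2::real) ^ 1 \<le> 2 ^ l" using False by (intro power_increasing; simp)+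
  then have "1 / 2 ^ k \<le> (1/2::real)" "1 / 2 ^ l \<le> (1/2::real)" by (simp_all add: field_simps)
  then have kl: "1 / 2 ^ k + 1 / 2 ^ l \<le> (1::real)" by linarith
  have "\<bar>cov_term n (k, l)\<bar> = \<bar>2 ^ (k + l) - 2 ^ max k l\<bar> * \<bar>few_cov n (1 / 2 ^ k) (1 / 2 ^ l)\<bar>"
    by (simp add: cov_term_def abs_mult)
  also have "\<dots> \<le> 2 ^ (k + l) * ((1 / 2 ^ k * (1 / 2 ^ l))\<^sup>2 * real n ^ 3)"
  proof (intro mult_mono few_cov_abs_le kl)
    have "(2::real) ^ max k l \<le> 2 ^ (k + l)" by (intro power_increasing) auto
    then show "\<bar>2 ^ (k + l) - 2 ^ max k l\<bar> \<le> (2::real) ^ (k + l)" by auto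
  qed auto
  also have "\<dots> = real n ^ 3 * (1/2) ^ (k + l)" by (simp add: power2_eq_square power_add field_simps)
  finally show ?thesis .
qed

lemma nested_term_nonneg: "0 \<le> nested_term n x"
  by (cases x) (auto simp: nested_term_def many_nonneg intro!: mult_nonneg_nonneg few_bounds)

lemma nested_term_bound: "nested_term n (k, l) \<le> (real n)\<^sup>2 * sqrt (1/2) ^ (k + l)"
proof -
  have "nested_term n (k, l) = mean_term n (max k l) * few n (1 / 2 ^ min k l)"
    by (simp add: nested_term_def mean_term_def)
  also have "\<dots> \<le> mean_term n (max k l) * 1"
    by (intro mult_left_mono few_bounds mean_term_nonneg) auto
  also have "\<dots> \<le> (real n)\<^sup>2 * (1/2) ^ max k l" using mean_term_le by simp
  also have "\<dots> \<le> (real n)\<^sup>2 * sqrt (1/2) ^ (k + l)" by (intro mult_left_mono inverse_power_max_le) auto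
  finally show ?thesis .
qed

lemma cov_term_summable: "cov_term n summable_on UNIV"
proof -
  have "(\<lambda>x. real n ^ 3 * (case x of (k, l) \<Rightarrow> (1/2) ^ (k + l))) summable_on (UNIV :: (nat \<times> nat) set)"
    by (intro summable_on_cmult_right summable_on_geometric_pairs) auto
  then have "(\<lambda>x. norm (cov_term n x)) summable_on UNIV"
    by (rule Infinite_Sum.abs_summable_on_comparison_test') (use cov_term_bound in auto)
  then show ?thesis by (rule abs_summable_summable)
qed

lemma nested_term_summable: "nested_term n summable_on UNIV"
proof -
  have "(\<lambda>x. (real n)\<^sup>2 * (case x of (k, l) \<Rightarrow> sqrt (1/2) ^ (k + l))) summable_on (UNIV :: (nat \<times> nat) set)"
    by (intro summable_on_cmult_right summable_on_geometric_pairs) (auto simp: real_sqrt_lt_1_iff)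
  then show ?thesis
    by (rule summable_on_comparison_test) (use nested_term_bound nested_term_nonneg in auto)
qed

lemma trie_var_has_sum: "((\<lambda>x. cov_term n x + nested_term n x) has_sum trie_var n) UNIV"
  unfolding trie_var_def by (intro has_sum_infsum summable_on_add cov_term_summable nested_term_summable)

text \<open>The summand of the second moment: joint probabilities for the incomparable pairs, and
  for the comparable pairs the probability of the longer word alone.\<close>

definition square_term :: "nat \<Rightarrow> nat \<times> nat \<Rightarrow> real" where
  "square_term n = (\<lambda>(k, l). (2 ^ (k + l) - 2 ^ max k l) * many2 n k l + 2 ^ max k l * many n (max k l))"

lemma square_term_has_sum: "(square_term n has_sum trie_var n + (trie_mean n)\<^sup>2) UNIV"
proof -
  have prod: "((\<lambda>(k, l). mean_term n k * mean_term n l) has_sum trie_mean n * trie_mean n) (UNIV \<times> UNIV)"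
    by (intro has_sum_product_real mean_term_has_sum) (auto simp: mean_term_nonneg)
  have eq: "cov_term n x + nested_term n x + (case x of (k, l) \<Rightarrow> mean_term n k * mean_term n l) = square_term n x" for x
  proof (cases x)
    case (Pair k l)
    have "many n k * many n l = many n (max k l) * many n (min k l)" by (simp add: max_def min_def mult.commute)
    then have F: "many n (max k l) = many n k * many n l + many n (max k l) * few n (1 / 2 ^ min k l)"
      by (simp add: many_def[of n "min k l"] algebra_simps)
    have E: "2 ^ max k l * many n (max k l)
       = 2 ^ max k l * (many n k * many n l) + 2 ^ max k l * many n (max k l) * few n (1 / 2 ^ min k l)"
      using arg_cong[OF F, of "(*) (2 ^ max k l)"] unfolding distrib_left mult.assoc .
    have "square_term n x = (2 ^ (k + l) - 2 ^ max k l) * many2 n k l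
       + (2 ^ max k l * (many n k * many n l) + 2 ^ max k l * many n (max k l) * few n (1 / 2 ^ min k l))"
      unfolding E[symmetric] by (simp add: Pair square_term_def)
    then show ?thesis
      by (simp add: Pair cov_term_def nested_term_def mean_term_def many2_def power_add algebra_simps)
  qed
  show ?thesis
    using has_sum_add[OF trie_var_has_sum[of n] prod[unfolded UNIV_Times_UNIV]] by (simp add: eq power2_eq_square)
qed

lemma mean_term_shift: "((\<lambda>k. 2 * (2 ^ k * many n (Suc k))) has_sum trie_mean n - many n 0) UNIV"
proof -
  have "mean_term n sums trie_mean n" using has_sum_imp_sums[OF mean_term_has_sum] .
  then have "(\<lambda>k. mean_term n (Suc k)) sums (trie_mean n - mean_term n 0)"
    by (subst sums_Suc_iff) simp
  then have "((\<lambda>k. mean_term n (Suc k)) has_sum (trie_mean n - mean_term n 0)) UNIV"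
    by (rule sums_nonneg_imp_has_sum) (simp add: mean_term_nonneg)
  then show ?thesis by (simp add: mean_term_def mult.assoc)
qed

lemma sum_split_symmetric:
  fixes f :: "nat \<Rightarrow> real"
  shows "(\<Sum>j\<le>n. real (n choose j) / 2 ^ n * f (n - j)) = (\<Sum>j\<le>n. real (n choose j) / 2 ^ n * f j)"
  by (rule sum.reindex_bij_witness[of _ "\<lambda>j. n - j" "\<lambda>j. n - j"]) (auto simp: binomial_symmetric[symmetric])

lemma trie_mean_thinning:
  "2 * (\<Sum>j\<le>n. real (n choose j) / 2 ^ n * trie_mean j) = trie_mean n - many n 0"
proof -
  have "((\<lambda>k. \<Sum>j\<le>n. real (n choose j) / 2 ^ n * mean_term j k) has_sum
      (\<Sum>j\<le>n. real (n choose j) / 2 ^ n * trie_mean j)) UNIV"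
    by (intro has_sum_linear_combination mean_term_has_sum) auto
  also have "(\<lambda>k. \<Sum>j\<le>n. real (n choose j) / 2 ^ n * mean_term j k) = (\<lambda>k. 2 ^ k * many n (Suc k))"
  proof
    fix k
    have "(\<Sum>j\<le>n. real (n choose j) / 2 ^ n * mean_term j k) = 2 ^ k * (\<Sum>j\<le>n. real (n choose j) / 2 ^ n * many j k)"
      unfolding sum_distrib_left by (intro sum.cong refl) (simp add: mean_term_def)
    then show "(\<Sum>j\<le>n. real (n choose j) / 2 ^ n * mean_term j k) = 2 ^ k * many n (Suc k)"
      unfolding many_thinning .
  qed
  finally have "((\<lambda>k. 2 * (2 ^ k * many n (Suc k))) has_sum
      2 * (\<Sum>j\<le>n. real (n choose j) / 2 ^ n * trie_mean j)) UNIV"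
    by (rule has_sum_cmult_right)
  then show ?thesis using mean_term_shift[of n] by (rule has_sum_unique)
qed

lemma trie_mean_product:
  "((\<lambda>(k, l). 2 ^ (k + l) * many2 n (Suc k) (Suc l)) has_sum
      (\<Sum>j\<le>n. real (n choose j) / 2 ^ n * (trie_mean j * trie_mean (n - j)))) UNIV"
proof -
  have "((\<lambda>x. \<Sum>j\<le>n. real (n choose j) / 2 ^ n * (case x of (k, l) \<Rightarrow> mean_term j k * mean_term (n - j) l)) has_sum
      (\<Sum>j\<le>n. real (n choose j) / 2 ^ n * (trie_mean j * trie_mean (n - j)))) (UNIV \<times> UNIV)"
    by (intro has_sum_linear_combination has_sum_product_real mean_term_has_sum) (auto simp: mean_term_nonneg)
  also have "(\<lambda>x. \<Sum>j\<le>n. real (n choose j) / 2 ^ n * (case x of (k, l) \<Rightarrow> mean_term j k * mean_term (n - j) l))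
      = (\<lambda>(k, l). 2 ^ (k + l) * many2 n (Suc k) (Suc l))"
  proof (intro ext, clarsimp)
    fix k l
    have "(\<Sum>j\<le>n. real (n choose j) * (mean_term j k * mean_term (n - j) l) / 2 ^ n)
        = 2 ^ (k + l) * (\<Sum>j\<le>n. real (n choose j) / 2 ^ n * (many j k * many (n - j) l))"
      unfolding sum_distrib_left by (intro sum.cong refl) (simp add: mean_term_def power_add)
    then show "(\<Sum>j\<le>n. real (n choose j) * (mean_term j k * mean_term (n - j) l) / 2 ^ n) = 2 ^ (k + l) * many2 n (Suc k) (Suc l)"
      unfolding many_split .
  qed
  finally show ?thesis by simp
qed

lemma square_term_thinning:
  "((\<lambda>(k, l). (2 ^ (k + l) - 2 ^ max k l) * many2 n (Suc k) (Suc l) + 2 ^ max k l * many n (Suc (max k l)))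
     has_sum (\<Sum>j\<le>n. real (n choose j) / 2 ^ n * (trie_var j + (trie_mean j)\<^sup>2))) UNIV"
proof -
  have "((\<lambda>x. \<Sum>j\<le>n. real (n choose j) / 2 ^ n * square_term j x) has_sum
      (\<Sum>j\<le>n. real (n choose j) / 2 ^ n * (trie_var j + (trie_mean j)\<^sup>2))) UNIV"
    by (intro has_sum_linear_combination square_term_has_sum) auto
  also have "(\<lambda>x. \<Sum>j\<le>n. real (n choose j) / 2 ^ n * square_term j x)
     = (\<lambda>(k, l). (2 ^ (k + l) - 2 ^ max k l) * many2 n (Suc k) (Suc l) + 2 ^ max k l * many n (Suc (max k l)))"
  proof
    fix x :: "nat \<times> nat"
    obtain k l where x: "x = (k, l)" by (cases x)
    have "(\<Sum>j\<le>n. real (n choose j) / 2 ^ n * square_term j x)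
        = (2 ^ (k + l) - 2 ^ max k l) * (\<Sum>j\<le>n. real (n choose j) / 2 ^ n * many2 j k l)
         + 2 ^ max k l * (\<Sum>j\<le>n. real (n choose j) / 2 ^ n * many j (max k l))"
      unfolding sum_distrib_left sum.distrib[symmetric]
      by (intro sum.cong refl) (simp add: x square_term_def algebra_simps add_divide_distrib diff_divide_distrib)
    then show "(\<Sum>j\<le>n. real (n choose j) / 2 ^ n * square_term j x) = (case x of (k, l) \<Rightarrow>
      (2 ^ (k + l) - 2 ^ max k l) * many2 n (Suc k) (Suc l) + 2 ^ max k l * many n (Suc (max k l)))"
      unfolding many2_thinning many_thinning by (simp add: x)
  qed
  finally show ?thesis .
qed

text \<open>Pairs of words are sorted by their first letters: both nonempty, second word empty, only
  the first word empty. For nonempty words the weight \<open>2^(k + l + 2) - 2^(max k l + 1)\<close>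
  is twice \<open>2^(k + l) - 2^max k l\<close>, for equal first letters, plus twice
  \<open>2^(k + l)\<close>, for different ones, which are always incomparable.\<close>

lemma square_term_decomposition:
  "trie_var n + (trie_mean n)\<^sup>2 = 2 * (\<Sum>j\<le>n. real (n choose j) / 2 ^ n * (trie_var j + (trie_mean j)\<^sup>2))
     + 2 * (\<Sum>j\<le>n. real (n choose j) / 2 ^ n * (trie_mean j * trie_mean (n - j)))
     + (2 * trie_mean n - many n 0)"
proof -
  let ?R = "range (\<lambda>(k, l). (Suc k, Suc l)) :: (nat \<times> nat) set"
  let ?S = "range (\<lambda>k. (k, 0)) :: (nat \<times> nat) set"
  let ?T = "range (\<lambda>l. (0, Suc l)) :: (nat \<times> nat) set"
  have R: "(square_term n has_sum (2 * (\<Sum>j\<le>n. real (n choose j) / 2 ^ n * (trie_var j + (trie_mean j)\<^sup>2))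
     + 2 * (\<Sum>j\<le>n. real (n choose j) / 2 ^ n * (trie_mean j * trie_mean (n - j))))) ?R"
  proof (subst has_sum_reindex)
    show "inj (\<lambda>(k::nat, l::nat). (Suc k, Suc l))" by (auto simp: inj_on_def)
    have "square_term n \<circ> (\<lambda>(k, l). (Suc k, Suc l)) = (\<lambda>x. 2 * (case x of (k, l) \<Rightarrow>
        (2 ^ (k + l) - 2 ^ max k l) * many2 n (Suc k) (Suc l) + 2 ^ max k l * many n (Suc (max k l)))
       + 2 * (case x of (k, l) \<Rightarrow> 2 ^ (k + l) * many2 n (Suc k) (Suc l)))"
      by (auto simp: fun_eq_iff square_term_def algebra_simps)
    then show "((square_term n \<circ> (\<lambda>(k, l). (Suc k, Suc l))) has_sum (2 * (\<Sum>j\<le>n. real (n choose j) / 2 ^ n * (trie_var j + (trie_mean j)\<^sup>2))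
     + 2 * (\<Sum>j\<le>n. real (n choose j) / 2 ^ n * (trie_mean j * trie_mean (n - j))))) UNIV"
      by (simp only:) (intro has_sum_add has_sum_cmult_right square_term_thinning trie_mean_product)
  qed
  have S: "(square_term n has_sum trie_mean n) ?S"
  proof (subst has_sum_reindex)
    have "square_term n \<circ> (\<lambda>k. (k, 0)) = mean_term n"
      by (auto simp: fun_eq_iff square_term_def mean_term_def)
    then show "((square_term n \<circ> (\<lambda>k. (k, 0))) has_sum trie_mean n) UNIV"
      using mean_term_has_sum by simp
  qed (auto simp: inj_on_def)
  have T: "(square_term n has_sum (trie_mean n - many n 0)) ?T"
  proof (subst has_sum_reindex)
    have "square_term n \<circ> (\<lambda>l. (0, Suc l)) = (\<lambda>k. 2 * (2 ^ k * many n (Suc k)))"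
      by (auto simp: fun_eq_iff square_term_def)
    then show "((square_term n \<circ> (\<lambda>l. (0, Suc l))) has_sum (trie_mean n - many n 0)) UNIV"
      using mean_term_shift by simp
  qed (auto simp: inj_on_def)
  have U: "?R \<union> (?S \<union> ?T) = UNIV"
  proof (intro equalityI subsetI UNIV_I)
    fix x :: "nat \<times> nat"
    obtain k l where x: "x = (k, l)" by (cases x)
    show "x \<in> ?R \<union> (?S \<union> ?T)"
      by (cases k; cases l) (auto simp: x image_iff)
  qed
  have "(square_term n has_sum ((2 * (\<Sum>j\<le>n. real (n choose j) / 2 ^ n * (trie_var j + (trie_mean j)\<^sup>2))
     + 2 * (\<Sum>j\<le>n. real (n choose j) / 2 ^ n * (trie_mean j * trie_mean (n - j))))
     + (trie_mean n + (trie_mean n - many n 0)))) (?R \<union> (?S \<union> ?T))"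
    by (intro has_sum_Un_disjoint R S T) auto
  then have "(square_term n has_sum ((2 * (\<Sum>j\<le>n. real (n choose j) / 2 ^ n * (trie_var j + (trie_mean j)\<^sup>2))
     + 2 * (\<Sum>j\<le>n. real (n choose j) / 2 ^ n * (trie_mean j * trie_mean (n - j))))
     + (trie_mean n + (trie_mean n - many n 0)))) UNIV" unfolding U .
  from has_sum_unique[OF square_term_has_sum this] show ?thesis by simp
qed

text \<open>In the recurrence for the difference of two solutions, induction leaves only the splits
  \<open>j = 0\<close> and \<open>j = n\<close>. The remaining equation
  \<open>d n = 2 d n / 2^n\<close> forces \<open>d n = 0\<close>, as \<open>2^n > 2\<close>.\<close>

lemma split_recurrence_unique:
  fixes f g :: "nat \<Rightarrow> real"
  assumes "f 0 = g 0" "f (Suc 0) = g (Suc 0)"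
    and f: "\<And>n. n \<ge> 2 \<Longrightarrow> f n = (\<Sum>j\<le>n. real (n choose j) / 2 ^ n * (f j + f (n - j))) + r n"
    and g: "\<And>n. n \<ge> 2 \<Longrightarrow> g n = (\<Sum>j\<le>n. real (n choose j) / 2 ^ n * (g j + g (n - j))) + r n"
  shows "f n = g n"
proof (induction n rule: less_induct)
  case (less n)
  show ?case
  proof (cases "n \<ge> 2")
    case False
    then consider "n = 0" | "n = Suc 0" by linarith
    then show ?thesis using assms by cases auto
  next
    case n: True
    define d where "d j = f j - g j" for j
    have d0: "d j = 0" if "j < n" for j using less that by (simp add: d_def)
    have "d n = (\<Sum>j\<le>n. real (n choose j) / 2 ^ n * (f j + f (n - j))) - (\<Sum>j\<le>n. real (n choose j) / 2 ^ n * (g j + g (n - j)))"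
      unfolding d_def by (subst f[OF n], subst g[OF n]) simp
    also have "\<dots> = (\<Sum>j\<le>n. real (n choose j) / 2 ^ n * (d j + d (n - j)))"
      unfolding sum_subtractf[symmetric] d_def by (intro sum.cong refl) (simp add: algebra_simps)
    also have "\<dots> = (\<Sum>j\<in>{0, n}. real (n choose j) / 2 ^ n * (d j + d (n - j)))"
    proof (rule sum.mono_neutral_right)
      show "\<forall>i\<in>{..n} - {0, n}. real (n choose i) / 2 ^ n * (d i + d (n - i)) = 0"
        using d0 by auto
    qed auto
    also have "\<dots> = 2 * d n / 2 ^ n" using n d0[of 0] by simp
    finally have "d n * (2 ^ n - 2) = 0" by (simp add: field_simps)
    moreover have "(2::real) ^ 2 \<le> 2 ^ n" using n by (intro power_increasing) auto
    ultimately show ?thesis by (auto simp: d_def)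
  qed
qed

lemma trie_mean_0: "trie_mean 0 = 0" "trie_mean (Suc 0) = 0"
proof -
  have "mean_term 0 = (\<lambda>_. 0)" "mean_term (Suc 0) = (\<lambda>_. 0)"
    by (auto simp: fun_eq_iff mean_term_def many_0)
  then show "trie_mean 0 = 0" "trie_mean (Suc 0) = 0" by (simp_all add: trie_mean_def)
qed

lemma trie_var_0: "trie_var 0 = 0" "trie_var (Suc 0) = 0"
proof -
  have c: "cov_term n x = 0" if "n = 0 \<or> n = Suc 0" for n x
    using that by (cases x) (auto simp: cov_term_def few_cov_eq mixed_coeff_def pow_deriv_def pow_deriv2_def)
  have h: "nested_term n x = 0" if "n = 0 \<or> n = Suc 0" for n x
    using that by (cases x) (auto simp: nested_term_def many_0)
  show "trie_var 0 = 0" "trie_var (Suc 0) = 0"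
    by (simp_all add: trie_var_def c h)
qed

context trie_law
begin

lemma m1_eq: "m1 n = trie_mean n"
proof (rule split_recurrence_unique[where r = "\<lambda>_. 1"])
  fix n :: nat assume n: "n \<ge> 2"
  show "m1 n = (\<Sum>j\<le>n. real (n choose j) / 2 ^ n * (m1 j + m1 (n - j))) + 1"
  proof -
    have "m1 n = (\<Sum>j\<le>n. real (n choose j) / 2 ^ n * (m1 j + m1 (n - j)) + real (n choose j) / 2 ^ n)"
      unfolding m1_rec[OF n] by (intro sum.cong refl) (simp add: algebra_simps add_divide_distrib)
    then show ?thesis unfolding sum.distrib sum_split_weights .
  qed
  have "(\<Sum>j\<le>n. real (n choose j) / 2 ^ n * (trie_mean j + trie_mean (n - j)))
      = 2 * (\<Sum>j\<le>n. real (n choose j) / 2 ^ n * trie_mean j)"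
    unfolding distrib_left sum.distrib sum_split_symmetric by simp
  then show "trie_mean n = (\<Sum>j\<le>n. real (n choose j) / 2 ^ n * (trie_mean j + trie_mean (n - j))) + 1"
    unfolding trie_mean_thinning using n by (simp add: many_0)
qed (simp_all add: m_0 trie_mean_0)

text \<open>With the mean already identified, the sums and products of means belong to the
  inhomogeneous term, and the recurrence is linear in the second moment.\<close>

lemma m2_eq: "m2 n = trie_var n + (trie_mean n)\<^sup>2"
proof (rule split_recurrence_unique[where f = m2 and g = "\<lambda>n. trie_var n + (trie_mean n)\<^sup>2"
      and r = "\<lambda>n. 1 + 2 * (\<Sum>j\<le>n. real (n choose j) / 2 ^ n * (trie_mean j * trie_mean (n - j)))
      + 2 * (\<Sum>j\<le>n. real (n choose j) / 2 ^ n * (trie_mean j + trie_mean (n - j)))"])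
  fix n :: nat assume n: "n \<ge> 2"
  have "m2 n = (\<Sum>j\<le>n. real (n choose j) / 2 ^ n * (m2 j + m2 (n - j)) + (real (n choose j) / 2 ^ n
        + 2 * (real (n choose j) / 2 ^ n * (trie_mean j * trie_mean (n - j)))
        + 2 * (real (n choose j) / 2 ^ n * (trie_mean j + trie_mean (n - j)))))"
    unfolding m2_rec[OF n] m1_eq by (intro sum.cong refl) (simp add: algebra_simps add_divide_distrib)
  then show "m2 n = (\<Sum>j\<le>n. real (n choose j) / 2 ^ n * (m2 j + m2 (n - j))) +
      (1 + 2 * (\<Sum>j\<le>n. real (n choose j) / 2 ^ n * (trie_mean j * trie_mean (n - j)))
      + 2 * (\<Sum>j\<le>n. real (n choose j) / 2 ^ n * (trie_mean j + trie_mean (n - j))))"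
    unfolding sum.distrib sum_split_weights sum_distrib_left[symmetric] .
  define V where "V j = trie_var j + (trie_mean j)\<^sup>2" for j
  have 1: "(\<Sum>j\<le>n. real (n choose j) / 2 ^ n * (V j + V (n - j)))
      = 2 * (\<Sum>j\<le>n. real (n choose j) / 2 ^ n * V j)"
    unfolding distrib_left sum.distrib sum_split_symmetric by simp
  have 2: "(\<Sum>j\<le>n. real (n choose j) / 2 ^ n * (trie_mean j + trie_mean (n - j)))
      = 2 * (\<Sum>j\<le>n. real (n choose j) / 2 ^ n * trie_mean j)"
    unfolding distrib_left sum.distrib sum_split_symmetric by simp
  have "V n = (\<Sum>j\<le>n. real (n choose j) / 2 ^ n * (V j + V (n - j))) +
      (1 + 2 * (\<Sum>j\<le>n. real (n choose j) / 2 ^ n * (trie_mean j * trie_mean (n - j)))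
      + 2 * (\<Sum>j\<le>n. real (n choose j) / 2 ^ n * (trie_mean j + trie_mean (n - j))))"
    using square_term_decomposition[of n] n unfolding 1 2 V_def[symmetric] trie_mean_thinning
    by (simp add: many_0)
  then show "trie_var n + (trie_mean n)\<^sup>2 =
       (\<Sum>j\<le>n. real (n choose j) / 2 ^ n * (trie_var j + (trie_mean j)\<^sup>2 + (trie_var (n - j) + (trie_mean (n - j))\<^sup>2))) +
      (1 + 2 * (\<Sum>j\<le>n. real (n choose j) / 2 ^ n * (trie_mean j * trie_mean (n - j)))
      + 2 * (\<Sum>j\<le>n. real (n choose j) / 2 ^ n * (trie_mean j + trie_mean (n - j))))"
    unfolding V_def .
qed (simp_all add: m_0 trie_mean_0 trie_var_0)

end

lemma (in symmetric_trie_size) variance_eq_trie_var: "variance (\<lambda>\<omega>. real (X n \<omega>)) = trie_var n"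
proof -
  interpret trie_law law
    by standard (use law_0 law_1 law_rec in auto)
  have i: "integrable M (\<lambda>\<omega>. f (X n \<omega>)) \<longleftrightarrow> integrable (measure_pmf (law n)) f"
    and e: "expectation (\<lambda>\<omega>. f (X n \<omega>)) = measure_pmf.expectation (law n) f" for f :: "nat \<Rightarrow> real"
    unfolding measure_pmf_law by (auto simp: integrable_distr_eq integral_distr)
  have "variance (\<lambda>\<omega>. real (X n \<omega>)) = expectation (\<lambda>\<omega>. (real (X n \<omega>))\<^sup>2) - (expectation (\<lambda>\<omega>. real (X n \<omega>)))\<^sup>2"
    by (rule variance_eq) (simp_all add: i integrable_moments i[of "\<lambda>x. (real x)\<^sup>2"])
  also have "\<dots> = m2 n - (m1 n)\<^sup>2"
    using e[of real] e[of "\<lambda>x. (real x)\<^sup>2"] by (simp add: m1_def m2_def)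
  finally show ?thesis by (simp add: m1_eq m2_eq)
qed

section \<open>Poisson limit of the variance\<close>

text \<open>Dominated convergence for unordered sums: a finite set carries all but
  \<open>e / 2\<close> of the majorant, and on this set termwise convergence suffices.\<close>

lemma infsum_dominated_tendsto_0:
  fixes f :: "nat \<Rightarrow> 'a \<Rightarrow> real"
  assumes D: "D summable_on A" and bound: "\<And>n x. n \<ge> m \<Longrightarrow> x \<in> A \<Longrightarrow> \<bar>f n x\<bar> \<le> D x"
    and lim: "\<And>x. x \<in> A \<Longrightarrow> (\<lambda>n. f n x) \<longlonglongrightarrow> 0"
  shows "(\<lambda>n. infsum (f n) A) \<longlonglongrightarrow> 0"
proof (rule LIMSEQ_I)
  fix e :: real assume e: "e > 0"
  obtain F where F: "finite F" "F \<subseteq> A" "dist (sum D F) (infsum D A) \<le> e / 2"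
    using infsum_finite_approximation[OF D, of "e/2"] e by auto
  have "(\<lambda>n. \<Sum>x\<in>F. \<bar>f n x\<bar>) \<longlonglongrightarrow> (\<Sum>x\<in>F. \<bar>0\<bar>)"
    using F lim by (intro tendsto_sum tendsto_rabs) auto
  then have "eventually (\<lambda>n. (\<Sum>x\<in>F. \<bar>f n x\<bar>) < e / 2) sequentially"
    using e by (intro order_tendstoD) auto
  then obtain n1 where n1: "\<And>n. n \<ge> n1 \<Longrightarrow> (\<Sum>x\<in>F. \<bar>f n x\<bar>) < e / 2"
    by (auto simp: eventually_sequentially)
  show "\<exists>no. \<forall>n\<ge>no. norm (infsum (f n) A - 0) < e"
  proof (intro exI allI impI)
    fix n assume n: "n \<ge> max m n1"
    have abs: "(\<lambda>x. norm (f n x)) summable_on A"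
      by (rule Infinite_Sum.abs_summable_on_comparison_test'[OF D]) (use bound n in auto)
    then have sf: "f n summable_on A" by (rule abs_summable_summable)
    have sub: "g summable_on A - F" if "g summable_on A" for g :: "'a \<Rightarrow> real"
      using that by (rule summable_on_subset_banach) auto
    have split: "infsum g A = sum g F + infsum g (A - F)" if "g summable_on A" for g :: "'a \<Rightarrow> real"
    proof -
      have "infsum g (F \<union> (A - F)) = infsum g F + infsum g (A - F)"
        using F that sub by (intro infsum_Un_disjoint) auto
      moreover have "F \<union> (A - F) = A" using F by auto
      ultimately show ?thesis using F by simp
    qed
    have "\<bar>infsum (f n) (A - F)\<bar> \<le> infsum D (A - F)"
      using norm_infsum_le[OF has_sum_infsum[OF sub[OF sf]] has_sum_infsum[OF sub[OF D]]] bound n by auto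
    also have "\<dots> \<le> e / 2" using split[OF D] F(3) by (auto simp: dist_real_def)
    finally have "\<bar>infsum (f n) (A - F)\<bar> \<le> e / 2" .
    moreover have "\<bar>sum (f n) F\<bar> < e / 2"
      by (rule le_less_trans[OF sum_abs n1]) (use n in auto)
    ultimately show "norm (infsum (f n) A - 0) < e" using split[OF sf] by simp
  qed
qed

lemma has_sum_int_split:
  fixes f :: "int \<Rightarrow> real"
  assumes "((\<lambda>n. f (int (Suc n))) has_sum S) UNIV" "((\<lambda>n. f (- int (Suc n))) has_sum T) UNIV"
  shows "(f has_sum (f 0 + (S + T))) UNIV"
proof -
  have "(f has_sum S) (range (\<lambda>n. int (Suc n)))"
    using assms(1) by (subst has_sum_reindex) (auto simp: inj_on_def o_def)
  moreover have "(f has_sum T) (range (\<lambda>n. - int (Suc n)))"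
    using assms(2) by (subst has_sum_reindex) (auto simp: inj_on_def o_def)
  moreover have "(f has_sum f 0) {0}" by (rule has_sum_finiteI) auto
  ultimately have "(f has_sum (f 0 + (S + T))) ({0} \<union> (range (\<lambda>n. int (Suc n)) \<union> range (\<lambda>n. - int (Suc n))))"
    by (intro has_sum_Un_disjoint) auto
  also have "{0} \<union> (range (\<lambda>n. int (Suc n)) \<union> range (\<lambda>n. - int (Suc n))) = UNIV"
  proof (intro equalityI subsetI UNIV_I)
    fix a :: int
    consider "a = 0" | "a > 0" | "a < 0" by linarith
    then show "a \<in> {0} \<union> (range (\<lambda>n. int (Suc n)) \<union> range (\<lambda>n. - int (Suc n)))"
      by cases (auto intro: image_eqI[of _ _ "nat (a - 1)"] image_eqI[of _ _ "nat (-a-1)"])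
  qed
  finally show ?thesis .
qed

lemma nat_abs_minus_Suc: "nat \<bar>- int (Suc n)\<bar> = Suc n" and nat_abs_Suc: "nat \<bar>int (Suc n)\<bar> = Suc n"
  by simp_all

lemma has_sum_int_geometric:
  assumes "0 \<le> x" "x < (1::real)"
  shows "((\<lambda>a::int. x ^ nat \<bar>a\<bar>) has_sum (1 + (x / (1 - x) + x / (1 - x)))) UNIV"
proof -
  have "(\<lambda>n. x * x ^ n) sums (x * (1 / (1 - x)))"
    using assms by (intro sums_mult geometric_sums) auto
  then have g: "((\<lambda>n. x ^ Suc n) has_sum (x / (1 - x))) UNIV"
    using assms by (intro sums_nonneg_imp_has_sum) auto
  show ?thesis
    using has_sum_int_split[of "\<lambda>a. x ^ nat \<bar>a\<bar>", unfolded nat_abs_minus_Suc nat_abs_Suc, OF g g] by simp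
qed

lemma summable_on_int_geometric:
  assumes "0 \<le> x" "x < (1::real)"
  shows "(\<lambda>a::int. x ^ nat \<bar>a\<bar>) summable_on UNIV"
  by (rule has_sum_imp_summable[OF has_sum_int_geometric[OF assms]])

section \<open>The Poisson limit terms and their summable majorants\<close>

definition pois_one :: "real \<Rightarrow> real" where "pois_one t = t * exp (- t)"
definition pois_few :: "real \<Rightarrow> real" where "pois_few t = (1 + t) * exp (- t)"

definition scaled :: "real \<Rightarrow> int \<Rightarrow> real" where "scaled x a = x / 2 powi a"

text \<open>For \<open>n = x 2^N\<close>, the limit of the summand at levels \<open>N + a\<close>
  and \<open>N + b\<close>, divided by \<open>n\<close>; a cell there receives
  \<open>s = scaled x a\<close> or \<open>t = scaled x b\<close> balls on average. The covariance
  \<open>- s^2 t^2 exp (- s - t) / n\<close>, multiplied by about \<open>n^2 / (s t)\<close> pairs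
  and divided by \<open>n\<close>, becomes the product of two \<open>pois_one\<close>. For nested
  pairs, the weight over \<open>n\<close> is the reciprocal of the smaller of these
  averages.\<close>

definition lim_term :: "real \<Rightarrow> int \<times> int \<Rightarrow> real" where
  "lim_term x = (\<lambda>(a, b). (1 - pois_few (scaled x (max a b))) / scaled x (max a b) * pois_few (scaled x (min a b))
      - pois_one (scaled x a) * pois_one (scaled x b))"

definition var_limit :: "real \<Rightarrow> real" where
  "var_limit x = infsum (lim_term x) UNIV"

lemma square_le_exp: "0 \<le> t \<Longrightarrow> t\<^sup>2 \<le> exp (t::real)"
proof -
  assume t: "0 \<le> t"
  have "t \<le> 1 + t/2 + (t/2)\<^sup>2 / 2"
    using zero_le_power2[of "t/2 - 1"] by (simp add: power2_eq_square algebra_simps)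
  also have "\<dots> \<le> exp (t/2)" using t by (intro exp_lower_Taylor_quadratic) auto
  finally have "t\<^sup>2 \<le> (exp (t/2))\<^sup>2" using t by (intro power_mono) auto
  also have "\<dots> = exp t" by (simp add: power2_eq_square flip: exp_add)
  finally show ?thesis .
qed

lemma pois_one_bounds:
  assumes "0 < t"
  shows "0 \<le> pois_one t" "pois_one t \<le> t" "pois_one t \<le> 1 / t" "pois_one t \<le> 1"
proof -
  show "0 \<le> pois_one t" "pois_one t \<le> t" using assms by (auto simp: pois_one_def mult_le_cancel_left1)
  show "pois_one t \<le> 1 / t" using square_le_exp[of t] assms
    by (simp add: pois_one_def exp_minus field_simps power2_eq_square)
  have "1 + t \<le> exp t" by (rule exp_ge_add_one_self)
  then have "t \<le> exp t" by linarith
  then show "pois_one t \<le> 1" by (simp add: pois_one_def exp_minus field_simps)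
qed

lemma pois_few_bounds:
  assumes "0 < t"
  shows "0 \<le> pois_few t" "pois_few t \<le> 1" "pois_few t \<le> 2 / t" "1 - pois_few t \<le> t\<^sup>2"
proof -
  show "0 \<le> pois_few t" using assms by (auto simp: pois_few_def)
  show "pois_few t \<le> 1" using exp_ge_add_one_self[of t] assms by (simp add: pois_few_def exp_minus field_simps)
  have "1 + t \<le> exp t" by (rule exp_ge_add_one_self)
  moreover have "t\<^sup>2 \<le> exp t" using assms by (intro square_le_exp) auto
  ultimately have "t + t\<^sup>2 \<le> 2 * exp t" by linarith
  then show "pois_few t \<le> 2 / t" using assms
    by (simp add: pois_few_def exp_minus field_simps power2_eq_square)
  have "(1 + t) * (1 - t) \<le> pois_few t"
    unfolding pois_few_def using assms exp_ge_add_one_self[of "-t"] by (intro mult_left_mono) auto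
  then show "1 - pois_few t \<le> t\<^sup>2" by (simp add: power2_eq_square algebra_simps)
qed

lemma scaled_pos: "1 \<le> x \<Longrightarrow> 0 < scaled x a"
  by (simp add: scaled_def)

lemma scaled_le: "1 \<le> x \<Longrightarrow> x \<le> 2 \<Longrightarrow> a \<ge> 0 \<Longrightarrow> scaled x a \<le> 2 * (1/2) ^ nat \<bar>a\<bar>"
  by (simp add: scaled_def power_int_def field_simps)

lemma inverse_scaled_le: "1 \<le> x \<Longrightarrow> a \<le> 0 \<Longrightarrow> 1 / scaled x a \<le> (1/2) ^ nat \<bar>a\<bar>"
  by (cases "a = 0") (auto simp: scaled_def power_int_def field_simps)

text \<open>For nonnegative levels \<open>scaled x a\<close> is small, for negative ones its
  reciprocal is. The factor 2 comes from \<open>x <= 2\<close>.\<close>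

lemma min_scaled_le:
  assumes "1 \<le> x" "x \<le> 2" "c \<le> scaled x a" "c \<le> 1 / scaled x a"
  shows "c \<le> 2 * (1/2) ^ nat \<bar>a\<bar>"
proof (cases "a \<ge> 0")
  case True
  then show ?thesis using scaled_le[of x a] assms by linarith
next
  case False
  have "c \<le> (1/2) ^ nat \<bar>a\<bar>" using inverse_scaled_le[of x a] assms False by linarith
  also have "\<dots> \<le> 2 * (1/2) ^ nat \<bar>a\<bar>" by simp
  finally show ?thesis .
qed

abbreviation \<rho> :: real where "\<rho> \<equiv> sqrt (1/2)"

lemma half_power_le: "(1/2) ^ k \<le> \<rho> ^ k"
  by (intro power_mono real_le_rsqrt) (auto simp: power2_eq_square)

text \<open>The factor \<open>g\<close> decays in the larger level in both directions, whereas
  \<open>f\<close> decays in the smaller level only towards minus infinity. If both levels are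
  nonnegative, the decay in the larger one must be shared between them by
  \<open>inverse_power_max_le\<close>, which is why the rate is \<open>\<rho>\<close> and not
  1/2.\<close>

lemma nested_bound:
  fixes a b :: int
  assumes x: "1 \<le> x" "x \<le> 2"
    and g: "0 \<le> g" "g \<le> scaled x (max a b)" "g \<le> 1 / scaled x (max a b)"
    and f: "0 \<le> f" "f \<le> 1" "f \<le> 2 / scaled x (min a b)"
  shows "g * f \<le> 4 * \<rho> ^ (nat \<bar>a\<bar> + nat \<bar>b\<bar>)"
proof -
  define m M where "m = min a b" and "M = max a b"
  have mM: "nat \<bar>a\<bar> + nat \<bar>b\<bar> = nat \<bar>m\<bar> + nat \<bar>M\<bar>" by (auto simp: m_def M_def min_def max_def)
  have g': "g \<le> 2 * (1/2) ^ nat \<bar>M\<bar>" using min_scaled_le[OF x g(2,3)] by (simp add: M_def)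
  show ?thesis
  proof (cases "m \<ge> 0")
    case True
    have "g * f \<le> (2 * (1/2) ^ nat \<bar>M\<bar>) * 1" using g g' f by (intro mult_mono) auto
    also have "(1/2::real) ^ nat \<bar>M\<bar> \<le> \<rho> ^ (nat \<bar>m\<bar> + nat \<bar>M\<bar>)"
    proof -
      have "max (nat \<bar>m\<bar>) (nat \<bar>M\<bar>) = nat \<bar>M\<bar>" using True by (auto simp: m_def M_def)
      then show ?thesis using inverse_power_max_le[of "nat \<bar>m\<bar>" "nat \<bar>M\<bar>"] by simp
    qed
    finally have "g * f \<le> 2 * \<rho> ^ (nat \<bar>m\<bar> + nat \<bar>M\<bar>)" by simp
    also have "\<dots> \<le> 4 * \<rho> ^ (nat \<bar>m\<bar> + nat \<bar>M\<bar>)" by (intro mult_right_mono) auto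
    finally show ?thesis unfolding mM .
  next
    case False
    then have i: "1 / scaled x m \<le> (1/2) ^ nat \<bar>m\<bar>" using x by (intro inverse_scaled_le) auto
    have "f \<le> 2 * (1 / scaled x m)" using f(3) by (simp add: m_def)
    also have "\<dots> \<le> 2 * (1/2) ^ nat \<bar>m\<bar>" using i by (rule mult_left_mono) auto
    finally have "g * f \<le> (2 * (1/2) ^ nat \<bar>M\<bar>) * (2 * (1/2) ^ nat \<bar>m\<bar>)"
      using g g' f by (intro mult_mono) auto
    also have "\<dots> = 4 * (1/2) ^ (nat \<bar>m\<bar> + nat \<bar>M\<bar>)" by (simp add: power_add)
    also have "\<dots> \<le> 4 * \<rho> ^ (nat \<bar>m\<bar> + nat \<bar>M\<bar>)" using half_power_le by (intro mult_left_mono) auto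
    finally show ?thesis unfolding mM .
  qed
qed

lemma pois_one_product_bound:
  assumes x: "1 \<le> x" "x \<le> 2"
  shows "pois_one (scaled x a) * pois_one (scaled x b) \<le> 4 * \<rho> ^ (nat \<bar>a\<bar> + nat \<bar>b\<bar>)"
proof -
  have o: "0 \<le> pois_one (scaled x a)" "pois_one (scaled x a) \<le> 2 * (1/2) ^ nat \<bar>a\<bar>" for a
    using pois_one_bounds[OF scaled_pos[of x a]] min_scaled_le[OF x, of "pois_one (scaled x a)" a] x by auto
  have "pois_one (scaled x a) * pois_one (scaled x b) \<le> (2 * (1/2) ^ nat \<bar>a\<bar>) * (2 * (1/2) ^ nat \<bar>b\<bar>)"
    using o by (intro mult_mono) auto
  also have "\<dots> = 4 * (1/2) ^ (nat \<bar>a\<bar> + nat \<bar>b\<bar>)" by (simp add: power_add)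
  also have "\<dots> \<le> 4 * \<rho> ^ (nat \<bar>a\<bar> + nat \<bar>b\<bar>)" using half_power_le by (intro mult_left_mono) auto
  finally show ?thesis .
qed

lemma lim_term_bound:
  assumes x: "1 \<le> x" "x \<le> 2"
  shows "\<bar>lim_term x (a, b)\<bar> \<le> 8 * \<rho> ^ (nat \<bar>a\<bar> + nat \<bar>b\<bar>)"
proof -
  let ?s = "scaled x (max a b)" and ?t = "scaled x (min a b)"
  have s: "0 < ?s" "0 < ?t" using x by (auto intro: scaled_pos)
  have nb: "(1 - pois_few ?s) / ?s * pois_few ?t \<le> 4 * \<rho> ^ (nat \<bar>a\<bar> + nat \<bar>b\<bar>)"
  proof (rule nested_bound[OF x])
    show "0 \<le> (1 - pois_few ?s) / ?s" "(1 - pois_few ?s) / ?s \<le> 1 / ?s"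
      using pois_few_bounds[OF s(1)] s by (auto intro: divide_right_mono)
    show "(1 - pois_few ?s) / ?s \<le> ?s"
      using pois_few_bounds[OF s(1)] s by (simp add: field_simps power2_eq_square)
  qed (use pois_few_bounds[OF s(2)] in auto)
  have "0 \<le> (1 - pois_few ?s) / ?s * pois_few ?t"
    using pois_few_bounds[OF s(1)] pois_few_bounds[OF s(2)] s by auto
  moreover have "0 \<le> pois_one (scaled x a) * pois_one (scaled x b)"
    using pois_one_bounds(1)[OF scaled_pos] x by (intro mult_nonneg_nonneg) auto
  moreover have "lim_term x (a, b) = (1 - pois_few ?s) / ?s * pois_few ?t - pois_one (scaled x a) * pois_one (scaled x b)"
    by (simp add: lim_term_def)
  ultimately show ?thesis
    using nb pois_one_product_bound[OF x, of a b] by linarith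
qed

lemma summable_on_int_pairs: "(\<lambda>(a, b). \<rho> ^ (nat \<bar>a\<bar> + nat \<bar>b\<bar>)) summable_on (UNIV :: (int \<times> int) set)"
proof -
  have "(\<lambda>(a::int, b::int). \<rho> ^ nat \<bar>a\<bar> * \<rho> ^ nat \<bar>b\<bar>) summable_on UNIV \<times> UNIV"
    by (intro summable_on_product_real summable_on_int_geometric) (auto simp: real_sqrt_lt_1_iff)
  then show ?thesis by (simp add: power_add)
qed

lemma lim_term_summable:
  assumes "1 \<le> y" "y \<le> 2"
  shows "lim_term y summable_on UNIV"
proof -
  have "(\<lambda>z. 8 * (case z of (a, b) \<Rightarrow> \<rho> ^ (nat \<bar>a\<bar> + nat \<bar>b\<bar>))) summable_on (UNIV :: (int \<times> int) set)"
    by (intro summable_on_cmult_right summable_on_int_pairs)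
  then have "(\<lambda>z. norm (lim_term y z)) summable_on UNIV"
    by (rule Infinite_Sum.abs_summable_on_comparison_test') (use lim_term_bound[OF assms] in auto)
  then show ?thesis by (rule abs_summable_summable)
qed

section \<open>Comparison of binomial and Poisson probabilities\<close>

lemma power_one_minus_bounds:
  assumes "0 \<le> p" "p \<le> (1::real)"
  shows "(1 - p) ^ n \<le> exp (- (real n * p))"
    and "exp (- (real n * p)) * (1 - real n * p * p) \<le> (1 - p) ^ n"
proof -
  have "(1 - p) ^ n \<le> exp (- p) ^ n"
    using assms exp_ge_add_one_self[of "-p"] by (intro power_mono) auto
  then show "(1 - p) ^ n \<le> exp (- (real n * p))"
    by (simp flip: exp_of_nat_mult)
  \<comment> \<open>For the lower bound, \<open>exp (- p) (1 + p) <= 1\<close> gives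
    \<open>exp (- n p) (1 - p^2)^n <= (1 - p)^n\<close>; Bernoulli's inequality then handles the
    power of \<open>1 - p^2\<close>.\<close>
  have "1 - real n * p * p \<le> (1 - p * p) ^ n"
    using Bernoulli_inequality[of "- (p * p)" n] assms by (simp add: mult_le_one mult.assoc)
  then have "exp (- (real n * p)) * (1 - real n * p * p) \<le> exp (- p) ^ n * (1 - p * p) ^ n"
    by (simp flip: exp_of_nat_mult)
  also have "\<dots> = (exp (- p) * (1 + p) * (1 - p)) ^ n"
    by (simp flip: power_mult_distrib add: algebra_simps)
  also have "\<dots> \<le> (1 * (1 - p)) ^ n"
  proof (intro power_mono mult_right_mono)
    show "exp (- p) * (1 + p) \<le> 1" using exp_ge_add_one_self[of p] by (simp add: exp_minus field_simps)
  qed (use assms in auto)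
  finally show "exp (- (real n * p)) * (1 - real n * p * p) \<le> (1 - p) ^ n" by simp
qed

lemma power_pred_one_minus_le:
  assumes "0 \<le> p" "p \<le> (1::real)"
  shows "(1 - p) ^ (n - c) \<le> exp (- (real n * p)) * exp (real c * p)"
proof -
  have "(1 - p) ^ (n - c) \<le> exp (- (real (n - c) * p))" by (rule power_one_minus_bounds[OF assms])
  also have "\<dots> \<le> exp (- (real n * p) + real c * p)"
  proof -
    have "(real n - real c) * p \<le> real (n - c) * p" using assms by (intro mult_right_mono) auto
    then show ?thesis by (simp add: algebra_simps)
  qed
  finally show ?thesis by (simp only: exp_add)
qed

text \<open>Crude but uniform in \<open>p\<close>, and so fit for a majorant, while
  \<open>few_approx\<close> is meant for bounded \<open>n p\<close> and small \<open>p\<close>. The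
  constant \<open>exp 1\<close> pays for the exponent \<open>n - 1\<close> in place of
  \<open>n\<close>.\<close>

lemma few_le_pois_few:
  assumes "0 \<le> p" "p \<le> 1" "n \<ge> 1"
  shows "few n p \<le> exp 1 * pois_few (real n * p)"
proof -
  have "few n p = (1 - p) ^ (n - 1) * (1 + (real n - 1) * p)" using assms by (intro few_eq)
  also have "\<dots> \<le> (exp (- (real n * p)) * exp (real 1 * p)) * (1 + real n * p)"
    using assms by (intro mult_mono power_pred_one_minus_le) (auto simp: mult_right_mono)
  also have "\<dots> \<le> (exp (- (real n * p)) * exp 1) * (1 + real n * p)"
    using assms by (intro mult_right_mono mult_left_mono) auto
  finally show ?thesis by (simp add: pois_few_def mult_ac)
qed

lemma few_approx:
  assumes "0 \<le> p" "p \<le> 1" "n \<ge> 1"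
  shows "\<bar>few n p - pois_few (real n * p)\<bar> \<le> (1 + real n * p) * (real n * p * p + (exp p - 1)) + p"
proof -
  define t A where "t = real n * p" and "A = (1 - p) ^ (n - 1)"
  have t: "t \<ge> 0" using assms by (simp add: t_def)
  have "A \<le> exp (- t) * exp p"
    using power_pred_one_minus_le[OF assms(1,2), of n 1] by (simp add: A_def t_def)
  then have "A - exp (- t) \<le> exp (- t) * (exp p - 1)" by (simp add: algebra_simps)
  also have "\<dots> \<le> 1 * (exp p - 1)" using t assms by (intro mult_right_mono) auto
  finally have 1: "A - exp (- t) \<le> exp p - 1" by simp
  have "exp (- t) * (1 - t * p) \<le> (1 - p) ^ n"
    using power_one_minus_bounds(2)[OF assms(1,2)] by (simp add: t_def)
  also have "\<dots> \<le> A" unfolding A_def using assms by (intro power_decreasing) auto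
  finally have "exp (- t) - A \<le> exp (- t) * (t * p)" by (simp add: algebra_simps)
  also have "\<dots> \<le> 1 * (t * p)" using t assms by (intro mult_right_mono) auto
  finally have 2: "exp (- t) - A \<le> t * p" by simp
  have "exp p - 1 \<ge> 0" "t * p \<ge> 0" using assms t by auto
  then have 3: "\<bar>A - exp (- t)\<bar> \<le> t * p + (exp p - 1)" using 1 2 by linarith
  have "few n p - pois_few t = (A - exp (- t)) * (1 + t - p) - exp (- t) * p"
    using few_eq[of n p] assms by (simp add: A_def t_def pois_few_def algebra_simps)
  also have "\<bar>\<dots>\<bar> \<le> \<bar>A - exp (- t)\<bar> * \<bar>1 + t - p\<bar> + exp (- t) * p"
    using assms by (intro order_trans[OF abs_triangle_ineq4] add_mono) (auto simp: abs_mult)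
  also have "\<dots> \<le> (t * p + (exp p - 1)) * (1 + t) + 1 * p"
    using 3 t assms by (intro add_mono mult_mono) auto
  finally show ?thesis by (simp add: t_def mult_ac)
qed

text \<open>The normalized covariance \<open>Y\<close> is compared with its limit \<open>E\<close>.
  Both sides of \<open>few_cov_bounds\<close> differ from \<open>E\<close> by correction factors:
  \<open>exp (3 * (p + r))\<close> pays for the exponent \<open>n - 3\<close>, the product
  \<open>(1 - 1/n) (1 - 2/n)\<close> is \<open>n (n - 1) (n - 2) / n^3\<close>, and the last factor
  is the loss in passing from a power to an exponential.\<close>

lemma cov_scaled_bounds:
  assumes p: "0 < p" "0 < r" "p + r \<le> 1" and n: "n \<ge> 2"
  defines "Y \<equiv> - few_cov n p r / (p * r * real n)" and "E \<equiv> pois_one (real n * p) * pois_one (real n * r)"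
  shows "Y \<le> E * exp (3 * (p + r))"
    and "E * ((1 - 1 / real n) * (1 - 2 / real n) * (1 - (real n * p + real n * r) * (p + r))) \<le> Y"
    and "0 \<le> Y"
proof -
  have pos: "0 < p * r * real n" using p n by auto
  have n1: "n \<ge> 1" using n by simp
  have "- few_cov n p r \<le> (p * r)\<^sup>2 * real n ^ 3 * ((1 - p) ^ (n - 3) * (1 - r) ^ (n - 3))"
    using few_cov_bounds(1)[of p r n] p n by (simp add: power_mult_distrib)
  also have "\<dots> \<le> (p * r)\<^sup>2 * real n ^ 3 * ((exp (- (real n * p)) * exp (real 3 * p)) * (exp (- (real n * r)) * exp (real 3 * r)))"
    using p by (intro mult_left_mono mult_mono power_pred_one_minus_le) auto
  also have "\<dots> = (p * r * real n) * (E * exp (3 * (p + r)))"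
    by (simp add: E_def pois_one_def power2_eq_square power3_eq_cube distrib_left exp_add mult_ac)
  finally show "Y \<le> E * exp (3 * (p + r))"
    unfolding Y_def by (subst pos_divide_le_eq[OF pos]) (simp only: mult_ac)
  have c: "real n * (real n - 1) * (real n - 2) = real n ^ 3 * ((1 - 1 / real n) * (1 - 2 / real n))"
    using n by (simp add: power3_eq_cube field_simps)
  have nn: "0 \<le> (1 - 1 / real n) * (1 - 2 / real n)" using n by (intro mult_nonneg_nonneg) auto
  have "(p * r * real n) * (E * ((1 - 1 / real n) * (1 - 2 / real n) * (1 - (real n * p + real n * r) * (p + r))))
     = (p * r)\<^sup>2 * (real n ^ 3 * ((1 - 1 / real n) * (1 - 2 / real n))) *
       (exp (- (real n * (p + r))) * (1 - real n * (p + r) * (p + r)))"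
    by (simp add: E_def pois_one_def power2_eq_square power3_eq_cube distrib_left exp_add exp_diff exp_minus mult_ac)
       (simp add: field_simps)
  also have "\<dots> \<le> (p * r)\<^sup>2 * (real n ^ 3 * ((1 - 1 / real n) * (1 - 2 / real n))) * (1 - (p + r)) ^ n"
    using p nn by (intro mult_left_mono power_one_minus_bounds) auto
  also have "\<dots> \<le> - few_cov n p r"
    using few_cov_bounds(2)[of p r n] p n1 unfolding c by (simp add: diff_diff_eq)
  finally show "E * ((1 - 1 / real n) * (1 - 2 / real n) * (1 - (real n * p + real n * r) * (p + r))) \<le> Y"
    unfolding Y_def by (subst pos_le_divide_eq[OF pos]) (simp only: mult_ac)
  have "0 \<le> (p * r)\<^sup>2 * (real n ^ 3 * ((1 - 1 / real n) * (1 - 2 / real n))) * (1 - p - r) ^ n"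
    using p nn n by (intro mult_nonneg_nonneg) auto
  also have "\<dots> \<le> - few_cov n p r"
    using few_cov_bounds(2)[of p r n] p n1 unfolding c by simp
  finally show "0 \<le> Y" unfolding Y_def using pos by (intro divide_nonneg_pos)
qed

text \<open>Two bounds for two purposes: the first holds with one constant at all levels and serves
  for domination, the second tends to 0 when the levels move along with \<open>log 2 n\<close> and
  gives the limit.\<close>

lemma cov_term_approx:
  assumes kl: "k \<ge> 1" "l \<ge> 1" and n: "n \<ge> 2"
  defines "p \<equiv> 1 / 2 ^ k" and "r \<equiv> 1 / 2 ^ l"
  defines "E \<equiv> pois_one (real n * p) * pois_one (real n * r)"
  shows "\<bar>cov_term n (k, l) / real n\<bar> \<le> exp 3 * E"
    and "\<bar>cov_term n (k, l) / real n + E\<bar> \<le> (exp (3 * (p + r)) - 1)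
       + (3 / real n + (real n * p + real n * r) * (p + r)) + exp 3 * (p + r)"
proof -
  define Y where "Y = - few_cov n p r / (p * r * real n)"
  have p: "0 < p" "0 < r" by (auto simp: p_def r_def)
  have pr: "p + r \<le> 1"
  proof -
    have "(2::real) ^ 1 \<le> 2 ^ k" "(2::real) ^ 1 \<le> 2 ^ l" using kl by (intro power_increasing; simp)+
    then have "p \<le> 1/2" "r \<le> 1/2" by (simp_all add: p_def r_def field_simps)
    then show ?thesis by linarith
  qed
  note Yb = cov_scaled_bounds[OF p pr n, folded Y_def E_def]
  have E: "0 \<le> E" "E \<le> 1" unfolding E_def using p n by (auto intro!: mult_nonneg_nonneg mult_le_one pois_one_bounds)
  have "exp (3 * (p + r)) \<le> exp (3::real)" using pr by simp
  then have Y3: "Y \<le> exp 3 * E" using Yb(1) E mult_left_mono[of "exp (3 * (p + r))" "exp 3" E] by (simp add: mult.commute)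
  \<comment> \<open>The proportion of comparable pairs among all pairs at these levels; it equals
    the cell probability of the shorter word.\<close>
  define d where "d = (2::real) ^ max k l / 2 ^ (k + l)"
  have d: "0 \<le> d" "d \<le> p + r" "d \<le> 1"
  proof -
    show "0 \<le> d" by (simp add: d_def)
    have "max k l = k \<or> max k l = l" by auto
    then have "d = p \<or> d = r" by (auto simp: d_def p_def r_def power_add)
    then show "d \<le> p + r" "d \<le> 1" using p pr by auto
  qed
  have ct: "cov_term n (k, l) / real n = - (Y * (1 - d))"
    using n by (simp add: cov_term_def Y_def d_def p_def r_def power_add field_simps)
  have "\<bar>cov_term n (k, l) / real n\<bar> = Y * (1 - d)" unfolding ct using Yb(3) d by (simp add: abs_mult)
  also have "\<dots> \<le> Y * 1" using Yb(3) d by (intro mult_left_mono) auto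
  finally show "\<bar>cov_term n (k, l) / real n\<bar> \<le> exp 3 * E" using Y3 by simp
  have up: "Y - E \<le> exp (3 * (p + r)) - 1"
  proof -
    have "Y - E \<le> E * (exp (3 * (p + r)) - 1)" using Yb(1) by (simp add: algebra_simps)
    also have "\<dots> \<le> 1 * (exp (3 * (p + r)) - 1)" using E p by (intro mult_right_mono) auto
    finally show ?thesis by simp
  qed
  have low: "E - Y \<le> 3 / real n + (real n * p + real n * r) * (p + r)"
  proof -
    define c \<delta> where "c = (1 - 1 / real n) * (1 - 2 / real n)" and "\<delta> = (real n * p + real n * r) * (p + r)"
    have \<delta>: "\<delta> \<ge> 0" using p by (auto simp: \<delta>_def)
    have c: "0 \<le> c" "c \<le> 1" unfolding c_def using n by (auto intro!: mult_nonneg_nonneg mult_le_one)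
    have "1 - c \<le> 3 / real n" using n by (simp add: c_def field_simps)
    moreover have "c * \<delta> \<le> 1 * \<delta>" using c \<delta> by (intro mult_right_mono) auto
    ultimately have q: "1 - c * (1 - \<delta>) \<le> 3 / real n + \<delta>" by (simp add: algebra_simps)
    have "E - Y \<le> E * (1 - c * (1 - \<delta>))" using Yb(2) by (simp add: c_def \<delta>_def algebra_simps)
    also have "\<dots> \<le> E * (3 / real n + \<delta>)" using E q by (intro mult_left_mono) auto
    also have "\<dots> \<le> 1 * (3 / real n + \<delta>)" using E \<delta> by (intro mult_right_mono) auto
    finally show ?thesis by (simp add: \<delta>_def)
  qed
  have "Y * d \<le> exp 3 * (p + r)"
  proof -
    have "Y \<le> exp 3 * 1" using Y3 E by (meson mult_left_mono exp_ge_zero order_trans)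
    then show ?thesis using d Yb(3) by (intro mult_mono) auto
  qed
  moreover have "0 \<le> Y * d" using Yb(3) d by auto
  moreover have "0 \<le> exp (3 * (p + r)) - 1" "0 \<le> 3 / real n + (real n * p + real n * r) * (p + r)" using p by auto
  moreover have "cov_term n (k, l) / real n + E = (E - Y) + Y * d" unfolding ct by (simp add: algebra_simps)
  ultimately show "\<bar>cov_term n (k, l) / real n + E\<bar> \<le> (exp (3 * (p + r)) - 1)
       + (3 / real n + (real n * p + real n * r) * (p + r)) + exp 3 * (p + r)"
    using up low by linarith
qed

section \<open>Dyadic rescaling and convergence of the variance\<close>

locale dyadic_scaling =
  fixes N :: "nat \<Rightarrow> nat" and x :: "nat \<Rightarrow> real"
  assumes x_ge: "\<And>n. n \<ge> 1 \<Longrightarrow> 1 \<le> x n" and x_le: "\<And>n. n \<ge> 1 \<Longrightarrow> x n \<le> 2"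
    and x_eq: "\<And>n. n \<ge> 1 \<Longrightarrow> real n = x n * 2 ^ N n"
begin

text \<open>The bound 1 in place of 0 keeps both words nonempty, as required by
  \<open>cov_term_approx\<close>.\<close>

lemma N_ge: "eventually (\<lambda>n. a + int (N n) \<ge> 1) sequentially"
proof -
  define K where "K = nat \<bar>a\<bar> + 2"
  have "a + int (N n) \<ge> 1" if n: "n \<ge> 2 ^ K" for n
  proof -
    have n1: "n \<ge> 1" using n by (meson one_le_numeral one_le_power order_trans)
    have "(2::real) ^ K \<le> real n" using n by (metis of_nat_le_iff of_nat_numeral of_nat_power)
    also have "\<dots> \<le> 2 * 2 ^ N n" using x_eq[OF n1] x_le[OF n1] by (simp add: mult_right_mono)
    finally have "(2::real) ^ K \<le> 2 ^ Suc (N n)" by simp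
    then have "K \<le> Suc (N n)" by (simp add: power_increasing_iff del: power_Suc)
    then show ?thesis by (simp add: K_def)
  qed
  then show ?thesis by (auto simp: eventually_sequentially)
qed

lemma scaled_eq:
  assumes "n \<ge> 1" "a + int (N n) \<ge> 0"
  shows "real n * (1 / 2 ^ nat (a + int (N n))) = scaled (x n) a"
proof -
  have "(2::real) ^ nat (a + int (N n)) = 2 powi (a + int (N n))"
    using assms by (simp add: power_int_def)
  also have "\<dots> = 2 powi a * 2 ^ N n" by (simp add: power_int_add)
  finally show ?thesis using x_eq[OF assms(1)] by (simp add: scaled_def)
qed

definition cell :: "int \<Rightarrow> nat \<Rightarrow> real" where "cell a n = 1 / 2 ^ nat (a + int (N n))"

lemma cell_pos: "0 < cell a n" "cell a n \<le> 1"
  by (auto simp: cell_def)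

lemma scaled_x_le: "n \<ge> 1 \<Longrightarrow> scaled (x n) a \<le> 2 / 2 powi a"
  unfolding scaled_def using x_le by (intro divide_right_mono) auto

lemma scaled_x_ge: "n \<ge> 1 \<Longrightarrow> 1 / 2 powi a \<le> scaled (x n) a"
  unfolding scaled_def using x_ge by (intro divide_right_mono) auto

lemma cell_tendsto_0: "(\<lambda>n. cell a n) \<longlonglongrightarrow> 0"
proof (rule Lim_null_comparison)
  show "eventually (\<lambda>n. norm (cell a n) \<le> (2 / 2 powi a) * (1 / real n)) sequentially"
    using N_ge[of a] eventually_ge_at_top[of 1]
  proof eventually_elim
    case (elim n)
    then have "real n * cell a n \<le> 2 / 2 powi a"
      using scaled_eq[of n a] scaled_x_le[of n a] by (simp add: cell_def)
    then show ?case using elim cell_pos[of a n] by (simp add: field_simps)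
  qed
  show "(\<lambda>n. (2 / 2 powi a) * (1 / real n)) \<longlonglongrightarrow> 0"
    by (intro tendsto_mult_right_zero lim_const_over_n)
qed

lemma few_cell_tendsto: "(\<lambda>n. few n (cell a n) - pois_few (scaled (x n) a)) \<longlonglongrightarrow> 0"
proof (rule Lim_null_comparison)
  define T where "T = (2::real) / 2 powi a"
  have T: "T \<ge> 0" by (simp add: T_def)
  show "eventually (\<lambda>n. norm (few n (cell a n) - pois_few (scaled (x n) a))
      \<le> (1 + T) * (T * cell a n + (exp (cell a n) - 1)) + cell a n) sequentially"
    using N_ge[of a] eventually_ge_at_top[of 1]
  proof eventually_elim
    case (elim n)
    have s: "real n * cell a n = scaled (x n) a" using elim scaled_eq[of n a] by (simp add: cell_def)
    have sT: "scaled (x n) a \<le> T" using scaled_x_le elim by (simp add: T_def)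
    have s0: "0 < scaled (x n) a" using elim x_ge by (intro scaled_pos) auto
    have "norm (few n (cell a n) - pois_few (scaled (x n) a))
        \<le> (1 + scaled (x n) a) * (scaled (x n) a * cell a n + (exp (cell a n) - 1)) + cell a n"
      using few_approx[of "cell a n" n] cell_pos[of a n] elim by (simp add: s)
    also have "\<dots> \<le> (1 + T) * (T * cell a n + (exp (cell a n) - 1)) + cell a n"
      using sT T s0 cell_pos[of a n] by (intro add_mono mult_mono) auto
    finally show ?case .
  qed
  have "(\<lambda>n. (1 + T) * (T * cell a n + (exp (cell a n) - 1)) + cell a n) \<longlonglongrightarrow> (1 + T) * (T * 0 + (exp 0 - 1)) + 0"
    by (intro tendsto_intros cell_tendsto_0)
  then show "(\<lambda>n. (1 + T) * (T * cell a n + (exp (cell a n) - 1)) + cell a n) \<longlonglongrightarrow> 0" by simp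
qed

lemma cov_tendsto:
  "(\<lambda>n. cov_term n (nat (a + int (N n)), nat (b + int (N n))) / real n
      + pois_one (scaled (x n) a) * pois_one (scaled (x n) b)) \<longlonglongrightarrow> 0"
proof (rule Lim_null_comparison)
  define T where "T = (2::real) / 2 powi a + 2 / 2 powi b"
  show "eventually (\<lambda>n. norm (cov_term n (nat (a + int (N n)), nat (b + int (N n))) / real n
      + pois_one (scaled (x n) a) * pois_one (scaled (x n) b))
      \<le> (exp (3 * (cell a n + cell b n)) - 1) + (3 / real n + T * (cell a n + cell b n)) + exp 3 * (cell a n + cell b n)) sequentially"
    using N_ge[of a] N_ge[of b] eventually_ge_at_top[of 2]
  proof eventually_elim
    case (elim n)
    have s: "real n * cell c n = scaled (x n) c" if "c = a \<or> c = b" for c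
      using that elim scaled_eq[of n c] by (auto simp: cell_def)
    have sT: "scaled (x n) a + scaled (x n) b \<le> T"
      using scaled_x_le[of n a] scaled_x_le[of n b] elim by (simp add: T_def)
    have "norm (cov_term n (nat (a + int (N n)), nat (b + int (N n))) / real n
      + pois_one (scaled (x n) a) * pois_one (scaled (x n) b))
      \<le> (exp (3 * (cell a n + cell b n)) - 1) + (3 / real n + (scaled (x n) a + scaled (x n) b) * (cell a n + cell b n)) + exp 3 * (cell a n + cell b n)"
      using cov_term_approx(2)[of "nat (a + int (N n))" "nat (b + int (N n))" n, folded cell_def] elim by (simp add: s)
    also have "\<dots> \<le> (exp (3 * (cell a n + cell b n)) - 1) + (3 / real n + T * (cell a n + cell b n)) + exp 3 * (cell a n + cell b n)"
      using sT cell_pos[of a n] cell_pos[of b n] by (intro add_mono mult_right_mono order_refl) auto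
    finally show ?case .
  qed
  have "(\<lambda>n. (exp (3 * (cell a n + cell b n)) - 1) + (3 / real n + T * (cell a n + cell b n)) + exp 3 * (cell a n + cell b n))
     \<longlonglongrightarrow> (exp (3 * (0 + 0)) - 1) + (0 + T * (0 + 0)) + exp 3 * (0 + 0)"
    by (intro tendsto_intros cell_tendsto_0 lim_const_over_n)
  then show "(\<lambda>n. (exp (3 * (cell a n + cell b n)) - 1) + (3 / real n + T * (cell a n + cell b n)) + exp 3 * (cell a n + cell b n)) \<longlonglongrightarrow> 0"
    by simp
qed

lemma nested_term_eq:
  assumes "n \<ge> 1" "a + int (N n) \<ge> 0" "b + int (N n) \<ge> 0"
  shows "nested_term n (nat (a + int (N n)), nat (b + int (N n))) / real n
     = (1 - few n (cell (max a b) n)) / scaled (x n) (max a b) * few n (cell (min a b) n)"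
proof -
  have mx: "max (nat (a + int (N n))) (nat (b + int (N n))) = nat (max a b + int (N n))" by auto
  have mn: "min (nat (a + int (N n))) (nat (b + int (N n))) = nat (min a b + int (N n))" by auto
  have s: "scaled (x n) (max a b) = real n * (1 / 2 ^ nat (max a b + int (N n)))"
    using assms scaled_eq[of n "max a b"] by simp
  show ?thesis unfolding nested_term_def prod.case mx mn s cell_def many_def by simp
qed

lemma nested_tendsto:
  "(\<lambda>n. nested_term n (nat (a + int (N n)), nat (b + int (N n))) / real n
     - (1 - pois_few (scaled (x n) (max a b))) / scaled (x n) (max a b) * pois_few (scaled (x n) (min a b))) \<longlonglongrightarrow> 0"
proof (rule Lim_null_comparison)
  define \<sigma> where "\<sigma> = (2::real) powi (max a b)"
  define d where "d c n = few n (cell c n) - pois_few (scaled (x n) c)" for c n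
  show "eventually (\<lambda>n. norm (nested_term n (nat (a + int (N n)), nat (b + int (N n))) / real n
     - (1 - pois_few (scaled (x n) (max a b))) / scaled (x n) (max a b) * pois_few (scaled (x n) (min a b)))
     \<le> (\<bar>d (max a b) n\<bar> + \<bar>d (min a b) n\<bar>) * \<sigma>) sequentially"
    using N_ge[of a] N_ge[of b] eventually_ge_at_top[of 1]
  proof eventually_elim
    case (elim n)
    define s F G f g where "s = scaled (x n) (max a b)" and "F = few n (cell (max a b) n)" and "G = few n (cell (min a b) n)"
      and "f = pois_few (scaled (x n) (max a b))" and "g = pois_few (scaled (x n) (min a b))"
    have s: "0 < s" unfolding s_def using elim x_ge by (intro scaled_pos) auto
    have "1 / \<sigma> \<le> s" unfolding s_def \<sigma>_def by (rule scaled_x_ge) (use elim in auto)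
    then have inv_s: "1 / s \<le> \<sigma>" using s by (simp add: \<sigma>_def field_simps)
    have bds: "0 \<le> G" "G \<le> 1" "0 \<le> f" "f \<le> 1"
      unfolding G_def f_def using cell_pos few_bounds[of "cell (min a b) n" n] pois_few_bounds[OF s[unfolded s_def]]
      by (auto simp: less_imp_le)
    have frac: "(1 - F) / s * G - (1 - f) / s * g = ((1 - F) * G - (1 - f) * g) / s"
      using s by (simp add: field_simps)
    have "nested_term n (nat (a + int (N n)), nat (b + int (N n))) / real n = (1 - F) / s * G"
      using nested_term_eq[of n a b] elim by (simp add: s_def F_def G_def)
    then have "norm (nested_term n (nat (a + int (N n)), nat (b + int (N n))) / real n - (1 - f) / s * g)
       = \<bar>((1 - F) * G - (1 - f) * g) / s\<bar>" by (simp only: frac real_norm_def)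
    also have "\<dots> = \<bar>(F - f) * G - (1 - f) * (G - g)\<bar> * (1 / s)"
    proof -
      have "(1 - F) * G - (1 - f) * g = - ((F - f) * G - (1 - f) * (G - g))" by (simp add: algebra_simps)
      then show ?thesis using s by (simp only: abs_divide abs_minus_cancel abs_of_pos) simp
    qed
    also have "\<dots> \<le> (\<bar>F - f\<bar> + \<bar>G - g\<bar>) * \<sigma>"
    proof (intro mult_mono inv_s)
      have "\<bar>(F - f) * G - (1 - f) * (G - g)\<bar> \<le> \<bar>F - f\<bar> * \<bar>G\<bar> + \<bar>1 - f\<bar> * \<bar>G - g\<bar>"
        unfolding abs_mult[symmetric] by (rule abs_triangle_ineq4)
      also have "\<dots> \<le> \<bar>F - f\<bar> * 1 + 1 * \<bar>G - g\<bar>" using bds by (intro add_mono mult_mono) auto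
      finally show "\<bar>(F - f) * G - (1 - f) * (G - g)\<bar> \<le> \<bar>F - f\<bar> + \<bar>G - g\<bar>" by simp
    qed (use s in auto)
    finally show ?case by (simp add: d_def s_def F_def G_def f_def g_def)
  qed
  have "(\<lambda>n. (\<bar>d (max a b) n\<bar> + \<bar>d (min a b) n\<bar>) * \<sigma>) \<longlonglongrightarrow> (\<bar>0\<bar> + \<bar>0\<bar>) * \<sigma>"
    unfolding d_def by (intro tendsto_intros few_cell_tendsto)
  then show "(\<lambda>n. (\<bar>d (max a b) n\<bar> + \<bar>d (min a b) n\<bar>) * \<sigma>) \<longlonglongrightarrow> 0" by simp
qed

text \<open>Levels are counted relative to \<open>N n\<close>. Pairs above the root get the value 0,
  so that the sums for all \<open>n\<close> run over the same index set and can share one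
  majorant.\<close>

definition shifted_term :: "nat \<Rightarrow> int \<times> int \<Rightarrow> real" where
  "shifted_term n = (\<lambda>(a, b). if a + int (N n) \<ge> 0 \<and> b + int (N n) \<ge> 0
      then (cov_term n (nat (a + int (N n)), nat (b + int (N n)))
           + nested_term n (nat (a + int (N n)), nat (b + int (N n)))) / real n else 0)"

lemma shifted_term_has_sum: "(shifted_term n has_sum trie_var n / real n) UNIV"
proof -
  let ?h = "\<lambda>(k, l). (int k - int (N n), int l - int (N n))"
  have "((\<lambda>y. (cov_term n y + nested_term n y) * (1 / real n)) has_sum trie_var n * (1 / real n)) UNIV"
    by (intro has_sum_cmult_left trie_var_has_sum)
  also have "(\<lambda>y. (cov_term n y + nested_term n y) * (1 / real n)) = shifted_term n \<circ> ?h"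
    by (auto simp: fun_eq_iff shifted_term_def)
  finally have "(shifted_term n has_sum trie_var n * (1 / real n)) (range ?h)"
    by (subst has_sum_reindex) (auto simp: inj_on_def o_def)
  also have "?this \<longleftrightarrow> (shifted_term n has_sum trie_var n * (1 / real n)) UNIV"
  proof (rule has_sum_cong_neutral)
    fix y assume y: "y \<in> UNIV - range ?h"
    obtain a b where ab: "y = (a, b)" by (cases y)
    have "\<not> (a + int (N n) \<ge> 0 \<and> b + int (N n) \<ge> 0)"
    proof
      assume "a + int (N n) \<ge> 0 \<and> b + int (N n) \<ge> 0"
      then have "y = ?h (nat (a + int (N n)), nat (b + int (N n)))" by (simp add: ab)
      then show False using y by blast
    qed
    then show "shifted_term n y = 0" by (auto simp: shifted_term_def ab)
  qed auto
  finally show ?thesis by simp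
qed

text \<open>As \<open>x n\<close> stays in the interval from 1 to 2, the majorant is independent of
  \<open>n\<close>. Covariances contribute at most \<open>21 * 4 = 84\<close>, with
  \<open>exp 3 <= 21\<close>, and nested pairs at most \<open>3 * 4 = 12\<close>.\<close>

lemma shifted_term_bound:
  assumes n: "n \<ge> 2"
  shows "\<bar>shifted_term n (a, b)\<bar> \<le> 100 * \<rho> ^ (nat \<bar>a\<bar> + nat \<bar>b\<bar>)"
proof (cases "a + int (N n) \<ge> 0 \<and> b + int (N n) \<ge> 0")
  case False
  then show ?thesis by (auto simp: shifted_term_def)
next
  case True
  let ?k = "nat (a + int (N n))" and ?l = "nat (b + int (N n))"
  have x: "1 \<le> x n" "x n \<le> 2" using n x_ge x_le by auto
  have s: "real n * (1 / 2 ^ ?k) = scaled (x n) a" "real n * (1 / 2 ^ ?l) = scaled (x n) b"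
    using True n scaled_eq by auto
  have e3: "exp (3::real) \<le> 21"
  proof -
    have "exp (1::real) \<le> 11/4" by (rule order.strict_implies_order) (use e_less_272 in simp)
    then have "exp (1::real) ^ 3 \<le> (11/4) ^ 3" by (intro power_mono) auto
    also have "exp (1::real) ^ 3 = exp 3" by (simp flip: exp_of_nat_mult)
    finally show ?thesis by (simp add: power3_eq_cube)
  qed
  have e1: "exp (1::real) \<le> 3" using exp_le by simp
  have cov: "\<bar>cov_term n (?k, ?l) / real n\<bar> \<le> 21 * (4 * \<rho> ^ (nat \<bar>a\<bar> + nat \<bar>b\<bar>))"
  proof (cases "?k = 0 \<or> ?l = 0")
    case True
    then have "cov_term n (?k, ?l) = 0" by (auto simp: cov_term_def)
    then show ?thesis by simp
  next
    case False
    then have "?k \<ge> 1" "?l \<ge> 1" by linarith+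
    from cov_term_approx(1)[OF this n]
    have "\<bar>cov_term n (?k, ?l) / real n\<bar> \<le> exp 3 * (pois_one (scaled (x n) a) * pois_one (scaled (x n) b))"
      unfolding s .
    also have "\<dots> \<le> 21 * (4 * \<rho> ^ (nat \<bar>a\<bar> + nat \<bar>b\<bar>))"
      using x by (intro mult_mono e3 pois_one_product_bound mult_nonneg_nonneg pois_one_bounds scaled_pos) auto
    finally show ?thesis .
  qed
  let ?s = "scaled (x n) (max a b)" and ?t = "scaled (x n) (min a b)"
  have st: "0 < ?s" "0 < ?t" using x by (auto intro: scaled_pos)
  have c: "real n * cell c n = scaled (x n) c" if "c = max a b \<or> c = min a b" for c
    using that True n scaled_eq[of n c] by (auto simp: cell_def)
  have F: "0 \<le> few n (cell c n)" "few n (cell c n) \<le> 1" "1 - few n (cell c n) \<le> (real n * cell c n)\<^sup>2" for c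
    using few_bounds[of "cell c n" n] cell_pos[of c n] by auto
  have nest: "nested_term n (?k, ?l) / real n = (1 - few n (cell (max a b) n)) / ?s * few n (cell (min a b) n)"
    using nested_term_eq[of n a b] True n by simp
  \<comment> \<open>Division by 3 meets the hypothesis \<open>f <= 2 / scaled x (min a b)\<close> of
    \<open>nested_bound\<close>: the bound for \<open>few\<close> exceeds the one for
    \<open>pois_few\<close> by the factor \<open>exp 1 <= 3\<close>.\<close>
  have "(1 - few n (cell (max a b) n)) / ?s * (few n (cell (min a b) n) / 3) \<le> 4 * \<rho> ^ (nat \<bar>a\<bar> + nat \<bar>b\<bar>)"
  proof (rule nested_bound[OF x])
    show "0 \<le> (1 - few n (cell (max a b) n)) / ?s" "(1 - few n (cell (max a b) n)) / ?s \<le> 1 / ?s"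
      using F st by (auto intro!: divide_right_mono)
    show "(1 - few n (cell (max a b) n)) / ?s \<le> ?s"
      using F(3)[of "max a b"] st unfolding c[OF disjI1[OF refl]] by (simp add: field_simps power2_eq_square)
    show "few n (cell (min a b) n) / 3 \<le> 2 / ?t"
    proof -
      have "few n (cell (min a b) n) \<le> exp 1 * pois_few ?t"
        using few_le_pois_few[of "cell (min a b) n" n] cell_pos[of "min a b" n] n c[OF disjI2[OF refl]] by simp
      also have "\<dots> \<le> 3 * (2 / ?t)" using pois_few_bounds[OF st(2)] by (intro mult_mono e1) auto
      finally show ?thesis by simp
    qed
  qed (use F(1)[of "min a b"] F(2)[of "min a b"] in auto)
  then have "nested_term n (?k, ?l) / real n \<le> 12 * \<rho> ^ (nat \<bar>a\<bar> + nat \<bar>b\<bar>)" unfolding nest by simp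
  moreover have "0 \<le> nested_term n (?k, ?l) / real n" by (simp add: nested_term_nonneg)
  moreover have "shifted_term n (a, b) = cov_term n (?k, ?l) / real n + nested_term n (?k, ?l) / real n"
    using True by (simp add: shifted_term_def add_divide_distrib)
  moreover have "0 \<le> \<rho> ^ (nat \<bar>a\<bar> + nat \<bar>b\<bar>)" by simp
  ultimately show ?thesis using cov by linarith
qed

text \<open>The limit terms move with \<open>x n\<close>, which need not converge. Dominated
  convergence is therefore applied to the differences, with the constant
  \<open>108 = 100 + 8\<close>.\<close>

lemma trie_var_limit: "(\<lambda>n. trie_var n / real n - var_limit (x n)) \<longlonglongrightarrow> 0"
proof -
  have "(\<lambda>n. infsum (\<lambda>z. shifted_term n z - lim_term (x n) z) UNIV) \<longlonglongrightarrow> 0"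
  proof (rule infsum_dominated_tendsto_0[where m = 2])
    show "(\<lambda>z. 108 * (case z of (a, b) \<Rightarrow> \<rho> ^ (nat \<bar>a\<bar> + nat \<bar>b\<bar>))) summable_on (UNIV :: (int \<times> int) set)"
      by (intro summable_on_cmult_right summable_on_int_pairs)
    fix z :: "int \<times> int"
    obtain a b where z: "z = (a, b)" by (cases z)
    show "\<bar>shifted_term n z - lim_term (x n) z\<bar> \<le> 108 * (case z of (a, b) \<Rightarrow> \<rho> ^ (nat \<bar>a\<bar> + nat \<bar>b\<bar>))" if "n \<ge> 2" for n
    proof -
      have "1 \<le> x n" "x n \<le> 2" using that x_ge x_le by auto
      from lim_term_bound[OF this, of a b] shifted_term_bound[OF that, of a b] show ?thesis
        unfolding z prod.case by linarith
    qed
    have "(\<lambda>n. (cov_term n (nat (a + int (N n)), nat (b + int (N n))) / real n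
        + pois_one (scaled (x n) a) * pois_one (scaled (x n) b))
      + (nested_term n (nat (a + int (N n)), nat (b + int (N n))) / real n
     - (1 - pois_few (scaled (x n) (max a b))) / scaled (x n) (max a b) * pois_few (scaled (x n) (min a b)))) \<longlonglongrightarrow> 0 + 0"
      by (intro tendsto_add cov_tendsto nested_tendsto)
    moreover have "eventually (\<lambda>n. (cov_term n (nat (a + int (N n)), nat (b + int (N n))) / real n
        + pois_one (scaled (x n) a) * pois_one (scaled (x n) b))
      + (nested_term n (nat (a + int (N n)), nat (b + int (N n))) / real n
     - (1 - pois_few (scaled (x n) (max a b))) / scaled (x n) (max a b) * pois_few (scaled (x n) (min a b)))
      = shifted_term n z - lim_term (x n) z) sequentially"
      using N_ge[of a] N_ge[of b]
      by eventually_elim (simp add: z shifted_term_def lim_term_def add_divide_distrib)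
    ultimately show "(\<lambda>n. shifted_term n z - lim_term (x n) z) \<longlonglongrightarrow> 0"
      by (simp add: tendsto_cong)
  qed
  moreover have "eventually (\<lambda>n. infsum (\<lambda>z. shifted_term n z - lim_term (x n) z) UNIV = trie_var n / real n - var_limit (x n)) sequentially"
    using eventually_ge_at_top[of 1]
  proof eventually_elim
    case (elim n)
    have "(lim_term (x n) has_sum var_limit (x n)) UNIV"
      unfolding var_limit_def using elim x_ge x_le by (intro has_sum_infsum lim_term_summable) auto
    then have "((\<lambda>z. shifted_term n z + - lim_term (x n) z) has_sum trie_var n / real n + - var_limit (x n)) UNIV"
      by (intro has_sum_add shifted_term_has_sum has_sum_uminusI)
    then show ?case by (simp add: infsumI)
  qed
  ultimately show ?thesis by (simp add: tendsto_cong)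
qed

end

lemma ex_dyadic_scaling: "\<exists>N x. dyadic_scaling N x"
proof -
  have "\<exists>m. 2 ^ m \<le> n \<and> n < 2 ^ (m + 1)" if "n \<ge> 1" for n :: nat
    using ex_power_ivl1[of 2 n] that by auto
  then obtain N where N: "\<And>n::nat. n \<ge> 1 \<Longrightarrow> 2 ^ N n \<le> n \<and> n < 2 ^ (N n + 1)" by metis
  have "dyadic_scaling N (\<lambda>n. real n / 2 ^ N n)"
  proof
    fix n :: nat assume n: "n \<ge> 1"
    have "real (2 ^ N n) \<le> real n" "real n \<le> real (2 ^ (N n + 1))" using N[OF n] by (auto simp del: of_nat_power)
    then show "1 \<le> real n / 2 ^ N n" "real n / 2 ^ N n \<le> 2" by (auto simp: field_simps)
  qed auto
  then show ?thesis by blast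
qed

section \<open>Uniqueness of Fourier coefficients\<close>

definition fourier_null :: "(real \<Rightarrow> complex) \<Rightarrow> bool" where
  "fourier_null f \<longleftrightarrow> continuous_on {0..2 * pi} f \<and>
     (\<forall>k::int. integral {0..2 * pi} (\<lambda>\<theta>. f \<theta> * cis (real_of_int k * \<theta>)) = 0)"

lemma continuous_on_cis_mult [continuous_intros]: "continuous_on A (\<lambda>\<theta>. cis (c * \<theta>))"
  unfolding cis_conv_exp by (intro continuous_intros)

lemma fourier_null_lincomb:
  assumes "fourier_null f" "fourier_null g"
  shows "fourier_null (\<lambda>\<theta>. u * f \<theta> + v * g \<theta>)"
proof -
  have c: "continuous_on {0..2 * pi} f" "continuous_on {0..2 * pi} g"
    using assms by (auto simp: fourier_null_def)
  have "integral {0..2 * pi} (\<lambda>\<theta>. (u * f \<theta> + v * g \<theta>) * cis (real_of_int k * \<theta>)) = 0" for k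
  proof -
    have eq: "(\<lambda>\<theta>. (u * f \<theta> + v * g \<theta>) * cis (real_of_int k * \<theta>))
      = (\<lambda>\<theta>. u * (f \<theta> * cis (real_of_int k * \<theta>)) + v * (g \<theta> * cis (real_of_int k * \<theta>)))"
      by (simp add: algebra_simps)
    have "integral {0..2 * pi} (\<lambda>\<theta>. (u * f \<theta> + v * g \<theta>) * cis (real_of_int k * \<theta>)) = integral {0..2 * pi} (\<lambda>\<theta>. u * (f \<theta> * cis (real_of_int k * \<theta>)))
       + integral {0..2 * pi} (\<lambda>\<theta>. v * (g \<theta> * cis (real_of_int k * \<theta>)))"
      unfolding eq by (rule integral_add) (intro integrable_continuous_interval continuous_intros c)+
    also have "\<dots> = 0"
      using assms unfolding fourier_null_def by (simp only: integral_mult_right) simp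
    finally show ?thesis .
  qed
  moreover have "continuous_on {0..2 * pi} (\<lambda>\<theta>. u * f \<theta> + v * g \<theta>)"
    by (intro continuous_intros c)
  ultimately show ?thesis unfolding fourier_null_def by blast
qed

lemma fourier_null_shift:
  assumes "fourier_null f"
  shows "fourier_null (\<lambda>\<theta>. f \<theta> * cis (real_of_int l * \<theta>))"
proof -
  have eq: "f \<theta> * cis (real_of_int l * \<theta>) * cis (real_of_int k * \<theta>) = f \<theta> * cis (real_of_int (l + k) * \<theta>)" for \<theta> k
    by (simp add: cis_mult mult.assoc distrib_right)
  show ?thesis
    using assms unfolding fourier_null_def eq by (auto intro!: continuous_intros simp del: of_int_add)
qed

text \<open>Multiplication by \<open>cis\<close> only shifts the Fourier coefficients, so a function
  with vanishing coefficients stays such after multiplication by a trigonometric polynomial; on the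
  circle every real polynomial in the coordinates is one.\<close>

lemma fourier_null_mult_polynomial:
  fixes p :: "complex \<Rightarrow> real"
  assumes "real_polynomial_function p" "fourier_null f"
  shows "fourier_null (\<lambda>\<theta>. f \<theta> * of_real (p (cis \<theta>)))"
  using assms
proof (induction p arbitrary: f rule: real_polynomial_function.induct)
  case (linear p)
  \<comment> \<open>A real linear form on the complex plane is \<alpha> times \<open>z\<close> plus
    \<beta> times the conjugate of \<open>z\<close>, and on the circle the conjugate is
    \<open>cis (- \<theta>)\<close>.\<close>
  define \<alpha> \<beta> where "\<alpha> = (of_real (p 1) - \<i> * of_real (p \<i>)) / 2" and "\<beta> = (of_real (p 1) + \<i> * of_real (p \<i>)) / 2"
  interpret p: bounded_linear p by fact
  have p: "of_real (p (cis \<theta>)) = \<alpha> * cis (real_of_int 1 * \<theta>) + \<beta> * cis (real_of_int (-1) * \<theta>)" for \<theta>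
  proof -
    have "p (cis \<theta>) = p (cos \<theta> *\<^sub>R 1 + sin \<theta> *\<^sub>R \<i>)"
      by (intro arg_cong[where f = p]) (simp add: complex_eq_iff)
    also have "\<dots> = cos \<theta> * p 1 + sin \<theta> * p \<i>" by (simp only: p.add p.scaleR real_scaleR_def)
    finally show ?thesis by (simp add: \<alpha>_def \<beta>_def complex_eq_iff field_simps)
  qed
  have "(\<lambda>\<theta>. f \<theta> * of_real (p (cis \<theta>))) = (\<lambda>\<theta>. \<alpha> * (f \<theta> * cis (real_of_int 1 * \<theta>)) + \<beta> * (f \<theta> * cis (real_of_int (-1) * \<theta>)))"
    unfolding p by (simp add: algebra_simps)
  then show ?case
    using fourier_null_lincomb[OF fourier_null_shift[OF linear(2), of 1] fourier_null_shift[OF linear(2), of "-1"], of \<alpha> \<beta>]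
    by (simp only:)
next
  case (const c)
  show ?case
    using fourier_null_lincomb[OF const const, of "of_real c" 0] by (simp add: mult.commute)
next
  case (add p q)
  have "fourier_null (\<lambda>\<theta>. f \<theta> * of_real (p (cis \<theta>)))" "fourier_null (\<lambda>\<theta>. f \<theta> * of_real (q (cis \<theta>)))"
    using add by auto
  from fourier_null_lincomb[OF this, of 1 1] show ?case by (simp add: distrib_left)
next
  case (mult p q)
  have "fourier_null (\<lambda>\<theta>. f \<theta> * of_real (p (cis \<theta>)))" using mult by auto
  then have "fourier_null (\<lambda>\<theta>. f \<theta> * of_real (p (cis \<theta>)) * of_real (q (cis \<theta>)))" using mult by blast
  then show ?case by (simp add: mult.assoc)
qed

lemma periodic_int_shift:
  fixes \<gamma> :: "real \<Rightarrow> 'a"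
  assumes "\<And>\<theta>. \<gamma> (\<theta> + 2 * pi) = \<gamma> \<theta>"
  shows "\<gamma> (\<theta> + 2 * pi * real_of_int k) = \<gamma> \<theta>"
proof -
  have nat: "\<gamma> (\<theta> + 2 * pi * real n) = \<gamma> \<theta>" for n \<theta>
  proof (induction n)
    case (Suc n)
    have "\<gamma> (\<theta> + 2 * pi * real (Suc n)) = \<gamma> ((\<theta> + 2 * pi * real n) + 2 * pi)"
      by (simp add: algebra_simps)
    then show ?case using assms Suc by simp
  qed auto
  show ?thesis
  proof (cases "k \<ge> 0")
    case True
    then show ?thesis using nat[of \<theta> "nat k"] by simp
  next
    case False
    then show ?thesis using nat[of "\<theta> + 2 * pi * real_of_int k" "nat (-k)"] by simp
  qed
qed

text \<open>Stone-Weierstrass is to be used on the circle, where the coordinate polynomials restrict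
  to trigonometric ones; hence the periodic function is first pulled back along the
  argument.\<close>

lemma periodic_imp_circle_function:
  fixes \<gamma> :: "real \<Rightarrow> real"
  assumes cont: "continuous_on UNIV \<gamma>" and per: "\<And>\<theta>. \<gamma> (\<theta> + 2 * pi) = \<gamma> \<theta>"
  obtains G :: "complex \<Rightarrow> real" where "continuous_on (sphere 0 1) G" "\<And>\<theta>. G (cis \<theta>) = \<gamma> \<theta>"
proof
  define G where "G z = \<gamma> (Im (Ln z))" for z
  have eq: "\<gamma> \<theta> = \<gamma> \<phi>" if "cis \<theta> = cis \<phi>" for \<theta> \<phi>
  proof -
    have "exp (\<i> * of_real \<theta>) = exp (\<i> * of_real \<phi>)" using that by (simp add: cis_conv_exp)
    then obtain n :: int where "\<i> * of_real \<theta> = \<i> * of_real \<phi> + complex_of_real (real_of_int (2 * n) * pi) * \<i>"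
      by (auto simp: exp_eq)
    then have "\<theta> = \<phi> + 2 * pi * real_of_int n" by (auto simp: complex_eq_iff)
    then show ?thesis using periodic_int_shift[of \<gamma> \<phi> n] per by simp
  qed
  have cis_Ln: "cis (Im (Ln z)) = z" if "z \<in> sphere 0 1" for z
  proof -
    have z: "z \<noteq> 0" "norm z = 1" using that by auto
    have "exp (Ln z) = z" using z by simp
    moreover have "Re (Ln z) = 0" using z by simp
    ultimately show ?thesis by (metis exp_eq_polar exp_zero of_real_1 mult_1)
  qed
  show G: "G (cis \<theta>) = \<gamma> \<theta>" for \<theta>
    unfolding G_def by (rule eq, rule cis_Ln) simp
  have cont': "isCont \<gamma> \<theta>" for \<theta> using cont by (simp add: continuous_on_eq_continuous_at)
  show "continuous_on (sphere 0 1) G"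
    unfolding continuous_on_eq_continuous_within
  proof
    fix z :: complex assume z: "z \<in> sphere 0 1"
    show "continuous (at z within sphere 0 1) G"
    proof (cases "z \<in> \<real>\<^sub>\<le>\<^sub>0")
      case False
      have "isCont (\<lambda>z. Im (Ln z)) z" using False by (intro isCont_Im continuous_at_Ln)
      then have "isCont G z" unfolding G_def by (rule isCont_o2) (rule cont')
      then show ?thesis by (rule continuous_at_imp_continuous_at_within)
    next
      case True
      \<comment> \<open>The principal argument jumps on the negative real axis. There the argument
        of \<open>- z\<close> increased by \<open>pi\<close> is continuous, and it differs from an
        argument of \<open>z\<close> by a multiple of the period only.\<close>
      define H where "H z = \<gamma> (Im (Ln (- z)) + pi)" for z
      have "- z \<notin> \<real>\<^sub>\<le>\<^sub>0" using True z by (auto simp: complex_nonpos_Reals_iff cmod_eq_Re)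
      then have "isCont (\<lambda>z. Im (Ln (- z)) + pi) z" by (intro continuous_intros isCont_Im isCont_Ln') auto
      then have "isCont H z" unfolding H_def by (rule isCont_o2) (rule cont')
      then have cH: "continuous (at z within sphere 0 1) H" by (rule continuous_at_imp_continuous_at_within)
      have HG: "H w = G w" if "w \<in> sphere 0 1" for w
        unfolding H_def G_def using cis_Ln[OF that] cis_Ln[of "- w"] that
        by (intro eq) (simp add: cis_mult[symmetric])
      show ?thesis
        by (rule continuous_transform_within[where \<delta> = 1, OF cH]) (use z HG in auto)
    qed
  qed
qed

text \<open>For a polynomial \<open>p\<close> uniformly within \<open>e\<close> of \<gamma> on the
  circle, the integral of \<open>\<gamma> p\<close> vanishes. Thus the integral of the square of
  \<gamma> equals that of \<open>\<gamma> (\<gamma> - p)\<close>, which is at most \<open>e\<close>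
  times the integral of the absolute value of \<gamma>.\<close>

lemma fourier_null_real_eq_0:
  fixes \<gamma> :: "real \<Rightarrow> real"
  assumes cont: "continuous_on UNIV \<gamma>" and per: "\<And>\<theta>. \<gamma> (\<theta> + 2 * pi) = \<gamma> \<theta>"
    and null: "fourier_null (\<lambda>\<theta>. of_real (\<gamma> \<theta>))"
  shows "\<gamma> \<theta> = 0"
proof -
  obtain G :: "complex \<Rightarrow> real" where G: "continuous_on (sphere 0 1) G" "\<And>\<theta>. G (cis \<theta>) = \<gamma> \<theta>"
    using periodic_imp_circle_function[OF cont per] by blast
  have c: "continuous_on {0..2 * pi} \<gamma>" using cont by (rule continuous_on_subset) auto
  have int: "(\<lambda>\<theta>. \<bar>\<gamma> \<theta>\<bar>) integrable_on {0..2 * pi}"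
    by (intro integrable_continuous_interval continuous_intros c)
  define A where "A = integral {0..2 * pi} (\<lambda>\<theta>. \<bar>\<gamma> \<theta>\<bar>)"
  have A: "A \<ge> 0" unfolding A_def by (intro integral_nonneg int) auto
  have le: "integral {0..2 * pi} (\<lambda>\<theta>. \<gamma> \<theta> * \<gamma> \<theta>) \<le> e * A" if e: "e > 0" for e
  proof -
    obtain p where p: "real_polynomial_function p" "\<And>z. z \<in> sphere 0 1 \<Longrightarrow> \<bar>G z - p z\<bar> < e"
      using Stone_Weierstrass_real_polynomial_function[OF compact_sphere G(1) e] by blast
    have "continuous_on UNIV p"
      using p(1) by (simp add: continuous_on_eq_continuous_at continuous_real_polymonial_function)
    then have pc: "continuous_on {0..2 * pi} (\<lambda>\<theta>. p (cis \<theta>))"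
      using continuous_on_cis_mult[of "{0..2*pi}" 1] \<open>continuous_on UNIV p\<close> by (auto intro: continuous_on_compose2)
    have "complex_of_real (integral {0..2 * pi} (\<lambda>\<theta>. \<gamma> \<theta> * p (cis \<theta>)))
        = integral {0..2 * pi} (\<lambda>\<theta>. of_real (\<gamma> \<theta> * p (cis \<theta>)))"
      by (rule integral_linear[symmetric, unfolded o_def])
         (auto intro!: bounded_linear_of_real integrable_continuous_interval continuous_intros c pc)
    also have "\<dots> = 0"
      using fourier_null_mult_polynomial[OF p(1) null] unfolding fourier_null_def
      by (auto dest!: spec[of _ "0::int"])
    finally have z: "integral {0..2 * pi} (\<lambda>\<theta>. \<gamma> \<theta> * p (cis \<theta>)) = 0" by simp
    have "integral {0..2 * pi} (\<lambda>\<theta>. \<gamma> \<theta> * \<gamma> \<theta>)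
      = integral {0..2 * pi} (\<lambda>\<theta>. \<gamma> \<theta> * \<gamma> \<theta>) - integral {0..2 * pi} (\<lambda>\<theta>. \<gamma> \<theta> * p (cis \<theta>))"
      by (simp add: z)
    also have "\<dots> = integral {0..2 * pi} (\<lambda>\<theta>. \<gamma> \<theta> * \<gamma> \<theta> - \<gamma> \<theta> * p (cis \<theta>))"
      by (rule integral_diff[symmetric]) (intro integrable_continuous_interval continuous_intros c pc)+
    also have "\<dots> \<le> integral {0..2 * pi} (\<lambda>\<theta>. e * \<bar>\<gamma> \<theta>\<bar>)"
    proof (rule integral_le)
      fix \<theta>
      have "\<gamma> \<theta> * \<gamma> \<theta> - \<gamma> \<theta> * p (cis \<theta>) = \<gamma> \<theta> * (G (cis \<theta>) - p (cis \<theta>))" by (simp add: G(2) algebra_simps)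
      also have "\<dots> \<le> \<bar>\<gamma> \<theta>\<bar> * \<bar>G (cis \<theta>) - p (cis \<theta>)\<bar>" unfolding abs_mult[symmetric] by (rule abs_ge_self)
      also have "\<dots> \<le> \<bar>\<gamma> \<theta>\<bar> * e" using p(2)[of "cis \<theta>"] by (intro mult_left_mono) auto
      finally show "\<gamma> \<theta> * \<gamma> \<theta> - \<gamma> \<theta> * p (cis \<theta>) \<le> e * \<bar>\<gamma> \<theta>\<bar>" by (simp add: mult.commute)
    qed (intro integrable_continuous_interval continuous_intros c pc)+
    also have "\<dots> = e * A" by (simp add: A_def)
    finally show ?thesis .
  qed
  have "integral {0..2 * pi} (\<lambda>\<theta>. \<gamma> \<theta> * \<gamma> \<theta>) \<le> 0"
  proof (rule field_le_epsilon)
    fix e :: real assume e: "e > 0"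
    \<comment> \<open>The denominator is \<open>A + 1\<close> since \<open>A\<close> may be
      0.\<close>
    have "e / (A + 1) * A \<le> e" using e A by (simp add: field_simps)
    then show "integral {0..2 * pi} (\<lambda>\<theta>. \<gamma> \<theta> * \<gamma> \<theta>) \<le> 0 + e" using le[of "e / (A + 1)"] e A by auto
  qed
  moreover have "integral {0..2 * pi} (\<lambda>\<theta>. \<gamma> \<theta> * \<gamma> \<theta>) \<ge> 0"
    by (intro integral_nonneg integrable_continuous_interval continuous_intros c) auto
  ultimately have "integral {0..2 * pi} (\<lambda>\<theta>. \<gamma> \<theta> * \<gamma> \<theta>) = 0" by simp
  moreover have "continuous_on {0..2 * pi} (\<lambda>\<theta>. \<gamma> \<theta> * \<gamma> \<theta>)"
    by (intro continuous_intros c)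
  ultimately have "\<forall>\<theta>\<in>{0..2 * pi}. \<gamma> \<theta> * \<gamma> \<theta> = 0"
    by (subst (asm) integral_eq_0_iff) auto
  then have zero: "\<gamma> \<theta> = 0" if "\<theta> \<in> {0..2 * pi}" for \<theta>
    using that by auto
  define k where "k = \<lfloor>\<theta> / (2 * pi)\<rfloor>"
  have "real_of_int k \<le> \<theta> / (2 * pi)" "\<theta> / (2 * pi) < real_of_int k + 1" by (auto simp: k_def)
  then have "\<theta> + 2 * pi * real_of_int (- k) \<in> {0..2 * pi}" by (auto simp: field_simps)
  then have "\<gamma> (\<theta> + 2 * pi * real_of_int (- k)) = 0" by (rule zero)
  then show ?thesis using periodic_int_shift[of \<gamma> \<theta> "-k"] per by simp
qed

text \<open>Real and imaginary part are combinations of \<gamma> and its conjugate, and conjugation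
  merely reverses the order of the coefficients.\<close>

theorem fourier_null_eq_0:
  fixes \<gamma> :: "real \<Rightarrow> complex"
  assumes cont: "continuous_on UNIV \<gamma>" and per: "\<And>\<theta>. \<gamma> (\<theta> + 2 * pi) = \<gamma> \<theta>"
    and null: "\<And>k::int. integral {0..2 * pi} (\<lambda>\<theta>. \<gamma> \<theta> * cis (real_of_int k * \<theta>)) = 0"
  shows "\<gamma> \<theta> = 0"
proof -
  have c: "continuous_on {0..2 * pi} \<gamma>" using cont by (rule continuous_on_subset) auto
  have null': "integral {0..2 * pi} (\<lambda>\<theta>. cnj (\<gamma> \<theta>) * cis (real_of_int k * \<theta>)) = 0" for k
  proof -
    have "integral {0..2 * pi} (\<lambda>\<theta>. cnj (\<gamma> \<theta>) * cis (real_of_int k * \<theta>))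
       = integral {0..2 * pi} (\<lambda>\<theta>. cnj (\<gamma> \<theta> * cis (real_of_int (- k) * \<theta>)))"
      by (simp add: cis_cnj)
    also have "\<dots> = cnj (integral {0..2 * pi} (\<lambda>\<theta>. \<gamma> \<theta> * cis (real_of_int (- k) * \<theta>)))"
      by (rule integral_cnj[symmetric])
    finally show ?thesis using null[of "-k"] by simp
  qed
  have "fourier_null \<gamma>" "fourier_null (\<lambda>\<theta>. cnj (\<gamma> \<theta>))"
    using null null' c by (auto simp: fourier_null_def intro!: continuous_intros)
  note lin = fourier_null_lincomb[OF this]
  have "Re (\<gamma> \<theta>) = 0"
  proof (rule fourier_null_real_eq_0[where \<gamma> = "\<lambda>\<theta>. Re (\<gamma> \<theta>)"])
    have "of_real (Re (\<gamma> \<theta>)) = 1/2 * \<gamma> \<theta> + 1/2 * cnj (\<gamma> \<theta>)" for \<theta> by (simp add: complex_eq_iff)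
    then show "fourier_null (\<lambda>\<theta>. of_real (Re (\<gamma> \<theta>)))"
      using lin[of "1/2" "1/2"] by (simp only:)
  qed (auto intro!: continuous_intros cont simp: per)
  moreover have "Im (\<gamma> \<theta>) = 0"
  proof (rule fourier_null_real_eq_0[where \<gamma> = "\<lambda>\<theta>. Im (\<gamma> \<theta>)"])
    have "of_real (Im (\<gamma> \<theta>)) = - \<i> / 2 * \<gamma> \<theta> + \<i> / 2 * cnj (\<gamma> \<theta>)" for \<theta> by (simp add: complex_eq_iff)
    then show "fourier_null (\<lambda>\<theta>. of_real (Im (\<gamma> \<theta>)))"
      using lin[of "- \<i> / 2" "\<i> / 2"] by (simp only:)
  qed (auto intro!: continuous_intros cont simp: per)
  ultimately show ?thesis by (simp add: complex_eq_iff)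
qed

section \<open>The limit as a sum over dyadic scales\<close>

text \<open>Contribution of two words whose lengths differ by \<open>d\<close>: the cell of the
  shorter word receives \<open>t\<close> balls on average, that of the longer one
  \<open>t / 2^d\<close>.\<close>

definition lag_term :: "nat \<Rightarrow> real \<Rightarrow> real" where
  "lag_term d t = (1 - pois_few (t / 2 ^ d)) / (t / 2 ^ d) * pois_few t - pois_one t * pois_one (t / 2 ^ d)"

text \<open>The sign of \<open>d\<close> tells which of the two words is the longer one, so every
  positive lag occurs twice and lag 0 once.\<close>

definition lag_sum :: "real \<Rightarrow> real" where
  "lag_sum t = (\<Sum>\<^sub>\<infinity>d::int. lag_term (nat \<bar>d\<bar>) t)"

lemma lim_term_eq_lag_term: "lim_term x (a, b) = lag_term (nat \<bar>a - b\<bar>) (scaled x (min a b))"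
proof -
  have "scaled x (max a b) = scaled x (min a b) / 2 ^ nat \<bar>a - b\<bar>"
  proof -
    have "(2::real) powi (max a b) = 2 powi (min a b + \<bar>a - b\<bar>)"
      by (intro arg_cong2[where f = power_int] refl) (auto simp: max_def min_def)
    also have "\<dots> = 2 powi (min a b) * 2 powi \<bar>a - b\<bar>" by (subst power_int_add) auto
    also have "(2::real) powi \<bar>a - b\<bar> = 2 ^ nat \<bar>a - b\<bar>" by (simp add: power_int_def)
    finally show ?thesis by (simp add: scaled_def)
  qed
  moreover have "pois_one (scaled x a) * pois_one (scaled x b) = pois_one (scaled x (min a b)) * pois_one (scaled x (max a b))"
    by (simp add: min_def max_def mult.commute)
  ultimately show ?thesis by (simp add: lim_term_def lag_term_def)
qed

text \<open>Both parts are at most linear in \<open>s = t / 2^d\<close>, which yields the geometric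
  factor; what remains is \<open>t\<close> times
  \<open>(1 + t) exp (- t) + t exp (- t)\<close>.\<close>

lemma lag_term_bound:
  assumes t: "t > 0"
  shows "\<bar>lag_term d t\<bar> \<le> (1/2) ^ d * ((t + 2 * t\<^sup>2) * exp (- t))"
proof -
  define s where "s = t / 2 ^ d"
  have s: "s > 0" using t by (simp add: s_def)
  have f: "0 \<le> (1 - pois_few s) / s" "(1 - pois_few s) / s \<le> s"
    using pois_few_bounds[OF s] s by (auto simp: field_simps power2_eq_square)
  have a: "(1 - pois_few s) / s * pois_few t \<le> s * pois_few t" "0 \<le> (1 - pois_few s) / s * pois_few t"
    by (rule mult_right_mono[OF f(2) pois_few_bounds(1)[OF t]], rule mult_nonneg_nonneg[OF f(1) pois_few_bounds(1)[OF t]])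
  have b: "pois_one t * pois_one s \<le> pois_one t * s" "0 \<le> pois_one t * pois_one s"
    using pois_one_bounds[OF s] pois_one_bounds[OF t] by (auto intro!: mult_left_mono mult_nonneg_nonneg)
  have "s * pois_few t + pois_one t * s = (1/2) ^ d * ((t + 2 * t\<^sup>2) * exp (- t))"
    by (simp add: s_def pois_few_def pois_one_def power2_eq_square power_one_over field_simps)
  moreover have "lag_term d t = (1 - pois_few s) / s * pois_few t - pois_one t * pois_one s"
    by (simp add: lag_term_def s_def)
  ultimately show ?thesis using a b by linarith
qed

lemma weight_le_3: "(t::real) > 0 \<Longrightarrow> (t + 2 * t\<^sup>2) * exp (- t) \<le> 3"
proof -
  assume t: "t > 0"
  have "t * exp (- t) \<le> 1" using pois_one_bounds(4)[OF t] by (simp add: pois_one_def)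
  moreover have "t\<^sup>2 * exp (- t) \<le> 1" using square_le_exp[of t] t by (simp add: exp_minus field_simps)
  ultimately show ?thesis by (simp add: algebra_simps)
qed

lemma summable_on_half_powers: "(\<lambda>d::int. c * (1/2::real) ^ nat \<bar>d\<bar>) summable_on UNIV"
  by (intro summable_on_cmult_right summable_on_int_geometric) auto

lemma lag_term_summable:
  assumes t: "t > 0"
  shows "(\<lambda>d::int. norm (lag_term (nat \<bar>d\<bar>) t)) summable_on UNIV"
  by (rule Infinite_Sum.abs_summable_on_comparison_test'[OF summable_on_half_powers[of "(t + 2 * t\<^sup>2) * exp (- t)"]])
     (use lag_term_bound[OF t] in \<open>auto simp: mult.commute\<close>)

lemma infsum_half_powers: "(\<Sum>\<^sub>\<infinity>d::int. (1/2::real) ^ nat \<bar>d\<bar>) = 3"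
  using infsumI[OF has_sum_int_geometric[of "1/2"]] by simp

lemma lag_sum_bound:
  assumes t: "t > 0"
  shows "\<bar>lag_sum t\<bar> \<le> 3 * ((t + 2 * t\<^sup>2) * exp (- t))"
proof -
  have "norm (lag_sum t) \<le> (\<Sum>\<^sub>\<infinity>d::int. ((t + 2 * t\<^sup>2) * exp (- t)) * (1/2::real) ^ nat \<bar>d\<bar>)"
    unfolding lag_sum_def
    by (rule norm_infsum_le[OF has_sum_infsum[OF abs_summable_summable[OF lag_term_summable[OF t]]]
          has_sum_infsum[OF summable_on_half_powers]])
       (use lag_term_bound[OF t] in \<open>auto simp: mult.commute\<close>)
  also have "\<dots> = ((t + 2 * t\<^sup>2) * exp (- t)) * 3"
    by (simp only: infsum_cmult_right' infsum_half_powers)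
  finally show ?thesis by simp
qed

lemma continuous_on_lag_term: "continuous_on {0<..} (lag_term d)"
  unfolding lag_term_def[abs_def] pois_few_def pois_one_def by (intro continuous_intros) auto

lemma continuous_on_lag_sum: "continuous_on {0<..} lag_sum"
proof -
  have "uniform_limit {0<..} (\<lambda>D t. \<Sum>d\<in>D. lag_term (nat \<bar>d\<bar>) t) (\<lambda>t. \<Sum>\<^sub>\<infinity>d::int. lag_term (nat \<bar>d\<bar>) t)
      (finite_subsets_at_top UNIV)"
  proof (rule Weierstrass_m_test_general[OF _ summable_on_half_powers[of 3]])
    fix d :: int and t :: real assume "t \<in> {0<..}"
    then have t: "t > 0" by simp
    have "\<bar>lag_term (nat \<bar>d\<bar>) t\<bar> \<le> (1/2) ^ nat \<bar>d\<bar> * ((t + 2 * t\<^sup>2) * exp (- t))" by (rule lag_term_bound[OF t])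
    also have "\<dots> \<le> (1/2) ^ nat \<bar>d\<bar> * 3" by (intro mult_left_mono weight_le_3 t) auto
    finally show "norm (lag_term (nat \<bar>d\<bar>) t) \<le> 3 * (1/2) ^ nat \<bar>d\<bar>" by simp
  qed
  then show ?thesis
    unfolding lag_sum_def[abs_def]
    by (rule uniform_limit_theorem[rotated]) (auto intro!: always_eventually continuous_on_sum continuous_on_lag_term)
qed

lemma var_limit_eq:
  assumes x: "1 \<le> x" "x \<le> 2"
  shows "var_limit x = (\<Sum>\<^sub>\<infinity>a. lag_sum (scaled x a))"
proof -
  let ?f = "\<lambda>(m, d). lag_term (nat \<bar>d\<bar>) (scaled x m)"
  let ?i = "\<lambda>(m, d). if d \<ge> 0 then (m, m + d) else (m - d, m)"
  let ?j = "\<lambda>(a, b). (min a b, b - a) :: int \<times> int"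
  have sum: "lim_term x summable_on UNIV" by (rule lim_term_summable[OF x])
  have eq: "?f (?j z) = lim_term x z" for z
    by (cases z) (simp add: lim_term_eq_lag_term abs_minus_commute)
  have "?f summable_on UNIV"
    using sum by (subst (asm) summable_on_reindex_bij_witness[where i = ?i and j = ?j and T = UNIV and h = ?f])
                 (simp_all only: eq, auto simp: min_def)
  then have s2: "?f summable_on Sigma UNIV (\<lambda>_. UNIV)" by simp
  have "var_limit x = infsum ?f UNIV"
    unfolding var_limit_def
    by (rule infsum_reindex_bij_witness[where i = ?i and j = ?j]) (simp_all only: eq, auto simp: min_def)
  also have "\<dots> = (\<Sum>\<^sub>\<infinity>m. \<Sum>\<^sub>\<infinity>d. ?f (m, d))"
    using infsum_Sigma_banach[OF s2] by simp
  finally show ?thesis by (simp add: lag_sum_def)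
qed

section \<open>Power series in the scale of the longer word\<close>

lemma Suc_div_fact: "real (Suc n) / fact (Suc n) = 1 / fact n"
  by (subst fact_Suc) (simp del: of_nat_Suc fact_Suc)

lemma exp_minus_sums: "(\<lambda>n. (-1) ^ n * s ^ n / fact n) sums exp (- s :: real)"
  using exp_converges[of "- s"] by (simp add: power_minus[of s] field_simps)

lemma summable_power_over_fact: "summable (\<lambda>n. c * (s::real) ^ n / fact n)"
  using summable_mult[OF summable_exp[of s], of c] by (simp add: field_simps)

lemma exp_minus_deriv_sums: "(\<lambda>n. (-1) ^ n * real n * s ^ n / fact n) sums (- pois_one s)"
proof -
  have "(\<lambda>n. (-1) ^ Suc n * real (Suc n) * s ^ Suc n / fact (Suc n)) sums (- s * exp (- s))"
  proof -
    have "(\<lambda>n. - s * ((-1) ^ n * s ^ n / fact n)) sums (- s * exp (- s))"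
      by (intro sums_mult exp_minus_sums)
    moreover have "(\<lambda>n. - s * ((-1) ^ n * s ^ n / fact n)) = (\<lambda>n. (-1) ^ Suc n * real (Suc n) * s ^ Suc n / fact (Suc n))"
    proof
      fix n
      have "(-1) ^ Suc n * s ^ Suc n * (real (Suc n) / fact (Suc n)) = (-1) ^ Suc n * s ^ Suc n * (1 / fact n)"
        by (rule arg_cong[OF Suc_div_fact])
      then show "- s * ((-1) ^ n * s ^ n / fact n) = (-1) ^ Suc n * real (Suc n) * s ^ Suc n / fact (Suc n)"
        by (simp add: mult_ac del: of_nat_Suc fact_Suc)
    qed
    ultimately show ?thesis by (simp only:)
  qed
  then show ?thesis by (subst (asm) sums_Suc_iff) (simp add: pois_one_def)
qed

lemma pois_many_sums:
  assumes s: "s > 0"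
  shows "(\<lambda>j. (-1) ^ Suc j * real j * s ^ j / fact (Suc j)) sums ((1 - pois_few s) / s)"
proof -
  have "(\<lambda>n. (-1) ^ n * real n * s ^ n / fact n - (-1) ^ n * s ^ n / fact n) sums (- pois_one s - exp (- s))"
    by (intro sums_diff exp_minus_deriv_sums exp_minus_sums)
  also have "- pois_one s - exp (- s) = - pois_few s"
    by (simp add: pois_one_def pois_few_def algebra_simps)
  finally have "(\<lambda>n. (-1) ^ n * real n * s ^ n / fact n - (-1) ^ n * s ^ n / fact n) sums (- pois_few s)" .
  then have "(\<lambda>n. (-1) ^ Suc n * real (Suc n) * s ^ Suc n / fact (Suc n) - (-1) ^ Suc n * s ^ Suc n / fact (Suc n))
      sums (1 - pois_few s)"
    by (subst sums_Suc_iff) simp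
  then have "(\<lambda>n. ((-1) ^ Suc n * real (Suc n) * s ^ Suc n / fact (Suc n) - (-1) ^ Suc n * s ^ Suc n / fact (Suc n)) / s)
      sums ((1 - pois_few s) / s)" by (rule sums_divide)
  moreover have "((-1) ^ Suc n * real (Suc n) * s ^ Suc n / fact (Suc n) - (-1) ^ Suc n * s ^ Suc n / fact (Suc n)) / s
      = (-1) ^ Suc n * real n * s ^ n / fact (Suc n)" for n
    using s by (simp add: field_simps del: fact_Suc)
  ultimately show ?thesis by (simp only:)
qed

lemma pois_one_sums: "(\<lambda>j. (-1) ^ Suc j * real j * real (Suc j) * s ^ j / fact (Suc j)) sums pois_one s"
proof -
  have "(\<lambda>n. - ((-1) ^ n * real n * s ^ n / fact n)) sums (- (- pois_one s))"
    by (intro sums_minus exp_minus_deriv_sums)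
  moreover have "- ((-1) ^ n * real n * s ^ n / fact n) = (-1) ^ Suc n * real n * real (Suc n) * s ^ n / fact (Suc n)" for n
  proof -
    have "(-1) ^ Suc n * real n * s ^ n * (real (Suc n) / fact (Suc n)) = (-1) ^ Suc n * real n * s ^ n * (1 / fact n)"
      by (rule arg_cong[OF Suc_div_fact])
    then show ?thesis by (simp add: mult_ac del: of_nat_Suc fact_Suc)
  qed
  ultimately show ?thesis by (simp only: minus_minus)
qed

text \<open>The coefficient of \<open>2^(- d j)\<close> in \<open>lag_term d t\<close>. Only the
  argument \<open>t / 2^d\<close> is expanded, while the exponential in \<open>t\<close> is kept for
  the Gamma integrals. The factor \<open>j t - 1\<close> is \<open>(j + 1) t - (1 + t)\<close>, from
  the series of \<open>pois_one\<close> and of the nested part.\<close>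

definition lag_coeff :: "nat \<Rightarrow> real \<Rightarrow> real" where
  "lag_coeff j t = (-1) ^ j * real j * (real j * t - 1) * t ^ j * exp (- t) / fact (Suc j)"

lemma lag_term_sums:
  assumes t: "t > 0"
  shows "(\<lambda>j. lag_coeff j t * (1/2) ^ (d * j)) sums lag_term d t"
proof -
  define s where "s = t / 2 ^ d"
  have s: "s > 0" using t by (simp add: s_def)
  have "(\<lambda>j. (-1) ^ Suc j * real j * s ^ j / fact (Suc j) * pois_few t
      - pois_one t * ((-1) ^ Suc j * real j * real (Suc j) * s ^ j / fact (Suc j))) sums lag_term d t"
    unfolding lag_term_def s_def[symmetric]
    by (intro sums_diff sums_mult sums_mult2 pois_many_sums[OF s] pois_one_sums)
  moreover have "(-1) ^ Suc j * real j * s ^ j / fact (Suc j) * pois_few t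
      - pois_one t * ((-1) ^ Suc j * real j * real (Suc j) * s ^ j / fact (Suc j))
     = lag_coeff j t * (1/2) ^ (d * j)" for j
  proof -
    define h F :: real where "h = (1/2) ^ (d * j)" and "F = fact (Suc j)"
    have F: "F \<noteq> 0" by (simp add: F_def)
    have "s ^ j = t ^ j * h" by (simp add: s_def h_def power_divide power_mult power_one_over)
    then show ?thesis
      using F unfolding lag_coeff_def pois_few_def pois_one_def h_def[symmetric] F_def[symmetric]
      by (simp add: field_simps)
  qed
  ultimately show ?thesis by (simp only:)
qed

lemma lag_coeff_abs_le:
  assumes t: "t > 0"
  shows "\<bar>lag_coeff j t\<bar> \<le> real j * (real j * t + 1) * t ^ j * exp (- t) / fact (Suc j)"
proof -
  have "\<bar>lag_coeff j t\<bar> = real j * \<bar>real j * t - 1\<bar> * t ^ j * exp (- t) / fact (Suc j)"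
    using t by (simp add: lag_coeff_def abs_mult power_abs)
  also have "\<dots> \<le> real j * (real j * t + 1) * t ^ j * exp (- t) / fact (Suc j)"
  proof -
    have "0 \<le> real j * t" using t by simp
    then have "\<bar>real j * t - 1\<bar> \<le> real j * t + 1" by linarith
    then show ?thesis using t by (intro divide_right_mono mult_right_mono mult_left_mono) auto
  qed
  finally show ?thesis .
qed

lemma summable_lag_coeff:
  assumes t: "t > 0"
  shows "summable (\<lambda>j. \<bar>lag_coeff j t\<bar>)"
proof (rule summable_comparison_test)
  show "\<exists>N. \<forall>j\<ge>N. norm \<bar>lag_coeff j t\<bar> \<le> (t + 1) * (2 * t) ^ j / fact j"
  proof (intro exI allI impI)
    fix j :: nat
    have jj: "real j * (real j * t + 1) \<le> real (Suc j) * ((t + 1) * 2 ^ j)"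
    proof (rule mult_mono)
      have "real j < 2 ^ j" by (rule of_nat_less_two_power)
      then have a: "real j \<le> 2 ^ j" "1 \<le> (2::real) ^ j" by auto
      have "real j * t + 1 \<le> 2 ^ j * t + 2 ^ j" using a t by (intro add_mono mult_right_mono) auto
      then show "real j * t + 1 \<le> (t + 1) * 2 ^ j" by (simp add: algebra_simps)
    qed (use t in auto)
    have "norm \<bar>lag_coeff j t\<bar> \<le> real j * (real j * t + 1) * t ^ j * exp (- t) / fact (Suc j)"
      using lag_coeff_abs_le[OF t] by simp
    also have "\<dots> \<le> real (Suc j) * ((t + 1) * 2 ^ j) * t ^ j * 1 / fact (Suc j)"
      using t by (intro divide_right_mono mult_mono[OF mult_right_mono[OF jj]]) auto
    also have "\<dots> = ((t + 1) * 2 ^ j * t ^ j) * (real (Suc j) / fact (Suc j))"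
      by (simp del: of_nat_Suc fact_Suc)
    also have "\<dots> = (t + 1) * (2 * t) ^ j / fact j"
      unfolding Suc_div_fact by (simp add: power_mult_distrib)
    finally show "norm \<bar>lag_coeff j t\<bar> \<le> (t + 1) * (2 * t) ^ j / fact j" .
  qed
  show "summable (\<lambda>j. (t + 1) * (2 * t) ^ j / fact j)" by (rule summable_power_over_fact)
qed

lemma geometric_has_sum_multiple:
  assumes "j > 0"
  shows "((\<lambda>d. (1/2::real) ^ (Suc d * j)) has_sum 1 / (2 ^ j - 1)) UNIV"
proof -
  have g: "(2::real) ^ j > 1" using assms by simp
  have "(\<lambda>d. ((1/2::real) ^ j) ^ d) sums (1 / (1 - (1/2) ^ j))"
    using assms by (intro geometric_sums) (simp add: power_one_over field_simps)
  then have "(\<lambda>d. (1/2::real) ^ j * ((1/2::real) ^ j) ^ d) sums ((1/2) ^ j * (1 / (1 - (1/2) ^ j)))" by (rule sums_mult)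
  moreover have "(1/2::real) ^ j * (1 / (1 - (1/2) ^ j)) = 1 / (2 ^ j - 1)"
    using g by (simp add: power_one_over field_simps)
  moreover have "(1/2::real) ^ j * ((1/2::real) ^ j) ^ d = (1/2) ^ (Suc d * j)" for d
    by (simp add: power_add power_mult[symmetric] mult.commute)
  ultimately show ?thesis by (intro sums_nonneg_imp_has_sum) auto
qed

text \<open>Summation of \<open>2^(- d j)\<close> over \<open>d >= 1\<close> gives
  \<open>1 / (2^j - 1)\<close>, and the factor 2 counts the two signs of the lag. The series starts
  at \<open>Suc j\<close> because the coefficient with index 0 vanishes. Absolute convergence of the
  double series permits the exchange.\<close>

lemma lag_sum_eq:
  assumes t: "t > 0"
  shows "summable (\<lambda>j. \<bar>lag_coeff (Suc j) t / (2 ^ Suc j - 1)\<bar>)"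
    and "lag_sum t = lag_term 0 t + 2 * (\<Sum>j. lag_coeff (Suc j) t / (2 ^ Suc j - 1))"
proof -
  let ?e = "\<lambda>j. lag_coeff (Suc j) t"
  have se: "summable (\<lambda>j. \<bar>?e j\<bar>)" using summable_lag_coeff[OF t] by (subst summable_Suc_iff)
  show s1: "summable (\<lambda>j. \<bar>?e j / (2 ^ Suc j - 1)\<bar>)"
  proof (rule summable_comparison_test'[OF se])
    fix j
    define D :: real where "D = 2 ^ Suc j - 1"
    have "(2::real) ^ 1 \<le> 2 ^ Suc j" by (intro power_increasing) auto
    then have D: "D \<ge> 1" by (simp add: D_def)
    have "\<bar>?e j\<bar> / D \<le> \<bar>?e j\<bar> / 1" using D by (intro divide_left_mono) auto
    then show "norm \<bar>?e j / (2 ^ Suc j - 1)\<bar> \<le> \<bar>?e j\<bar>"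
      using D unfolding D_def[symmetric] by simp
  qed
  define f where "f d j = ?e j * (1/2) ^ (Suc d * Suc j)" for d j
  have "(\<lambda>(d, j). norm (f d j)) summable_on UNIV \<times> UNIV"
  proof -
    have "(\<lambda>d::nat. (1/2::real) ^ d) summable_on UNIV" "(\<lambda>j. \<bar>?e j\<bar>) summable_on UNIV"
      using se by (subst summable_on_UNIV_nonneg_real_iff; auto intro: summable_geometric)+
    then have "(\<lambda>(d::nat, j). (1/2) ^ d * \<bar>?e j\<bar>) summable_on UNIV \<times> UNIV"
      by (rule summable_on_product_real) auto
    then show ?thesis
    proof (rule summable_on_comparison_test)
      fix z :: "nat \<times> nat"
      obtain d j where z: "z = (d, j)" by (cases z)
      have "(1/2::real) ^ (Suc d * Suc j) \<le> (1/2) ^ d" by (intro power_decreasing) auto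
      then have "\<bar>?e j\<bar> * (1/2) ^ (Suc d * Suc j) \<le> \<bar>?e j\<bar> * (1/2) ^ d" by (intro mult_left_mono) auto
      then show "(case z of (d, j) \<Rightarrow> norm (f d j)) \<le> (case z of (d, j) \<Rightarrow> (1/2) ^ d * \<bar>?e j\<bar>)"
        by (simp add: z f_def abs_mult mult.commute)
    qed auto
  qed
  then have "(\<lambda>z. norm (case z of (d, j) \<Rightarrow> f d j)) summable_on UNIV \<times> UNIV"
    by (simp only: case_prod_unfold)
  then have fs: "(\<lambda>(d, j). f d j) summable_on UNIV \<times> UNIV"
    by (rule abs_summable_summable)
  have inner1: "(\<Sum>\<^sub>\<infinity>j. f d j) = lag_term (Suc d) t" for d
  proof (rule infsumI, rule norm_summable_imp_has_sum)
    have "(\<lambda>j. lag_coeff j t * (1/2) ^ (Suc d * j)) sums lag_term (Suc d) t" by (rule lag_term_sums[OF t])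
    then show "f d sums lag_term (Suc d) t"
      unfolding f_def by (subst sums_Suc_iff) (simp add: lag_coeff_def)
    show "summable (\<lambda>j. norm (f d j))"
    proof (rule summable_comparison_test'[OF se])
      fix j
      have "\<bar>?e j\<bar> * (1/2) ^ (Suc d * Suc j) \<le> \<bar>?e j\<bar> * 1" by (intro mult_left_mono power_le_one) auto
      then show "norm (norm (f d j)) \<le> \<bar>?e j\<bar>" by (simp add: f_def abs_mult)
    qed
  qed
  have inner2: "(\<Sum>\<^sub>\<infinity>d. f d j) = ?e j / (2 ^ Suc j - 1)" for j
    unfolding f_def using has_sum_cmult_right[OF geometric_has_sum_multiple[of "Suc j"], of "?e j"]
    by (intro infsumI) simp
  have S: "(\<Sum>\<^sub>\<infinity>d. lag_term (Suc d) t) = (\<Sum>j. ?e j / (2 ^ Suc j - 1))"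
  proof -
    have "(\<Sum>\<^sub>\<infinity>d. lag_term (Suc d) t) = (\<Sum>\<^sub>\<infinity>d. \<Sum>\<^sub>\<infinity>j. f d j)" by (simp add: inner1)
    also have "\<dots> = (\<Sum>\<^sub>\<infinity>j. \<Sum>\<^sub>\<infinity>d. f d j)" by (rule infsum_swap_banach[OF fs])
    also have "\<dots> = (\<Sum>\<^sub>\<infinity>j. ?e j / (2 ^ Suc j - 1))" by (simp only: inner2)
    also have "\<dots> = (\<Sum>j. ?e j / (2 ^ Suc j - 1))"
      using s1 by (intro infsumI norm_summable_imp_has_sum summable_sums) (auto intro: summable_rabs_cancel)
    finally show ?thesis .
  qed
  have sumd: "(\<lambda>d. lag_term (Suc d) t) summable_on UNIV"
    using summable_on_Sigma_banach[OF fs] by (simp add: inner1)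
  have "((\<lambda>d::int. lag_term (nat \<bar>d\<bar>) t) has_sum (lag_term (nat \<bar>0\<bar>) t + ((\<Sum>\<^sub>\<infinity>d. lag_term (Suc d) t) + (\<Sum>\<^sub>\<infinity>d. lag_term (Suc d) t)))) UNIV"
    by (rule has_sum_int_split; unfold nat_abs_minus_Suc nat_abs_Suc; rule has_sum_infsum[OF sumd])
  then show "lag_sum t = lag_term 0 t + 2 * (\<Sum>j. ?e j / (2 ^ Suc j - 1))"
    unfolding lag_sum_def S by (simp add: infsumI)
qed

section \<open>Mellin transforms\<close>

text \<open>A complex power of a positive real, written with the real logarithm so that its
  multiplicativity on positive bases involves no branches.\<close>

definition cpow :: "real \<Rightarrow> complex \<Rightarrow> complex" where
  "cpow t c = exp (c * of_real (ln t))"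

lemma powr_eq_cpow: "t > 0 \<Longrightarrow> of_real t powr c = cpow t c"
  by (simp add: powr_def cpow_def Ln_of_real)

lemma cpow_add: "cpow t (a + b) = cpow t a * cpow t b"
  by (simp add: cpow_def distrib_right exp_add)

lemma cpow_of_nat: "t > 0 \<Longrightarrow> cpow t (of_nat n) = of_real (t ^ n)"
  by (simp add: cpow_def exp_of_nat_mult exp_of_real)

lemma cpow_mult: "s > 0 \<Longrightarrow> t > 0 \<Longrightarrow> cpow (s * t) c = cpow s c * cpow t c"
  by (simp add: cpow_def ln_mult distrib_left exp_add)

lemma Re_trie_chi [simp]: "Re (trie_chi k) = 0"
  by (simp add: trie_chi_def)

lemma norm_cpow_chi [simp]: "norm (cpow t (trie_chi k)) = 1"
  by (simp add: cpow_def)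

text \<open>This is the role of the points \<open>trie_chi k\<close>: powers with these exponents
  are invariant under doubling, like the limit function.\<close>

lemma cpow_2_chi: "cpow 2 (trie_chi k) = 1"
proof -
  have "trie_chi k * of_real (ln 2) = of_real (real_of_int (2 * k) * pi) * \<i>"
    by (simp add: trie_chi_def field_simps)
  then have "exp (trie_chi k * of_real (ln 2)) = exp (0 + of_real (real_of_int (2 * k) * pi) * \<i>)" by simp
  also have "\<dots> = exp 0" unfolding exp_eq by blast
  finally show ?thesis by (simp add: cpow_def)
qed

definition mellin_kernel :: "int \<Rightarrow> real \<Rightarrow> complex" where
  "mellin_kernel k t = cpow t (trie_chi k) / of_real t"

lemma norm_mellin_kernel: "t > 0 \<Longrightarrow> norm (mellin_kernel k t) = 1 / t"
  by (simp add: mellin_kernel_def norm_divide)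

lemma continuous_on_mellin_kernel: "continuous_on {0<..} (mellin_kernel k)"
  unfolding mellin_kernel_def[abs_def] cpow_def by (intro continuous_intros) auto

text \<open>Absolute integrability refers to the completed measure; continuity supplies the Borel
  measurability needed to return to \<open>lborel\<close>.\<close>

lemma set_integrable_lborelI:
  fixes f :: "real \<Rightarrow> complex"
  assumes "f absolutely_integrable_on {0<..}" "continuous_on {0<..} f"
  shows "set_integrable lborel {0<..} f"
proof -
  have "(\<lambda>x. indicat_real {0<..} x *\<^sub>R f x) \<in> borel_measurable borel"
    by (rule borel_measurable_continuous_on_indicator) (use assms in auto)
  then show ?thesis
    using assms(1) unfolding set_integrable_def by (subst (asm) integrable_completion) auto
qed

lemma mellin_power_exp:
  assumes j: "j \<ge> 1"
  shows "set_integrable lborel {0<..} (\<lambda>t. of_real (t ^ j * exp (- t)) * mellin_kernel k t)"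
    and "(LINT t:{0<..}|lborel. of_real (t ^ j * exp (- t)) * mellin_kernel k t) = Gamma (of_nat j + trie_chi k)"
proof -
  let ?z = "of_nat j + trie_chi k"
  have z: "Re ?z > 0" using j by simp
  have eq: "of_real t powr (?z - 1) / of_real (exp t) = of_real (t ^ j * exp (- t)) * mellin_kernel k t" if "t \<in> {0<..}" for t
  proof -
    have "of_real t powr ?z = of_real t powr (?z - 1) * of_real t"
      using that powr_add[of "of_real t" "?z - 1" 1] by simp
    then have "of_real t powr (?z - 1) = of_real t powr ?z / of_real t" using that by simp
    also have "\<dots> = of_real (t ^ j) * mellin_kernel k t"
      using that by (simp add: powr_eq_cpow cpow_add cpow_of_nat mellin_kernel_def)
    finally show ?thesis by (simp add: exp_minus divide_inverse)
  qed
  have cont: "continuous_on {0<..} (\<lambda>t. of_real (t ^ j * exp (- t)) * mellin_kernel k t)"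
    by (intro continuous_intros continuous_on_mellin_kernel)
  have "(\<lambda>t. of_real (t ^ j * exp (- t)) * mellin_kernel k t) absolutely_integrable_on {0<..}"
    using absolutely_integrable_Gamma_integral'[OF z]
    by (rule absolutely_integrable_spike[OF _ negligible_empty]) (use eq in auto)
  then show si: "set_integrable lborel {0<..} (\<lambda>t. of_real (t ^ j * exp (- t)) * mellin_kernel k t)"
    by (rule set_integrable_lborelI[OF _ cont])
  have "((\<lambda>t. of_real (t ^ j * exp (- t)) * mellin_kernel k t) has_integral Gamma ?z) {0<..}"
    by (rule has_integral_eq[OF _ Gamma_integral_complex'[OF z]]) (use eq in auto)
  then show "(LINT t:{0<..}|lborel. of_real (t ^ j * exp (- t)) * mellin_kernel k t) = Gamma ?z"
    using set_borel_integral_eq_integral(2)[OF si] by (simp add: integral_unique)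
qed

text \<open>Replacing \<open>t\<close> by \<open>2 * t\<close> costs the factor \<open>2^j\<close>
  only, since the power in the kernel does not notice doubling.\<close>

lemma mellin_power_exp2:
  assumes j: "j \<ge> 1"
  shows "set_integrable lborel {0<..} (\<lambda>t. of_real (t ^ j * exp (- 2 * t)) * mellin_kernel k t)"
    and "(LINT t:{0<..}|lborel. of_real (t ^ j * exp (- 2 * t)) * mellin_kernel k t) = Gamma (of_nat j + trie_chi k) / 2 ^ j"
proof -
  let ?g = "\<lambda>t. indicat_real {0<..} t *\<^sub>R (of_real (t ^ j * exp (- t)) * mellin_kernel k t)"
  let ?h = "\<lambda>t. indicat_real {0<..} t *\<^sub>R (of_real (t ^ j * exp (- 2 * t)) * mellin_kernel k t)"
  have gh: "?g (0 + 2 * t) = (2 ^ j / 2) * ?h t" for t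
    by (cases "t > 0")
       (auto simp: mellin_kernel_def cpow_mult cpow_2_chi power_mult_distrib field_simps)
  have g: "integrable lborel ?g" using mellin_power_exp(1)[OF j] by (simp add: set_integrable_def)
  then have "integrable lborel (\<lambda>t. ?g (0 + 2 * t))" by (rule lborel_integrable_real_affine) auto
  then have "integrable lborel (\<lambda>t. (2 / 2 ^ j) * ((2 ^ j / 2) * ?h t))" unfolding gh by (rule integrable_mult_right)
  also have "(\<lambda>t. (2 / 2 ^ j) * ((2 ^ j / 2) * ?h t)) = ?h" by (auto simp: fun_eq_iff)
  finally have "integrable lborel ?h" .
  then show "set_integrable lborel {0<..} (\<lambda>t. of_real (t ^ j * exp (- 2 * t)) * mellin_kernel k t)"
    by (simp add: set_integrable_def)
  have "Gamma (of_nat j + trie_chi k) = integral\<^sup>L lborel ?g"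
    using mellin_power_exp(2)[OF j] by (simp add: set_lebesgue_integral_def)
  also have "\<dots> = \<bar>2\<bar> *\<^sub>R (LINT t|lborel. ?g (0 + 2 * t))" by (rule lborel_integral_real_affine) auto
  also have "\<dots> = 2 ^ j * integral\<^sup>L lborel ?h" unfolding gh by (subst integral_mult_right_zero) (simp add: scaleR_conv_of_real)
  finally show "(LINT t:{0<..}|lborel. of_real (t ^ j * exp (- 2 * t)) * mellin_kernel k t) = Gamma (of_nat j + trie_chi k) / 2 ^ j"
    by (simp add: set_lebesgue_integral_def field_simps)
qed

text \<open>The weight is that of \<open>lag_term_bound\<close>; times the kernel it is a
  combination of the Gamma integrands with \<open>j = 1\<close> and \<open>j = 2\<close>.\<close>

lemma mellin_dominated_integrable:
  fixes f :: "real \<Rightarrow> real"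
  assumes cont: "continuous_on {0<..} f" and bound: "\<And>t. t > 0 \<Longrightarrow> \<bar>f t\<bar> \<le> C * ((t + 2 * t\<^sup>2) * exp (- t))"
  shows "set_integrable lborel {0<..} (\<lambda>t. of_real (f t) * mellin_kernel k t)"
proof (rule set_integrable_bound)
  have "set_integrable lborel {0<..} (\<lambda>t. of_real C * (of_real (t ^ 1 * exp (- t)) * mellin_kernel k t)
      + of_real (2 * C) * (of_real (t ^ 2 * exp (- t)) * mellin_kernel k t))"
    by (intro set_integral_add set_integrable_mult_right mellin_power_exp) auto
  also have "(\<lambda>t. of_real C * (of_real (t ^ 1 * exp (- t)) * mellin_kernel k t)
      + of_real (2 * C) * (of_real (t ^ 2 * exp (- t)) * mellin_kernel k t))
    = (\<lambda>t. of_real (C * ((t + 2 * t\<^sup>2) * exp (- t))) * mellin_kernel k t)"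
    by (auto simp: fun_eq_iff algebra_simps)
  finally show "set_integrable lborel {0<..} (\<lambda>t. of_real (C * ((t + 2 * t\<^sup>2) * exp (- t))) * mellin_kernel k t)" .
  show "set_borel_measurable lborel {0<..} (\<lambda>t. complex_of_real (f t) * mellin_kernel k t)"
  proof -
    have "(\<lambda>t. indicat_real {0<..} t *\<^sub>R (complex_of_real (f t) * mellin_kernel k t)) \<in> borel_measurable borel"
      by (rule borel_measurable_continuous_on_indicator) (auto intro!: continuous_intros cont continuous_on_mellin_kernel)
    then show ?thesis by (simp add: set_borel_measurable_def)
  qed
  show "AE t\<in>{0<..} in lborel. norm (complex_of_real (f t) * mellin_kernel k t)
      \<le> norm (complex_of_real (C * ((t + 2 * t\<^sup>2) * exp (- t))) * mellin_kernel k t)"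
  proof (intro AE_I2 impI)
    fix t :: real assume "t \<in> {0<..}"
    then have t: "t > 0" by simp
    have "\<bar>f t\<bar> \<le> \<bar>C * ((t + 2 * t\<^sup>2) * exp (- t))\<bar>" using bound[OF t] by linarith
    then show "norm (complex_of_real (f t) * mellin_kernel k t)
      \<le> norm (complex_of_real (C * ((t + 2 * t\<^sup>2) * exp (- t))) * mellin_kernel k t)"
      unfolding norm_mult norm_of_real by (intro mult_right_mono) auto
  qed
qed

lemma mellin_lag_term_0_algebra:
  fixes z K e c :: complex
  assumes "z \<noteq> 0" "c \<noteq> 1"
  shows "(c - 1) * (K / z) / (c - 1) * ((1 + z) * e - (1 + 2 * z) * e\<^sup>2) + K / (c - 1) * (4 * z * e\<^sup>2 - z * e)
    = ((1 - (1 + z) * e) / z * ((1 + z) * e) - (z * e)\<^sup>2) * K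
      - ((z ^ 1 * e * K - 4 * (z ^ 1 * e\<^sup>2 * K)) / (c - 1) - (z ^ 1 * e\<^sup>2 * K + z ^ 2 * e\<^sup>2 * K))"
proof -
  define b where "b = 1 / (c - 1)"
  have 1: "(c - 1) * (K / z) / (c - 1) = K / z" using assms by simp
  have 2: "x / (c - 1) = x * b" for x by (simp add: b_def)
  show ?thesis unfolding 1 unfolding 2 using assms by (simp add: field_simps power2_eq_square)
qed

text \<open>
  With \<open>c = trie_chi k\<close>, the function \<open>t powr (c - 1) / (c - 1)\<close> times \<open>pois_few t - pois_few (2 * t)\<close> vanishes at both ends;
  subtracting its derivative leaves only Gamma integrals.
\<close>

lemma mellin_lag_term_0:
  "(LINT t:{0<..}|lborel. of_real (lag_term 0 t) * mellin_kernel k t)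
     = - (Gamma (1 + trie_chi k) * (1 + trie_chi k)\<^sup>2 / (4 * (trie_chi k - 1)))"
proof -
  define c where "c = trie_chi k"
  have c: "c \<noteq> 1" using Re_trie_chi[of k] by (auto simp: c_def simp del: Re_trie_chi)
  let ?K = "mellin_kernel k"
  \<comment> \<open>The square of \<open>pois_few t\<close> is
    \<open>pois_few (2 * t) + t^2 exp (- 2 t)\<close>. Hence
    \<open>(pois_few t - pois_few (2 * t)) / t\<close> is the only part of
    \<open>lag_term 0 t\<close> that does not give Gamma integrands directly. Its two summands
    cannot be integrated separately near 0, and integrating by parts removes the
    denominator.\<close>
  define G where "G z = z powr (c - 1) / (c - 1) * ((1 + z) * exp (- z) - (1 + 2 * z) * exp (- 2 * z))" for z :: complex
  define r where "r t = (of_real (t ^ 1 * exp (- t)) * ?K t - 4 * (of_real (t ^ 1 * exp (- 2 * t)) * ?K t)) / (c - 1)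
      - (of_real (t ^ 1 * exp (- 2 * t)) * ?K t + of_real (t ^ 2 * exp (- 2 * t)) * ?K t)" for t
  define g where "g t = of_real (lag_term 0 t) * ?K t - r t" for t
  have i0: "set_integrable lborel {0<..} (\<lambda>t. of_real (lag_term 0 t) * ?K t)"
    by (rule mellin_dominated_integrable[of _ 1, OF continuous_on_lag_term]) (use lag_term_bound[of _ 0] in auto)
  have ir: "set_integrable lborel {0<..} r"
    unfolding r_def[abs_def]
    by (intro set_integral_add set_integral_diff set_integrable_divide set_integrable_mult_right mellin_power_exp mellin_power_exp2) auto
  have ig: "set_integrable lborel {0<..} g"
    unfolding g_def[abs_def] by (intro set_integral_diff i0 ir)
  have deriv: "((\<lambda>t. G (of_real t)) has_vector_derivative g t) (at t)" if t: "t > 0" for t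
  proof (rule has_vector_derivative_real_field)
    let ?z = "of_real t :: complex"
    have z: "?z \<notin> \<real>\<^sub>\<le>\<^sub>0" using t by (simp add: complex_nonpos_Reals_iff)
    have p: "?z powr (c - 1) = ?K t"
    proof -
      have "?z powr c = ?z powr (c - 1) * ?z"
        using t powr_add[of ?z "c - 1" 1] by simp
      then show ?thesis using t by (simp add: powr_eq_cpow mellin_kernel_def c_def)
    qed
    have p2: "?z powr (c - 1 - 1) = ?K t / ?z"
    proof -
      have "?z powr (c - 1) = ?z powr (c - 1 - 1) * ?z"
        using t powr_add[of ?z "c - 1 - 1" 1] by simp
      then show ?thesis using t p by simp
    qed
    have dP: "((\<lambda>z. z powr (c - 1) / (c - 1)) has_field_derivative (c - 1) * (?z powr (c - 1 - 1)) / (c - 1)) (at ?z)"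
      by (intro DERIV_cdivide has_field_derivative_powr z)
    have dB: "((\<lambda>z. (1 + z) * exp (- z) - (1 + 2 * z) * exp (- 2 * z)) has_field_derivative
        (4 * ?z * exp (- 2 * ?z) - ?z * exp (- ?z))) (at ?z)"
      by (auto intro!: derivative_eq_intros simp: algebra_simps)
    have "(G has_field_derivative
        ((c - 1) * (?z powr (c - 1 - 1)) / (c - 1) * ((1 + ?z) * exp (- ?z) - (1 + 2 * ?z) * exp (- 2 * ?z))
        + ?z powr (c - 1) / (c - 1) * (4 * ?z * exp (- 2 * ?z) - ?z * exp (- ?z)))) (at ?z)"
      unfolding G_def[abs_def] using DERIV_mult[OF dP dB] by (simp only: mult.commute)
    also have "((c - 1) * (?z powr (c - 1 - 1)) / (c - 1) * ((1 + ?z) * exp (- ?z) - (1 + 2 * ?z) * exp (- 2 * ?z))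
        + ?z powr (c - 1) / (c - 1) * (4 * ?z * exp (- 2 * ?z) - ?z * exp (- ?z))) = g t"
    proof -
      define e where "e = exp (- ?z)"
      have e2: "exp (- 2 * ?z) = e\<^sup>2" by (simp add: e_def power2_eq_square flip: exp_add)
      have er: "of_real (exp (- t)) = e" "of_real (exp (- 2 * t)) = e\<^sup>2" unfolding e2[symmetric] by (simp_all add: e_def flip: exp_of_real)
      have lag: "of_real (lag_term 0 t) = (1 - (1 + ?z) * e) / ?z * ((1 + ?z) * e) - (?z * e)\<^sup>2"
        unfolding lag_term_def pois_few_def pois_one_def by (simp add: er[symmetric] power2_eq_square)
      show ?thesis
        unfolding g_def r_def lag p p2 of_real_mult of_real_power er e2 e_def[symmetric]
        by (rule mellin_lag_term_0_algebra) (use t c in auto)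
    qed
    finally show "(G has_field_derivative g t) (at ?z)" .
  qed
  have contg: "isCont g t" if "t > 0" for t
  proof -
    have "continuous_on {0<..} g"
      unfolding g_def[abs_def] r_def using c
      by (intro continuous_intros continuous_on_lag_term continuous_on_mellin_kernel) auto
    then show ?thesis using that by (simp add: continuous_on_eq_continuous_at)
  qed
  have nG: "norm (G (of_real t)) = \<bar>pois_few t - pois_few (2 * t)\<bar> / (t * norm (c - 1))" if t: "t > 0" for t
  proof -
    have "of_real t powr c = of_real t powr (c - 1) * complex_of_real t"
      using t powr_add[of "of_real t" "c - 1" 1] by simp
    then have p: "of_real t powr (c - 1) = ?K t" using t by (simp add: powr_eq_cpow mellin_kernel_def c_def)
    have "G (of_real t) = ?K t / (c - 1) * of_real (pois_few t - pois_few (2 * t))"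
      unfolding G_def p pois_few_def by (simp flip: exp_of_real)
    then show ?thesis using t by (simp add: norm_mult norm_divide norm_mellin_kernel del: of_real_diff)
  qed
  have n0: "norm (c - 1) > 0" using c by simp
  have lim0: "((\<lambda>t. G (of_real t)) \<longlongrightarrow> 0) (at_right 0)"
  proof (rule Lim_null_comparison)
    show "eventually (\<lambda>t. norm (G (of_real t)) \<le> 5 * t / norm (c - 1)) (at_right 0)"
      using eventually_at_right_less[of "0::real"]
    proof eventually_elim
      case (elim t)
      \<comment> \<open>The deviation of \<open>pois_few\<close> from 1 is at most
        \<open>t^2\<close> at \<open>t\<close> and \<open>4 t^2\<close> at
        \<open>2 t\<close>.\<close>
      have "\<bar>pois_few t - pois_few (2 * t)\<bar> \<le> 5 * t\<^sup>2"
        using pois_few_bounds[of t] pois_few_bounds[of "2 * t"] elim by (auto simp: power_mult_distrib abs_le_iff)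
      then have "\<bar>pois_few t - pois_few (2 * t)\<bar> / (t * norm (c - 1)) \<le> 5 * t\<^sup>2 / (t * norm (c - 1))"
        using elim n0 by (intro divide_right_mono) auto
      then show ?case using elim nG[OF elim] by (simp add: power2_eq_square)
    qed
    have "((\<lambda>t. 5 * t / norm (c - 1)) \<longlongrightarrow> 5 * 0 / norm (c - 1)) (at_right 0)"
      using n0 by (intro tendsto_intros) auto
    then show "((\<lambda>t. 5 * t / norm (c - 1)) \<longlongrightarrow> 0) (at_right 0)" by simp
  qed
  have limi: "((\<lambda>t. G (of_real t)) \<longlongrightarrow> 0) at_top"
  proof (rule Lim_null_comparison)
    show "eventually (\<lambda>t. norm (G (of_real t)) \<le> (1 / norm (c - 1)) * (1 / t)) at_top"
      using eventually_gt_at_top[of "0::real"]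
    proof eventually_elim
      case (elim t)
      have "\<bar>pois_few t - pois_few (2 * t)\<bar> \<le> 1"
        using pois_few_bounds[of t] pois_few_bounds[of "2 * t"] elim by (auto simp: abs_le_iff)
      then have "\<bar>pois_few t - pois_few (2 * t)\<bar> / (t * norm (c - 1)) \<le> 1 / (t * norm (c - 1))"
        using elim n0 by (intro divide_right_mono) auto
      then show ?case using nG[OF elim] by (simp add: mult.commute)
    qed
    show "((\<lambda>t. (1 / norm (c - 1)) * (1 / t)) \<longlongrightarrow> 0) at_top"
      by (intro tendsto_mult_right_zero) real_asymp
  qed
  have ein: "einterval 0 \<infinity> = {0<..}" by (auto simp: einterval_def)
  have "(LBINT t=0..\<infinity>. g t) = 0 - 0"
  proof (rule interval_integral_FTC_integrable[where F = "\<lambda>t. G (of_real t)"])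
    show "set_integrable lborel (einterval 0 \<infinity>) g" unfolding ein by (rule ig)
    show "(((\<lambda>t. G (of_real t)) \<circ> real_of_ereal) \<longlongrightarrow> 0) (at_right 0)"
      using lim0 unfolding zero_ereal_def by (simp add: ereal_tendsto_simps)
    show "(((\<lambda>t. G (of_real t)) \<circ> real_of_ereal) \<longlongrightarrow> 0) (at_left \<infinity>)"
      using limi by (simp add: ereal_tendsto_simps)
  qed (auto simp: deriv contg)
  then have g0: "(LINT t:{0<..}|lborel. g t) = 0"
    by (simp add: interval_lebesgue_integral_def ein)
  have "(LINT t:{0<..}|lborel. of_real (lag_term 0 t) * ?K t) = (LINT t:{0<..}|lborel. g t + r t)"
    by (simp add: g_def)
  also have "\<dots> = (LINT t:{0<..}|lborel. r t)" using g0 by (subst set_integral_add(2)[OF ig ir]) simp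
  also have "\<dots> = (Gamma (of_nat 1 + c) - 4 * (Gamma (of_nat 1 + c) / 2 ^ 1)) / (c - 1)
      - (Gamma (of_nat 1 + c) / 2 ^ 1 + Gamma (of_nat 2 + c) / 2 ^ 2)"
  proof -
    define u1 u2 u3 where "u1 = (\<lambda>t. of_real (t ^ 1 * exp (- t)) * ?K t)"
      and "u2 = (\<lambda>t. of_real (t ^ 1 * exp (- 2 * t)) * ?K t)" and "u3 = (\<lambda>t. of_real (t ^ 2 * exp (- 2 * t)) * ?K t)"
    have i: "set_integrable lborel {0<..} u1" "set_integrable lborel {0<..} u2" "set_integrable lborel {0<..} u3"
      unfolding u1_def u2_def u3_def by (intro mellin_power_exp mellin_power_exp2; simp)+
    have v: "(LINT t:{0<..}|lborel. u1 t) = Gamma (of_nat 1 + c)"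
      "(LINT t:{0<..}|lborel. u2 t) = Gamma (of_nat 1 + c) / 2 ^ 1"
      "(LINT t:{0<..}|lborel. u3 t) = Gamma (of_nat 2 + c) / 2 ^ 2"
      unfolding u1_def u2_def u3_def c_def by (rule mellin_power_exp mellin_power_exp2; simp)+
    have "r = (\<lambda>t. (u1 t - 4 * u2 t) / (c - 1) - (u2 t + u3 t))"
      by (simp only: r_def[abs_def] u1_def u2_def u3_def)
    then show ?thesis
      by (simp add: set_integral_diff set_integral_add i v)
  qed
  also have "Gamma (of_nat 2 + c) = (1 + c) * Gamma (1 + c)"
  proof -
    have "1 + c \<notin> \<int>\<^sub>\<le>\<^sub>0" by (auto elim!: nonpos_Ints_cases simp: complex_eq_iff c_def)
    from Gamma_plus1[OF this] show ?thesis by (simp add: add_ac)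
  qed
  \<comment> \<open>The square in the result is
    \<open>4 + (3 + c) (c - 1) = (1 + c)^2\<close>.\<close>
  finally show ?thesis using c unfolding c_def[symmetric] by (simp add: field_simps power2_eq_square)
qed

section \<open>Termwise Mellin transform of the lag sum\<close>

lemma mellin_lag_coeff_integrable:
  assumes j: "j \<ge> 1"
  shows "set_integrable lborel {0<..} (\<lambda>t. of_real (lag_coeff j t) * mellin_kernel k t)"
    and "(LINT t:{0<..}|lborel. of_real (lag_coeff j t) * mellin_kernel k t) = trie_G_term k j * (2 ^ j - 1)"
    and "set_integrable lborel {0<..} (\<lambda>t. of_real (real j * (real j * t + 1) * t ^ j * exp (- t) / fact (Suc j)) * mellin_kernel k t)"
    and "(LINT t:{0<..}|lborel. of_real (real j * (real j * t + 1) * t ^ j * exp (- t) / fact (Suc j)) * mellin_kernel k t)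
         = of_nat j / fact (Suc j) * (of_nat j * Gamma (of_nat (Suc j) + trie_chi k) + Gamma (of_nat j + trie_chi k))"
proof -
  define A :: complex where "A = (-1) ^ j * of_nat j / fact (Suc j)"
  define u v where "u = (\<lambda>t. of_real (t ^ Suc j * exp (- t)) * mellin_kernel k t)"
    and "v = (\<lambda>t. of_real (t ^ j * exp (- t)) * mellin_kernel k t)"
  have i: "set_integrable lborel {0<..} u" "set_integrable lborel {0<..} v"
    unfolding u_def v_def by (rule mellin_power_exp; use j in simp)+
  have val: "(LINT t:{0<..}|lborel. u t) = Gamma (of_nat (Suc j) + trie_chi k)"
    "(LINT t:{0<..}|lborel. v t) = Gamma (of_nat j + trie_chi k)"
    unfolding u_def v_def by (rule mellin_power_exp; use j in simp)+
  have eq: "(\<lambda>t. of_real (lag_coeff j t) * mellin_kernel k t) = (\<lambda>t. A * (of_nat j * u t - v t))"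
  proof
    fix t
    define a where "a = (-1) ^ j * real j / fact (Suc j)"
    have a: "of_real a = A" by (simp add: a_def A_def)
    have r: "lag_coeff j t = a * (real j * (t ^ Suc j * exp (- t)) - t ^ j * exp (- t))"
      by (simp add: lag_coeff_def a_def algebra_simps diff_divide_distrib del: fact_Suc)
    show "of_real (lag_coeff j t) * mellin_kernel k t = A * (of_nat j * u t - v t)"
      unfolding r a[symmetric] by (simp add: u_def v_def algebra_simps)
  qed
  have eq': "(\<lambda>t. of_real (real j * (real j * t + 1) * t ^ j * exp (- t) / fact (Suc j)) * mellin_kernel k t)
      = (\<lambda>t. of_nat j / fact (Suc j) * (of_nat j * u t + v t))"
  proof
    fix t
    define a where "a = real j / fact (Suc j)"
    have a: "of_real a = of_nat j / (fact (Suc j) :: complex)" by (simp add: a_def)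
    have "real j * (real j * t + 1) * t ^ j * exp (- t) / fact (Suc j) = a * (real j * (t ^ Suc j * exp (- t)) + t ^ j * exp (- t))"
      by (simp add: a_def algebra_simps add_divide_distrib del: fact_Suc)
    then show "of_real (real j * (real j * t + 1) * t ^ j * exp (- t) / fact (Suc j)) * mellin_kernel k t
       = of_nat j / fact (Suc j) * (of_nat j * u t + v t)"
      unfolding a[symmetric] by (simp only:) (simp add: u_def v_def algebra_simps)
  qed
  show "set_integrable lborel {0<..} (\<lambda>t. of_real (lag_coeff j t) * mellin_kernel k t)"
    unfolding eq by (intro set_integrable_mult_right set_integral_diff i)
  show "set_integrable lborel {0<..} (\<lambda>t. of_real (real j * (real j * t + 1) * t ^ j * exp (- t) / fact (Suc j)) * mellin_kernel k t)"
    unfolding eq' by (intro set_integrable_mult_right set_integral_add i)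
  show "(LINT t:{0<..}|lborel. of_real (real j * (real j * t + 1) * t ^ j * exp (- t) / fact (Suc j)) * mellin_kernel k t)
         = of_nat j / fact (Suc j) * (of_nat j * Gamma (of_nat (Suc j) + trie_chi k) + Gamma (of_nat j + trie_chi k))"
    unfolding eq' set_integral_mult_right
    by (subst set_integral_add(2)) (simp_all only: set_integral_mult_right val set_integrable_mult_right i)
  have "(LINT t:{0<..}|lborel. of_real (lag_coeff j t) * mellin_kernel k t)
      = A * (of_nat j * Gamma (of_nat (Suc j) + trie_chi k) - Gamma (of_nat j + trie_chi k))"
    unfolding eq set_integral_mult_right
    by (subst set_integral_diff(2)) (simp_all only: set_integral_mult_right val set_integrable_mult_right i)
  also have "Gamma (of_nat (Suc j) + trie_chi k) = (of_nat j + trie_chi k) * Gamma (of_nat j + trie_chi k)"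
  proof -
    have "of_nat j + trie_chi k \<notin> \<int>\<^sub>\<le>\<^sub>0" using j by (auto elim!: nonpos_Ints_cases simp: complex_eq_iff)
    from Gamma_plus1[OF this] show ?thesis by (simp add: add_ac)
  qed
  also have "A * (of_nat j * ((of_nat j + trie_chi k) * Gamma (of_nat j + trie_chi k)) - Gamma (of_nat j + trie_chi k))
      = trie_G_term k j * (2 ^ j - 1)"
  proof -
    have "(2::complex) ^ j \<noteq> 1"
    proof
      assume "(2::complex) ^ j = 1"
      then have "norm ((2::complex) ^ j) = 1" by simp
      then have "(2::real) ^ j = 1" by (simp add: norm_power)
      moreover have "(2::real) ^ 1 \<le> 2 ^ j" using j by (intro power_increasing) auto
      ultimately show False by simp
    qed
    then have n: "(2::complex) ^ j - 1 \<noteq> 0" by simp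
    define F D :: complex where "F = fact (Suc j)" and "D = 2 ^ j - 1"
    have FD: "F \<noteq> 0" "D \<noteq> 0" unfolding F_def D_def by (rule fact_nonzero, rule n)
    show ?thesis
      unfolding A_def trie_G_term_def Suc_eq_plus1[symmetric] F_def[symmetric] D_def[symmetric]
      using FD by (simp add: field_simps)
  qed
  finally show "(LINT t:{0<..}|lborel. of_real (lag_coeff j t) * mellin_kernel k t) = trie_G_term k j * (2 ^ j - 1)" .
qed

lemma trie_chi_0 [simp]: "trie_chi 0 = 0"
  by (simp add: trie_chi_def)

lemma mellin_kernel_0: "mellin_kernel 0 t = of_real (1 / t)"
  by (simp add: mellin_kernel_def cpow_def)

text \<open>The absolute value of the kernel is the kernel for \<open>k = 0\<close>. Replacing
  \<open>j t - 1\<close> by \<open>j t + 1\<close> in the coefficient thus bounds the absolute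
  integral by the explicit value \<open>(j^2 + 1) / (j + 1)\<close>. This growth is harmless after
  division by \<open>2^j - 1\<close>.\<close>

lemma mellin_lag_coeff_norm:
  assumes j: "j \<ge> 1"
  shows "(LINT t|lborel. norm (indicat_real {0<..} t *\<^sub>R (of_real (lag_coeff j t) * mellin_kernel k t))) \<le> real j + 1"
proof -
  define g where "g t = real j * (real j * t + 1) * t ^ j * exp (- t) / fact (Suc j) * (1 / t)" for t
  have gc: "(\<lambda>t. indicat_real {0<..} t *\<^sub>R (of_real (real j * (real j * t + 1) * t ^ j * exp (- t) / fact (Suc j)) * mellin_kernel 0 t))
     = (\<lambda>t. complex_of_real (indicat_real {0<..} t * g t))"
    by (simp only: g_def mellin_kernel_0 scaleR_conv_of_real of_real_mult mult.assoc)
  have ig: "integrable lborel (\<lambda>t. complex_of_real (indicat_real {0<..} t * g t))"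
    using mellin_lag_coeff_integrable(3)[OF j, of 0] unfolding set_integrable_def gc .
  then have ig': "integrable lborel (\<lambda>t. indicat_real {0<..} t * g t)" by (simp only: complex_of_real_integrable_eq)
  have "complex_of_real (LINT t|lborel. indicat_real {0<..} t * g t)
     = (LINT t|lborel. complex_of_real (indicat_real {0<..} t * g t))" by (rule integral_complex_of_real[symmetric])
  also have "\<dots> = of_nat j / fact (Suc j) * (of_nat j * Gamma (of_nat (Suc j) + trie_chi 0) + Gamma (of_nat j + trie_chi 0))"
    using mellin_lag_coeff_integrable(4)[OF j, of 0] unfolding set_lebesgue_integral_def gc .
  also have "\<dots> = of_nat j / fact (Suc j) * (of_nat j * fact j + fact (j - 1))"
    using Gamma_fact[of j, where ?'a = complex] Gamma_fact[of "j - 1", where ?'a = complex] j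
    by (simp add: of_nat_diff add_ac)
  also have "\<dots> = complex_of_real (real j / fact (Suc j) * (real j * fact j + fact (j - 1)))" by simp
  finally have V: "(LINT t|lborel. indicat_real {0<..} t * g t) = real j / fact (Suc j) * (real j * fact j + fact (j - 1))"
    by (simp only: of_real_eq_iff)
  have "(LINT t|lborel. norm (indicat_real {0<..} t *\<^sub>R (of_real (lag_coeff j t) * mellin_kernel k t)))
      \<le> (LINT t|lborel. indicat_real {0<..} t * g t)"
  proof (rule integral_mono[OF _ ig'])
    show "integrable lborel (\<lambda>t. norm (indicat_real {0<..} t *\<^sub>R (of_real (lag_coeff j t) * mellin_kernel k t)))"
      using mellin_lag_coeff_integrable(1)[OF j, of k] unfolding set_integrable_def by (rule integrable_norm)
    fix t :: real
    show "norm (indicat_real {0<..} t *\<^sub>R (of_real (lag_coeff j t) * mellin_kernel k t)) \<le> indicat_real {0<..} t * g t"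
    proof (cases "t > 0")
      case True
      have "\<bar>lag_coeff j t\<bar> * (1 / t) \<le> g t"
        unfolding g_def using lag_coeff_abs_le[OF True, of j] True by (intro mult_right_mono) auto
      then show ?thesis using True by (simp add: norm_mult norm_mellin_kernel)
    qed auto
  qed
  also have "\<dots> \<le> real j + 1"
  proof -
    have jf: "real j * fact (j - 1) = fact j" using j by (simp add: fact_reduce)
    have "real j / fact (Suc j) * (real j * fact j + fact (j - 1)) = (real j * real j + 1) * fact j / fact (Suc j)"
      by (simp add: distrib_left jf[symmetric] algebra_simps)
    also have "\<dots> = (real j * real j + 1) / (real j + 1)" by (simp add: add.commute)
    also have "\<dots> \<le> real j + 1" by (simp add: field_simps)
    finally show ?thesis unfolding V .
  qed
  finally show ?thesis .
qed

text \<open>Lag 0 gives the closed-form term. For the other lags, the absolute integrals are at most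
  \<open>(j + 1) / (2^j - 1)\<close>, whose summability justifies exchanging series and
  integral.\<close>

lemma mellin_lag_sum:
  shows "set_integrable lborel {0<..} (\<lambda>t. of_real (lag_sum t) * mellin_kernel k t)"
    and "(LINT t:{0<..}|lborel. of_real (lag_sum t) * mellin_kernel k t) = trie_G k"
proof -
  show "set_integrable lborel {0<..} (\<lambda>t. of_real (lag_sum t) * mellin_kernel k t)"
    by (rule mellin_dominated_integrable[OF continuous_on_lag_sum]) (rule lag_sum_bound)
  define f where "f j t = indicat_real {0<..} t *\<^sub>R (of_real (lag_coeff (Suc j) t) * mellin_kernel k t)" for j t
  define D :: "nat \<Rightarrow> complex" where "D j = 2 ^ Suc j - 1" for j
  have D: "norm (D j) = 2 ^ Suc j - 1" "D j \<noteq> 0" "(2::real) ^ Suc j - 1 \<ge> 1" for j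
  proof -
    have "(2::real) ^ 1 \<le> 2 ^ Suc j" by (intro power_increasing) auto
    then show a: "(2::real) ^ Suc j - 1 \<ge> 1" by simp
    have "D j = of_real (2 ^ Suc j - 1)" by (simp add: D_def)
    then have "norm (D j) = \<bar>2 ^ Suc j - 1\<bar>" by (simp only: norm_of_real)
    then show "norm (D j) = 2 ^ Suc j - 1" using a by linarith
    then have "norm (D j) \<ge> 1" using a by linarith
    then show "D j \<noteq> 0" by auto
  qed
  have intf: "integrable lborel (f j)" for j
    using mellin_lag_coeff_integrable(1)[of "Suc j" k] unfolding f_def set_integrable_def by simp
  have valf: "integral\<^sup>L lborel (f j) = trie_G_term k (Suc j) * D j" for j
    using mellin_lag_coeff_integrable(2)[of "Suc j" k] unfolding f_def set_lebesgue_integral_def D_def by simp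
  have ptsum: "summable (\<lambda>j. norm (f j t / D j))" "(\<Sum>j. f j t / D j) = indicat_real {0<..} t *\<^sub>R
      (of_real (\<Sum>j. lag_coeff (Suc j) t / (2 ^ Suc j - 1)) * mellin_kernel k t)" for t
  proof -
    show "summable (\<lambda>j. norm (f j t / D j))"
    proof (cases "t > 0")
      case True
      have e: "norm (f j t / D j) = \<bar>lag_coeff (Suc j) t / (2 ^ Suc j - 1)\<bar> * (1 / t)" for j
        using True D(3)[of j] by (simp add: f_def norm_divide norm_mult norm_mellin_kernel D(1) abs_divide del: power_Suc)
      show ?thesis unfolding e by (rule summable_mult2[OF lag_sum_eq(1)[OF True]])
    qed (simp add: f_def)
    show "(\<Sum>j. f j t / D j) = indicat_real {0<..} t *\<^sub>R
      (of_real (\<Sum>j. lag_coeff (Suc j) t / (2 ^ Suc j - 1)) * mellin_kernel k t)"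
    proof (cases "t > 0")
      case True
      have "(\<lambda>j. lag_coeff (Suc j) t / (2 ^ Suc j - 1)) sums (\<Sum>j. lag_coeff (Suc j) t / (2 ^ Suc j - 1))"
        by (rule summable_sums[OF summable_rabs_cancel[OF lag_sum_eq(1)[OF True]]])
      then have "(\<lambda>j. complex_of_real (lag_coeff (Suc j) t / (2 ^ Suc j - 1)) * mellin_kernel k t) sums
         (of_real (\<Sum>j. lag_coeff (Suc j) t / (2 ^ Suc j - 1)) * mellin_kernel k t)"
        by (intro sums_mult2 sums_of_real)
      moreover have "complex_of_real (lag_coeff (Suc j) t / (2 ^ Suc j - 1)) * mellin_kernel k t = f j t / D j" for j
        using True by (simp add: f_def D_def)
      ultimately have "(\<lambda>j. f j t / D j) sums (of_real (\<Sum>j. lag_coeff (Suc j) t / (2 ^ Suc j - 1)) * mellin_kernel k t)"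
        by (simp only:)
      from sums_unique[OF this] show ?thesis using True by simp
    qed (simp add: f_def)
  qed
  have sumint: "summable (\<lambda>j. LINT t|lborel. norm (f j t / D j))"
  proof (rule summable_comparison_test_bigo)
    show "summable (\<lambda>j. norm (1 / real j ^ 2))"
      using inverse_power_summable[of 2, where ?'a = real] by (simp add: inverse_eq_divide)
    have "(\<lambda>j. LINT t|lborel. norm (f j t / D j)) \<in> O(\<lambda>j. (real (Suc j) + 1) / (2 ^ Suc j - 1))"
    proof (rule bigoI[of _ 1], rule always_eventually, rule allI)
      fix j
      have "(LINT t|lborel. norm (f j t / D j)) = (LINT t|lborel. norm (f j t)) / (2 ^ Suc j - 1)"
        by (simp add: norm_divide D(1) del: power_Suc)
      also have "\<dots> \<le> (real (Suc j) + 1) / (2 ^ Suc j - 1)"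
      proof (rule divide_right_mono)
        show "0 \<le> (2::real) ^ Suc j - 1" using D(3)[of j] by linarith
      qed (use mellin_lag_coeff_norm[of "Suc j" k] in \<open>simp add: f_def\<close>)
      finally show "norm (LINT t|lborel. norm (f j t / D j)) \<le> 1 * norm ((real (Suc j) + 1) / (2 ^ Suc j - 1))"
        using D(3)[of j] by (subst real_norm_def, subst abs_of_nonneg) (auto simp del: power_Suc)
    qed
    also have "(\<lambda>j. (real (Suc j) + 1) / (2 ^ Suc j - 1)) \<in> O(\<lambda>j. 1 / real j ^ 2)" by real_asymp
    finally show "(\<lambda>j. LINT t|lborel. norm (f j t / D j)) \<in> O(\<lambda>j. 1 / real j ^ 2)" .
  qed
  have intd: "integrable lborel (\<lambda>t. f j t / D j)" for j using intf by (rule integrable_divide)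
  have S: "(LINT t:{0<..}|lborel. of_real (\<Sum>j. lag_coeff (Suc j) t / (2 ^ Suc j - 1)) * mellin_kernel k t)
      = (\<Sum>j. trie_G_term k (Suc j))"
  proof -
    have "(LINT t|lborel. (\<Sum>j. f j t / D j)) = (\<Sum>j. LINT t|lborel. f j t / D j)"
      by (rule integral_suminf[OF intd]) (use ptsum(1) sumint in auto)
    also have "\<dots> = (\<Sum>j. trie_G_term k (Suc j))" using D(2) by (simp add: valf)
    finally show ?thesis unfolding ptsum(2) set_lebesgue_integral_def .
  qed
  have iS: "set_integrable lborel {0<..} (\<lambda>t. of_real (\<Sum>j. lag_coeff (Suc j) t / (2 ^ Suc j - 1)) * mellin_kernel k t)"
    using integrable_suminf[OF intd, OF _ sumint] ptsum(1) unfolding ptsum(2) set_integrable_def by auto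
  have i0: "set_integrable lborel {0<..} (\<lambda>t. of_real (lag_term 0 t) * mellin_kernel k t)"
    by (rule mellin_dominated_integrable[of _ 1, OF continuous_on_lag_term]) (use lag_term_bound[of _ 0] in auto)
  have "(LINT t:{0<..}|lborel. of_real (lag_sum t) * mellin_kernel k t)
     = (LINT t:{0<..}|lborel. of_real (lag_term 0 t) * mellin_kernel k t
          + 2 * (of_real (\<Sum>j. lag_coeff (Suc j) t / (2 ^ Suc j - 1)) * mellin_kernel k t))"
    by (rule set_lebesgue_integral_cong) (auto simp: lag_sum_eq(2) algebra_simps simp del: power_Suc)
  also have "\<dots> = - (Gamma (1 + trie_chi k) * (1 + trie_chi k)\<^sup>2 / (4 * (trie_chi k - 1))) + 2 * (\<Sum>j. trie_G_term k (Suc j))"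
    by (subst set_integral_add(2)[OF i0]) (simp_all only: set_integral_mult_right S mellin_lag_term_0 set_integrable_mult_right iS)
  also have "\<dots> = trie_G k"
  proof (cases "k = 0")
    case True
    \<comment> \<open>At exponent 0, the factorization of \<open>j^2 - 1\<close> lets all factorials
      cancel and leaves \<open>j - 1\<close>; the closed-form term of lag 0 reduces to 1/4.\<close>
    have "trie_G_term 0 (Suc j) = of_real (trie_G0_term (Suc j))" for j
    proof -
      define F :: complex where "F = fact j"
      have F: "F \<noteq> 0" by (simp add: F_def)
      have G: "Gamma (of_nat (Suc j)) = F" using Gamma_fact[of j, where ?'a = complex] by (simp add: F_def)
      have f2: "fact (Suc j + 1) = of_nat (Suc (Suc j)) * (of_nat (Suc j) * F)" by (simp add: F_def algebra_simps)
      have nz: "of_nat (Suc (Suc j)) \<noteq> (0::complex)" "of_nat (Suc j) \<noteq> (0::complex)" by (simp_all del: of_nat_Suc)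
      have e: "of_nat (Suc j) * of_nat (Suc j) - 1 = (of_nat (Suc (Suc j)) * of_nat j :: complex)" by (simp add: algebra_simps)
      have "trie_G_term 0 (Suc j) = (-1) ^ Suc j * of_nat (Suc j) * (of_nat (Suc (Suc j)) * of_nat j) * F
          / (of_nat (Suc (Suc j)) * (of_nat (Suc j) * F) * (2 ^ Suc j - 1))"
        unfolding trie_G_term_def trie_chi_0 add_0_right G f2 e ..
      also have "\<dots> = (-1) ^ Suc j * of_nat j / (2 ^ Suc j - 1)"
        using F nz by (simp del: of_nat_Suc power_Suc)
      also have "\<dots> = of_real (trie_G0_term (Suc j))" by (simp add: trie_G0_term_def)
      finally show ?thesis .
    qed
    then have "(\<Sum>j. trie_G_term 0 (Suc j)) = of_real (\<Sum>j. trie_G0_term (Suc j))"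
      by (simp only:) (rule suminf_of_real[OF summable_trie_G0_term, symmetric])
    then show ?thesis using True by (simp add: trie_G_def trie_G0_def)
  next
    case False
    define c where "c = trie_chi k"
    have Im: "Im c \<noteq> 0" using False by (simp add: c_def trie_chi_def)
    have nz: "c \<notin> \<int>\<^sub>\<le>\<^sub>0" "c - 1 \<notin> \<int>\<^sub>\<le>\<^sub>0" using Im by (auto elim!: nonpos_Ints_cases simp: complex_eq_iff)
    \<comment> \<open>Two steps of the functional equation, away from poles because
      \<open>Im c\<close> is nonzero, produce the factor \<open>c - 1\<close> that cancels the
      denominator of the lag 0 term.\<close>
    have G: "Gamma (1 + c) = c * ((c - 1) * Gamma (-1 + c))"
      using Gamma_plus1[OF nz(1)] Gamma_plus1[OF nz(2)] by (simp add: add.commute)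
    have c1: "c - 1 \<noteq> 0" using Im by auto
    have "c * ((c - 1) * Gamma (-1 + c)) * (1 + c)\<^sup>2 / (4 * (c - 1)) = c * Gamma (-1 + c) * (1 + c)\<^sup>2 / 4"
      using mult_divide_mult_cancel_left[OF c1, of "c * Gamma (-1 + c) * (1 + c)\<^sup>2" 4] by (simp only: mult_ac)
    then show ?thesis using False unfolding trie_G_def c_def[symmetric] G by simp
  qed
  finally show "(LINT t:{0<..}|lborel. of_real (lag_sum t) * mellin_kernel k t) = trie_G k" .
qed

section \<open>The constant term\<close>

lemma trie_G0_term_Suc: "trie_G0_term (Suc i) = (-1) ^ Suc i * (real i / (2 ^ Suc i - 1))"
  by (simp add: trie_G0_term_def)

lemma int_div_bounds:
  fixes a b :: int
  assumes "b > 0"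
  shows "real_of_int (a div b) \<le> real_of_int a / real_of_int b" "real_of_int a / real_of_int b \<le> real_of_int (a div b) + 1"
  using real_of_int_div4[of a b] real_of_int_div3[of a b] by auto

text \<open>Scaling by \<open>10^21\<close> and rounding down the absolute value of each term turns
  the partial sum into integer arithmetic; every one of the 80 roundings costs at most 1.\<close>

lemma trie_G0_partial_sum:
  "\<bar>(\<Sum>i<80. trie_G0_term (Suc i)) * 10 ^ 21 - real_of_int (\<Sum>i<80. (-1) ^ Suc i * (10 ^ 21 * int i div (2 ^ Suc i - 1)))\<bar> \<le> 80"
proof -
  have "(\<Sum>i<80. trie_G0_term (Suc i)) * 10 ^ 21 - real_of_int (\<Sum>i<80. (-1) ^ Suc i * (10 ^ 21 * int i div (2 ^ Suc i - 1)))
      = (\<Sum>i<80::nat. (-1) ^ Suc i * (real i / (2 ^ Suc i - 1) * 10 ^ 21 - real_of_int (10 ^ 21 * int i div (2 ^ Suc i - 1))))"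
    unfolding trie_G0_term_Suc of_int_sum sum_distrib_right sum_subtractf[symmetric]
    by (intro sum.cong refl) (simp only: of_int_mult of_int_power of_int_minus of_int_1 right_diff_distrib mult.assoc)
  also have "\<bar>\<dots>\<bar> \<le> (\<Sum>i<80::nat. 1)"
  proof (rule order_trans[OF sum_abs], rule sum_mono)
    fix i :: nat
    have "(2::int) ^ 1 \<le> 2 ^ Suc i" by (intro power_increasing) auto
    then have b: "(2::int) ^ Suc i - 1 > 0" by (simp del: power_Suc)
    have "real i / (2 ^ Suc i - 1) * 10 ^ 21 = real_of_int (10 ^ 21 * int i) / real_of_int (2 ^ Suc i - 1)" by simp
    then have "\<bar>real i / (2 ^ Suc i - 1) * 10 ^ 21 - real_of_int (10 ^ 21 * int i div (2 ^ Suc i - 1))\<bar> \<le> 1"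
      using int_div_bounds[OF b, of "10 ^ 21 * int i"] by linarith
    then show "\<bar>(-1) ^ Suc i * (real i / (2 ^ Suc i - 1) * 10 ^ 21 - real_of_int (10 ^ 21 * int i div (2 ^ Suc i - 1)))\<bar> \<le> 1"
      by (simp only: abs_mult power_abs abs_minus_cancel abs_one power_one mult_1)
  qed
  finally show ?thesis by simp
qed

lemma trie_G0_integer_sum:
  "(\<Sum>i<80. (-1) ^ Suc i * (10 ^ 21 * int i div (2 ^ Suc i - 1))) = 168152259868723892572"
  by code_simp

text \<open>The tail is dominated by the sum of \<open>m / 2^m\<close>, which telescopes as
  \<open>T (Suc m) - T m\<close>. Starting at 80, the bound is \<open>162 / 2^80\<close>.\<close>

lemma trie_G0_tail:
  "\<bar>(\<Sum>i. trie_G0_term (Suc i)) - (\<Sum>i<80. trie_G0_term (Suc i))\<bar> \<le> 1 / 10 ^ 21"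
proof -
  define T where "T i = - (2 * (real i + 1) / 2 ^ i)" for i
  have T0: "T \<longlonglongrightarrow> 0" unfolding T_def by real_asymp
  have S: "(\<lambda>n. T (Suc n + 80) - T (n + 80)) sums (0 - T (0 + 80))"
    by (rule telescope_sums) (rule LIMSEQ_ignore_initial_segment[OF T0])
  have bd: "norm (trie_G0_term (Suc (i + 80))) \<le> T (Suc i + 80) - T (i + 80)" for i
  proof -
    define m where "m = i + 80"
    have "(2::real) ^ m \<le> 2 ^ Suc m - 1" using one_le_power[of "2::real" m] by simp
    then have "real m / (2 ^ Suc m - 1) \<le> real m / 2 ^ m" by (intro frac_le) auto
    also have "\<dots> = T (Suc m) - T m" by (simp add: T_def field_simps)
    finally have "real m / (2 ^ Suc m - 1) \<le> T (Suc m) - T m" .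
    moreover have "norm (trie_G0_term (Suc m)) = real m / (2 ^ Suc m - 1)"
    proof -
      have "0 \<le> (2::real) ^ Suc m - 1" by (simp del: power_Suc)
      then show ?thesis unfolding trie_G0_term_Suc norm_mult norm_power norm_divide by (simp del: power_Suc)
    qed
    moreover have "Suc i + 80 = Suc m" by (simp add: m_def)
    ultimately show ?thesis by (simp only: m_def)
  qed
  have "(\<Sum>i. trie_G0_term (Suc i)) - (\<Sum>i<80. trie_G0_term (Suc i)) = (\<Sum>i. trie_G0_term (Suc (i + 80)))"
    using suminf_split_initial_segment[OF summable_trie_G0_term, of 80] by simp
  also have "norm \<dots> \<le> (\<Sum>i. T (Suc i + 80) - T (i + 80))"
    using S by (intro norm_suminf_le bd) (rule sums_summable)
  also have "\<dots> = - T 80" using sums_unique[OF S] by simp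
  also have "\<dots> \<le> 1 / 10 ^ 21" by (simp add: T_def)
  finally show ?thesis by simp
qed

lemma ln_2_bounds: "ln 2 \<in> {69314718055994530941 / 10 ^ 20..69314718055994530942 / (10 ^ 20 :: real)}"
  using ln_approx_bounds[of 2 22] by (simp add: lessThan_nat_numeral power_divide)

lemma trie_G0_numeric: "\<bar>trie_G0 / ln 2 - 0.845858623076001\<bar> < 5 / 10 ^ 16"
proof -
  define S where "S = (\<Sum>i. trie_G0_term (Suc i))"
  define P where "P = (\<Sum>i<80. trie_G0_term (Suc i))"
  have P: "\<bar>P * 10 ^ 21 - 168152259868723892572\<bar> \<le> 80"
    using trie_G0_partial_sum unfolding trie_G0_integer_sum P_def by simp
  have SP: "\<bar>S - P\<bar> \<le> 1 / 10 ^ 21" using trie_G0_tail by (simp add: S_def P_def)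
  have G: "trie_G0 = 1/4 + 2 * S" by (simp add: trie_G0_def S_def)
  have G1: "5863045197374477 / 10 ^ 16 \<le> trie_G0" "58630451973744779 / 10 ^ 17 \<ge> trie_G0"
  proof -
    have "S \<le> P + 1 / 10 ^ 21" "P \<le> S + 1 / 10 ^ 21" using SP by linarith+
    moreover have "P * 10 ^ 21 \<le> 168152259868723892652" "168152259868723892492 \<le> P * 10 ^ 21" using P by linarith+
    ultimately show "5863045197374477 / 10 ^ 16 \<le> trie_G0" "58630451973744779 / 10 ^ 17 \<ge> trie_G0"
      unfolding G by simp_all
  qed
  have l: "69314718055994530 / 10 ^ 17 \<le> ln (2::real)" "ln (2::real) \<le> 69314718055994531 / 10 ^ 17"
    using ln_2_bounds by simp_all
  have l0: "ln (2::real) > 0" by simp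
  have "trie_G0 / ln 2 < 0.845858623076001 + 5 / 10 ^ 16"
  proof (subst pos_divide_less_eq[OF l0])
    have "trie_G0 < (0.845858623076001 + 5 / 10 ^ 16) * (69314718055994530 / 10 ^ 17)" using G1(2) by simp
    also have "\<dots> \<le> (0.845858623076001 + 5 / 10 ^ 16) * ln 2" using l(1) by (intro mult_left_mono) auto
    finally show "trie_G0 < (0.845858623076001 + 5 / 10 ^ 16) * ln 2" .
  qed
  moreover have "0.845858623076001 - 5 / 10 ^ 16 < trie_G0 / ln 2"
  proof (subst pos_less_divide_eq[OF l0])
    have "(0.845858623076001 - 5 / 10 ^ 16) * ln (2::real) \<le> (0.845858623076001 - 5 / 10 ^ 16) * (69314718055994531 / 10 ^ 17)"
      using l(2) by (intro mult_left_mono) auto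
    also have "\<dots> < trie_G0" using G1(1) by simp
    finally show "(0.845858623076001 - 5 / 10 ^ 16) * ln 2 < trie_G0" .
  qed
  ultimately show ?thesis unfolding abs_less_iff by linarith
qed

section \<open>Fourier expansion of the limit\<close>

text \<open>Uniform convergence along finite subsets, from the Weierstrass test, gives both
  continuity and the exchange with the integral; it serves for the limit function as well as for its
  Fourier series.\<close>

lemma continuous_integral_infsum:
  fixes f :: "'a \<Rightarrow> real \<Rightarrow> complex"
  assumes cont: "\<And>a. continuous_on {l..u} (f a)"
    and bound: "\<And>a \<theta>. \<theta> \<in> {l..u} \<Longrightarrow> norm (f a \<theta>) \<le> M a" and M: "M summable_on UNIV"
  shows "continuous_on {l..u} (\<lambda>\<theta>. \<Sum>\<^sub>\<infinity>a. f a \<theta>)"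
    and "((\<lambda>a. integral {l..u} (f a)) has_sum integral {l..u} (\<lambda>\<theta>. \<Sum>\<^sub>\<infinity>a. f a \<theta>)) UNIV"
proof -
  have ul: "uniform_limit {l..u} (\<lambda>A \<theta>. \<Sum>a\<in>A. f a \<theta>) (\<lambda>\<theta>. \<Sum>\<^sub>\<infinity>a. f a \<theta>) (finite_subsets_at_top UNIV)"
    by (rule Weierstrass_m_test_general[OF _ M]) (use bound in auto)
  have c: "continuous_on {l..u} (\<lambda>\<theta>. \<Sum>a\<in>A. f a \<theta>)" for A by (intro continuous_intros cont)
  show "continuous_on {l..u} (\<lambda>\<theta>. \<Sum>\<^sub>\<infinity>a. f a \<theta>)"
    by (rule uniform_limit_theorem[OF _ ul]) (auto intro: always_eventually c)
  obtain I J where IJ: "\<And>A. ((\<lambda>\<theta>. \<Sum>a\<in>A. f a \<theta>) has_integral I A) {l..u}"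
    "((\<lambda>\<theta>. \<Sum>\<^sub>\<infinity>a. f a \<theta>) has_integral J) {l..u}" "(I \<longlongrightarrow> J) (finite_subsets_at_top UNIV)"
    using uniform_limit_integral[OF ul c] by auto
  have "I A = (\<Sum>a\<in>A. integral {l..u} (f a))" if "finite A" for A
  proof -
    have "((\<lambda>\<theta>. \<Sum>a\<in>A. f a \<theta>) has_integral (\<Sum>a\<in>A. integral {l..u} (f a))) {l..u}"
      by (intro has_integral_sum that integrable_integral integrable_continuous_interval cont)
    then show ?thesis using IJ(1) has_integral_unique by blast
  qed
  then have "eventually (\<lambda>A. I A = (\<Sum>a\<in>A. integral {l..u} (f a))) (finite_subsets_at_top UNIV)"
    by (auto intro: eventually_finite_subsets_at_top_weakI)
  then have "((\<lambda>A. \<Sum>a\<in>A. integral {l..u} (f a)) \<longlongrightarrow> J) (finite_subsets_at_top UNIV)"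
    using IJ(3) tendsto_cong by blast
  then show "((\<lambda>a. integral {l..u} (f a)) has_sum integral {l..u} (\<lambda>\<theta>. \<Sum>\<^sub>\<infinity>a. f a \<theta>)) UNIV"
    using IJ(2) by (simp add: has_sum_def integral_unique)
qed

lemma integral_cis_int:
  "integral {0..2 * pi} (\<lambda>\<theta>. cis (real_of_int n * \<theta>)) = (if n = 0 then 2 * of_real pi else 0)"
proof (cases "n = 0")
  case False
  have "((\<lambda>\<theta>. cis (real_of_int n * \<theta>)) has_integral
      (cis (real_of_int n * (2 * pi)) / (\<i> * of_int n) - cis (real_of_int n * 0) / (\<i> * of_int n))) {0..2 * pi}"
  proof (rule fundamental_theorem_of_calculus)
    fix \<theta> :: real
    have "((\<lambda>z. exp (\<i> * of_int n * z) / (\<i> * of_int n)) has_field_derivative exp (\<i> * of_int n * of_real \<theta>)) (at (of_real \<theta>))"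
      using False by (auto intro!: derivative_eq_intros)
    then have "((\<lambda>\<theta>. exp (\<i> * of_int n * of_real \<theta>) / (\<i> * of_int n)) has_vector_derivative exp (\<i> * of_int n * of_real \<theta>))
        (at \<theta> within {0..2 * pi})" by (rule has_vector_derivative_real_field)
    then show "((\<lambda>\<theta>. cis (real_of_int n * \<theta>) / (\<i> * of_int n)) has_vector_derivative cis (real_of_int n * \<theta>)) (at \<theta> within {0..2 * pi})"
      by (simp add: cis_conv_exp mult.assoc)
  qed simp
  moreover have "cis (real_of_int n * (2 * pi)) = 1"
    using cis_multiple_2pi[of "real_of_int n"] by (simp add: mult_ac)
  ultimately show ?thesis using False by (simp add: integral_unique)
qed (simp add: scaleR_conv_of_real)

section \<open>Quadratic decay of the coefficients\<close>

lemma Gamma_shift3_le: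
  assumes c: "Re c = 0" "Im c \<noteq> 0" and j: "j \<ge> 1"
  shows "norm (Gamma (of_nat j + c)) \<le> fact (j + 2) / norm c ^ 3"
proof -
  define z where "z = of_nat j + c"
  have nz: "z + of_nat i \<notin> \<int>\<^sub>\<le>\<^sub>0" for i
    using c by (auto elim!: nonpos_Ints_cases simp: complex_eq_iff z_def)
  have big: "norm c \<le> norm (z + of_nat i)" for i
  proof -
    have "norm c = \<bar>Im (z + of_nat i)\<bar>" using c by (simp add: z_def cmod_def)
    also have "\<dots> \<le> norm (z + of_nat i)" by (rule abs_Im_le_cmod)
    finally show ?thesis .
  qed
  \<comment> \<open>Each shift gains a factor of at least \<open>norm c\<close>. With three of them
    a summable order of decay remains after the polynomial factor of \<open>trie_G_term\<close> has
    given one back.\<close>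
  have "Gamma (z + of_nat 3) = (z + of_nat 2) * (z + of_nat 1) * (z + of_nat 0) * Gamma z"
    using Gamma_plus1[OF nz[of 0]] Gamma_plus1[OF nz[of 1]] Gamma_plus1[OF nz[of 2]] by (simp add: add_ac)
  then have "norm (Gamma (z + of_nat 3)) = norm (z + of_nat 2) * norm (z + of_nat 1) * norm (z + of_nat 0) * norm (Gamma z)"
    by (simp only: norm_mult)
  moreover have "norm c * norm c * norm c * norm (Gamma z) \<le> norm (z + of_nat 2) * norm (z + of_nat 1) * norm (z + of_nat 0) * norm (Gamma z)"
    by (intro mult_right_mono mult_mono big) auto
  ultimately have "norm c ^ 3 * norm (Gamma z) \<le> norm (Gamma (z + of_nat 3))" by (simp add: power3_eq_cube)
  also have "\<dots> \<le> Gamma (Re (z + of_nat 3))"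
    using c by (intro norm_Gamma_le_Gamma_Re) (simp add: z_def)
  also have "\<dots> = fact (j + 2)"
    using Gamma_fact[of "j + 2", where ?'a = real] c by (simp add: z_def add_ac)
  finally show ?thesis using c by (simp add: z_def field_simps complex_eq_iff)
qed

lemma norm_trie_chi: "norm (trie_chi k) = 2 * pi * \<bar>real_of_int k\<bar> / ln 2"
  by (simp add: trie_chi_def norm_mult norm_divide)

lemma norm_trie_chi_ge: "norm (trie_chi k) \<ge> \<bar>real_of_int k\<bar>"
proof -
  have "ln 2 \<le> (1::real)" using ln_2_less_1 by simp
  then have "1 \<le> 2 * pi / ln 2" using pi_ge_two by (simp add: field_simps)
  then have "1 * \<bar>real_of_int k\<bar> \<le> (2 * pi / ln 2) * \<bar>real_of_int k\<bar>" by (intro mult_right_mono) auto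
  then show ?thesis by (simp add: norm_trie_chi)
qed

text \<open>The polynomial factor costs one power of \<open>norm c\<close> against the three gained
  from Gamma. The quotient of factorials costs only \<open>j + 2\<close>, so the decay
  \<open>2^(- j)\<close> survives and the bound can be summed over \<open>j\<close>.\<close>

lemma trie_G_term_bound:
  assumes k: "k \<noteq> 0" and j: "j \<ge> 1"
  shows "norm (trie_G_term k j) \<le> (real j * (real j + 2) * ((real j)\<^sup>2 + real j + 1) / (2 ^ j - 1)) / (norm (trie_chi k))\<^sup>2"
proof -
  define c where "c = trie_chi k"
  have c: "Re c = 0" "Im c \<noteq> 0" using k by (simp_all add: c_def trie_chi_def)
  have "\<bar>real_of_int k\<bar> \<ge> 1" using k by simp
  then have n1: "norm c \<ge> 1" using norm_trie_chi_ge[of k] unfolding c_def by linarith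
  have D: "norm ((2::complex) ^ j - 1) = 2 ^ j - 1" "(2::real) ^ j - 1 > 0"
  proof -
    have "(2::real) ^ 1 \<le> 2 ^ j" using j by (intro power_increasing) auto
    then show "(2::real) ^ j - 1 > 0" by simp
    moreover have "(2::complex) ^ j - 1 = of_real (2 ^ j - 1)" by simp
    ultimately show "norm ((2::complex) ^ j - 1) = 2 ^ j - 1" by (metis abs_of_pos norm_of_real)
  qed
  have P: "norm (of_nat j * (of_nat j + c) - 1) \<le> ((real j)\<^sup>2 + real j + 1) * norm c"
  proof -
    have "norm (of_nat j * (of_nat j + c) - 1) \<le> norm (of_nat j * (of_nat j + c)) + 1"
      using norm_triangle_ineq4[of "of_nat j * (of_nat j + c)" 1] by simp
    also have "norm (of_nat j * (of_nat j + c)) \<le> real j * (real j + norm c)"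
      unfolding norm_mult using norm_triangle_ineq[of "of_nat j" c] by (intro mult_mono) auto
    also have "real j * (real j + norm c) + 1 \<le> real j * (real j * norm c + norm c) + norm c"
      using n1 by (intro add_mono mult_left_mono) (auto simp: mult_le_cancel_left1)
    finally show ?thesis by (simp add: power2_eq_square algebra_simps)
  qed
  have "norm (trie_G_term k j) = real j * norm (of_nat j * (of_nat j + c) - 1) * norm (Gamma (of_nat j + c)) / (fact (j + 1) * (2 ^ j - 1))"
    unfolding trie_G_term_def c_def[symmetric] norm_divide norm_mult D by (simp add: norm_power norm_fact del: fact_Suc)
  also have "\<dots> \<le> real j * (((real j)\<^sup>2 + real j + 1) * norm c) * (fact (j + 2) / norm c ^ 3) / (fact (j + 1) * (2 ^ j - 1))"
    using D(2) by (intro divide_right_mono mult_mono P Gamma_shift3_le[OF c j]) auto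
  also have "\<dots> = (real j * (real j + 2) * ((real j)\<^sup>2 + real j + 1) / (2 ^ j - 1)) / (norm c)\<^sup>2"
  proof -
    define F where "F = (fact (j + 1) :: real)"
    have f: "fact (j + 2) = (real j + 2) * F" by (simp add: F_def algebra_simps)
    have F: "F > 0" by (simp add: F_def)
    define E w where "E = (2::real) ^ j - 1" and "w = norm c"
    have "E > 0" "w > 0" using D(2) n1 by (auto simp: E_def w_def)
    then show ?thesis using F unfolding f F_def[symmetric] E_def[symmetric] w_def[symmetric]
      by (simp add: power2_eq_square power3_eq_cube field_simps)
  qed
  finally show ?thesis by (simp add: c_def)
qed

lemma trie_G_bound: "\<exists>C. \<forall>k. k \<noteq> 0 \<longrightarrow> norm (trie_G k) \<le> C / (real_of_int k)\<^sup>2"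
proof -
  define b where "b i = (let j = real (Suc i) in j * (j + 2) * (j\<^sup>2 + j + 1) / (2 ^ Suc i - 1))" for i
  have sb: "summable b"
  proof (rule summable_comparison_test_bigo)
    show "summable (\<lambda>i. norm (1 / real i ^ 2))"
      using inverse_power_summable[of 2, where ?'a = real] by (simp add: inverse_eq_divide)
    show "b \<in> O(\<lambda>i. 1 / real i ^ 2)" unfolding b_def Let_def by real_asymp
  qed
  define C where "C = 6 + 2 * suminf b"
  have C0: "C \<ge> 0"
  proof -
    have "b i \<ge> 0" for i unfolding b_def Let_def by (intro divide_nonneg_nonneg mult_nonneg_nonneg) (auto simp del: power_Suc)
    then show ?thesis unfolding C_def using suminf_nonneg[OF sb] by simp
  qed
  have "norm (trie_G k) \<le> C / (real_of_int k)\<^sup>2" if k: "k \<noteq> 0" for k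
  proof -
    define c where "c = trie_chi k"
    have c: "Re c = 0" "Im c \<noteq> 0" using k by (simp_all add: c_def trie_chi_def)
    then have c0: "norm c > 0" by auto
    have first: "norm (c * Gamma (-1 + c) * (1 + c)\<^sup>2 / 4) \<le> 6 / (norm c)\<^sup>2"
    proof -
      have nz: "-1 + c + of_nat i \<notin> \<int>\<^sub>\<le>\<^sub>0" for i
        using c by (auto elim!: nonpos_Ints_cases simp: complex_eq_iff)
      have nz': "c - 1 \<noteq> 0" "c \<noteq> 0" "c + 1 \<noteq> 0" using c by (auto simp: complex_eq_iff)
      have G: "Gamma (1 + (1 + c)) = (1 + c) * (c * ((c - 1) * Gamma (-1 + c)))"
        using Gamma_plus1[OF nz[of 0]] Gamma_plus1[OF nz[of 1]] Gamma_plus1[OF nz[of 2]] by (simp add: add_ac)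
      \<comment> \<open>Expressed through \<open>Gamma (2 + c)\<close>, the remaining factor
        \<open>(1 + c) / (c - 1)\<close> has modulus 1, as \<open>c\<close> is purely imaginary. The
        constant 6 is \<open>fact 4 / 4\<close>.\<close>
      have "c * Gamma (-1 + c) * (1 + c)\<^sup>2 = Gamma (1 + (1 + c)) * (1 + c) / (c - 1)"
        unfolding G using nz' by (simp add: power2_eq_square)
      then have "norm (c * Gamma (-1 + c) * (1 + c)\<^sup>2) = norm (Gamma (2 + c)) * (norm (1 + c) / norm (c - 1))"
        by (simp add: norm_mult norm_divide add.assoc[symmetric])
      also have "norm (1 + c) = norm (c - 1)" using c by (simp add: cmod_def)
      also have "norm (Gamma (2 + c)) * (norm (c - 1) / norm (c - 1)) = norm (Gamma (2 + c))" using nz' by simp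
      also have "\<dots> \<le> fact (2 + 2) / norm c ^ 3" using Gamma_shift3_le[OF c, of 2] by simp
      finally have 1: "norm (c * Gamma (-1 + c) * (1 + c)\<^sup>2) \<le> 24 / norm c ^ 3" by (simp add: fact_numeral)
      have "\<bar>real_of_int k\<bar> \<ge> 1" using k by simp
      then have n1: "norm c \<ge> 1" using norm_trie_chi_ge[of k] unfolding c_def by linarith
      have "norm c ^ 3 \<ge> (norm c)\<^sup>2" using n1 by (intro power_increasing) auto
      then have "24 / norm c ^ 3 \<le> 24 / (norm c)\<^sup>2" using n1 by (intro divide_left_mono) auto
      then show ?thesis using 1 by (simp add: norm_divide)
    qed
    have second: "norm (\<Sum>i. trie_G_term k (Suc i)) \<le> suminf b / (norm c)\<^sup>2"
    proof -
      have "norm (trie_G_term k (Suc i)) \<le> b i / (norm c)\<^sup>2" for i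
        using trie_G_term_bound[OF k, of "Suc i"] by (simp add: b_def c_def Let_def)
      then have "norm (\<Sum>i. trie_G_term k (Suc i)) \<le> (\<Sum>i. b i / (norm c)\<^sup>2)"
        by (intro norm_suminf_le summable_divide sb)
      also have "\<dots> = suminf b / (norm c)\<^sup>2" by (rule suminf_divide[OF sb])
      finally show ?thesis .
    qed
    have "norm (trie_G k) = norm (- (c * Gamma (-1 + c) * (1 + c)\<^sup>2 / 4) + 2 * (\<Sum>i. trie_G_term k (Suc i)))"
      using k by (simp add: trie_G_def c_def)
    also have "\<dots> \<le> norm (c * Gamma (-1 + c) * (1 + c)\<^sup>2 / 4) + 2 * norm (\<Sum>i. trie_G_term k (Suc i))"
      using norm_triangle_ineq[of "- (c * Gamma (-1 + c) * (1 + c)\<^sup>2 / 4)" "2 * (\<Sum>i. trie_G_term k (Suc i))"]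
      by (simp only: norm_minus_cancel norm_mult norm_numeral)
    also have "\<dots> \<le> 6 / (norm c)\<^sup>2 + 2 * (suminf b / (norm c)\<^sup>2)" using first second by linarith
    also have "\<dots> = C / (norm c)\<^sup>2" by (simp add: C_def add_divide_distrib)
    also have "\<dots> \<le> C / (real_of_int k)\<^sup>2"
    proof (rule divide_left_mono)
      have "\<bar>real_of_int k\<bar>\<^sup>2 \<le> (norm c)\<^sup>2" using norm_trie_chi_ge[of k] by (intro power_mono) (auto simp: c_def)
      then show "(real_of_int k)\<^sup>2 \<le> (norm c)\<^sup>2" by simp
    qed (use C0 c0 k in auto)
    finally show ?thesis .
  qed
  then show ?thesis by blast
qed

lemma trie_G_norm_summable: "(\<lambda>k. norm (trie_G k)) summable_on UNIV"
proof -
  obtain C where C: "\<And>k. k \<noteq> 0 \<Longrightarrow> norm (trie_G k) \<le> C / (real_of_int k)\<^sup>2" using trie_G_bound by blast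
  have base: "(\<lambda>n. C / (real (Suc n))\<^sup>2) summable_on UNIV"
  proof -
    have "summable (\<lambda>n. 1 / real n ^ 2)" using inverse_power_summable[of 2, where ?'a = real] by (simp add: inverse_eq_divide)
    then have "summable (\<lambda>n. norm (C * (1 / (real (Suc n))\<^sup>2)))"
      unfolding norm_mult by (intro summable_mult) (subst (asm) summable_Suc_iff[symmetric], simp)
    then show ?thesis using norm_summable_imp_summable_on[of "\<lambda>n. C * (1 / (real (Suc n))\<^sup>2)"] by simp
  qed
  have half: "(\<lambda>n. norm (trie_G (s * int (Suc n)))) summable_on UNIV" if "s = 1 \<or> s = -1" for s
  proof (rule summable_on_comparison_test[OF base])
    fix n
    have "(real_of_int (s * int (Suc n)))\<^sup>2 = (real (Suc n))\<^sup>2" using that by (auto simp: power2_eq_square)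
    then show "norm (trie_G (s * int (Suc n))) \<le> C / (real (Suc n))\<^sup>2"
      using C[of "s * int (Suc n)"] that by (auto simp del: of_nat_Suc)
  qed auto
  have "(\<lambda>n. norm (trie_G (int (Suc n)))) summable_on UNIV" "(\<lambda>n. norm (trie_G (- int (Suc n)))) summable_on UNIV"
    using half[of 1] half[of "-1"] by simp_all
  then show ?thesis
    by (rule has_sum_imp_summable[OF has_sum_int_split[OF has_sum_infsum has_sum_infsum]])
qed

text \<open>From \<open>t^2 exp (- t) <= 1\<close> and \<open>t^3 exp (- t) <= 17\<close>, the
  weight times \<open>t\<close> is at most 35, and \<open>lag_sum_bound\<close> multiplies it by 3.
  The bound near 0 is given the same constant.\<close>

lemma lag_sum_decay:
  assumes t: "t > 0"
  shows "\<bar>lag_sum t\<bar> \<le> 105 * t" "\<bar>lag_sum t\<bar> \<le> 105 * (1 / t)"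
proof -
  have e1: "t * exp (- t) \<le> 1" using pois_one_bounds(4)[OF t] by (simp add: pois_one_def)
  have e2: "t\<^sup>2 * exp (- t) \<le> 1" using square_le_exp[of t] t by (simp add: exp_minus field_simps)
  have e4: "t ^ 3 * exp (- t) \<le> 17"
  proof -
    have "(t/2)\<^sup>2 \<le> exp (t/2)" using t by (intro square_le_exp) auto
    then have "((t/2)\<^sup>2)\<^sup>2 \<le> (exp (t/2))\<^sup>2" by (intro power_mono) auto
    also have "(exp (t/2))\<^sup>2 = exp t" by (simp add: power2_eq_square flip: exp_add)
    finally have "t ^ 4 \<le> 16 * exp t" by (simp add: power2_eq_square power4_eq_xxxx field_simps)
    moreover have "t ^ 3 \<le> 1 + t ^ 4"
    proof (cases "t \<le> 1")
      case True
      then have "t ^ 3 \<le> 1" using t by (intro power_le_one) auto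
      moreover have "0 \<le> t ^ 4" by simp
      ultimately show ?thesis by linarith
    next
      case False
      then have "t ^ 3 \<le> t ^ 4" by (intro power_increasing) auto
      then show ?thesis by linarith
    qed
    moreover have "1 \<le> exp t" using t by simp
    ultimately have "t ^ 3 \<le> 17 * exp t" by linarith
    then show ?thesis by (simp add: exp_minus field_simps)
  qed
  have "exp (- t) \<le> 1" using t by simp
  then have "t * exp (- t) \<le> t * 1" using t by (intro mult_left_mono) auto
  moreover have "t * (t * exp (- t)) \<le> t * 1" using t e1 by (intro mult_left_mono) auto
  ultimately have "(t + 2 * t\<^sup>2) * exp (- t) \<le> 3 * t" by (simp add: power2_eq_square algebra_simps)
  then show "\<bar>lag_sum t\<bar> \<le> 105 * t" using lag_sum_bound[OF t] t by linarith
  have "t * ((t + 2 * t\<^sup>2) * exp (- t)) = t\<^sup>2 * exp (- t) + 2 * (t ^ 3 * exp (- t))"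
    by (simp add: power2_eq_square power3_eq_cube algebra_simps)
  also have "\<dots> \<le> 35" using e2 e4 by linarith
  finally have "(t + 2 * t\<^sup>2) * exp (- t) \<le> 35 * (1 / t)" using t by (simp add: field_simps)
  then show "\<bar>lag_sum t\<bar> \<le> 105 * (1 / t)" using lag_sum_bound[OF t] by linarith
qed

section \<open>The limit as a function on the circle\<close>

definition dyadic :: "real \<Rightarrow> real" where "dyadic \<theta> = exp (ln 2 * \<theta> / (2 * pi))"

lemma dyadic_pos: "dyadic \<theta> > 0"
  by (simp add: dyadic_def)

lemma dyadic_mono: "u \<le> v \<Longrightarrow> dyadic u \<le> dyadic v"
  unfolding dyadic_def by (simp add: divide_right_mono)

lemma dyadic_add_period: "dyadic (\<theta> + 2 * pi) = 2 * dyadic \<theta>"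
  by (simp add: dyadic_def distrib_left add_divide_distrib exp_add)

lemma ln_two_powi: "ln ((2::real) powi a) = real_of_int a * ln 2"
  by (simp add: powr_real_of_int'[symmetric] ln_powr)

lemma scaled_pos': "x > 0 \<Longrightarrow> scaled x a > 0"
  by (simp add: scaled_def)

lemma scaled_double: "scaled (2 * x) a = scaled x (a - 1)"
  by (simp add: scaled_def power_int_diff)

lemma lag_sum_scaled_bound:
  assumes x: "x > 0" "x \<le> B" "1 / B \<le> x" "B \<ge> 1"
  shows "\<bar>lag_sum (scaled x a)\<bar> \<le> (105 * B) * (1/2) ^ nat \<bar>a\<bar>"
proof (cases "a \<ge> 0")
  case True
  have "scaled x a \<le> B * (1/2) ^ nat \<bar>a\<bar>"
    using True x by (simp add: scaled_def power_int_def power_one_over divide_right_mono)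
  then show ?thesis using lag_sum_decay(1)[OF scaled_pos'[OF x(1), of a]] by linarith
next
  case False
  have "1 / x \<le> B" using x by (simp add: field_simps)
  have "1 / scaled x a = (1 / x) * (1/2) ^ nat \<bar>a\<bar>"
    using False by (simp add: scaled_def power_int_def power_one_over field_simps)
  also have "\<dots> \<le> B * (1/2) ^ nat \<bar>a\<bar>" using \<open>1 / x \<le> B\<close> by (intro mult_right_mono) auto
  finally show ?thesis using lag_sum_decay(2)[OF scaled_pos'[OF x(1), of a]] by linarith
qed

text \<open>In the angle \<open>\<theta> = 2 pi log 2 t\<close>, doubling of \<open>t\<close> is a
  full turn. Since the sum runs over all integer levels, doubling only shifts the summation
  index.\<close>

definition circle_fun :: "real \<Rightarrow> complex" where
  "circle_fun \<theta> = (\<Sum>\<^sub>\<infinity>a. of_real (lag_sum (scaled (dyadic \<theta>) a)))"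

lemma circle_fun_periodic: "circle_fun (\<theta> + 2 * pi) = circle_fun \<theta>"
  unfolding circle_fun_def dyadic_add_period scaled_double
  by (rule infsum_reindex_bij_witness[where i = "\<lambda>a. a + 1" and j = "\<lambda>a. a - 1"]) auto

lemma continuous_on_circle_term: "continuous_on A (\<lambda>\<theta>. complex_of_real (lag_sum (scaled (dyadic \<theta>) a)))"
proof -
  have "continuous_on A (\<lambda>\<theta>. scaled (dyadic \<theta>) a)"
    unfolding scaled_def dyadic_def by (intro continuous_intros) auto
  then have "continuous_on A (\<lambda>\<theta>. lag_sum (scaled (dyadic \<theta>) a))"
    by (rule continuous_on_compose2[OF continuous_on_lag_sum]) (auto simp: scaled_pos' dyadic_pos)
  then show ?thesis by (intro continuous_intros)
qed

lemma circle_term_bound: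
  assumes "\<theta> \<in> {- m..m}" "m \<ge> 0"
  shows "norm (complex_of_real (lag_sum (scaled (dyadic \<theta>) a))) \<le> (105 * dyadic m) * (1/2) ^ nat \<bar>a\<bar>"
proof -
  have "dyadic (- m) = 1 / dyadic m" by (simp add: dyadic_def exp_minus field_simps)
  then have "1 / dyadic m \<le> dyadic \<theta>" using dyadic_mono[of "- m" \<theta>] assms by simp
  moreover have "dyadic \<theta> \<le> dyadic m" using dyadic_mono assms by simp
  moreover have "1 \<le> dyadic m" using dyadic_mono[of 0 m] assms by (simp add: dyadic_def)
  ultimately have "\<bar>lag_sum (scaled (dyadic \<theta>) a)\<bar> \<le> (105 * dyadic m) * (1/2) ^ nat \<bar>a\<bar>"
    using dyadic_pos by (intro lag_sum_scaled_bound)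
  then show ?thesis by simp
qed

lemma continuous_on_circle_fun: "continuous_on UNIV circle_fun"
proof -
  have "isCont circle_fun \<theta>" for \<theta>
  proof -
    define m where "m = \<bar>\<theta>\<bar> + 1"
    have "continuous_on {- m..m} circle_fun"
      unfolding circle_fun_def[abs_def]
      by (rule continuous_integral_infsum(1)[OF continuous_on_circle_term circle_term_bound summable_on_half_powers])
         (auto simp: m_def)
    moreover have "\<theta> \<in> interior {- m..m}" by (auto simp: m_def)
    ultimately show ?thesis by (rule continuous_on_interior)
  qed
  then show ?thesis by (simp add: continuous_on_eq_continuous_at)
qed

text \<open>The level \<open>a\<close> enters the exponent through a multiple of
  \<open>2 pi \<i>\<close> only, so all levels see the same character.\<close>

lemma cpow_scaled_dyadic: "cpow (scaled (dyadic \<theta>) a) (trie_chi k) = cis (real_of_int k * \<theta>)"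
proof -
  have l: "ln (scaled (dyadic \<theta>) a) = ln 2 * \<theta> / (2 * pi) - real_of_int a * ln 2"
    unfolding scaled_def by (subst ln_divide_pos) (auto simp: dyadic_pos ln_two_powi, simp add: dyadic_def)
  have "trie_chi k * of_real (ln (scaled (dyadic \<theta>) a)) = \<i> * of_real (real_of_int k * \<theta>) + of_real (real_of_int (2 * (- k * a)) * pi) * \<i>"
    unfolding l by (simp add: trie_chi_def field_simps)
  then have "exp (trie_chi k * of_real (ln (scaled (dyadic \<theta>) a))) = exp (\<i> * of_real (real_of_int k * \<theta>))"
    unfolding exp_eq by blast
  then show ?thesis by (simp add: cpow_def cis_conv_exp)
qed

text \<open>Half-open, so that the cells partition the positive reals.\<close>

definition dyadic_cell :: "int \<Rightarrow> real set" where "dyadic_cell a = {scaled 1 a..<scaled 2 a}"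

lemma mem_dyadic_cell:
  assumes "t > 0"
  shows "t \<in> dyadic_cell a \<longleftrightarrow> a = - \<lfloor>log 2 t\<rfloor>"
proof -
  have s1: "scaled 1 a = 2 powr (- real_of_int a)"
    by (simp add: scaled_def powr_minus powr_real_of_int'[symmetric] divide_inverse)
  have s2: "scaled 2 a = 2 powr (1 - real_of_int a)"
    by (simp add: scaled_def powr_diff powr_real_of_int'[symmetric])
  have "t \<in> dyadic_cell a \<longleftrightarrow> - real_of_int a \<le> log 2 t \<and> log 2 t < 1 - real_of_int a"
    using assms unfolding dyadic_cell_def s1 s2 by (auto simp: le_log_iff log_less_iff)
  also have "\<dots> \<longleftrightarrow> \<lfloor>log 2 t\<rfloor> = - a" by (auto simp: floor_eq_iff)
  finally show ?thesis by auto
qed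

text \<open>Under \<open>t = scaled (dyadic \<theta>) a\<close> the measure \<open>dt / t\<close>
  becomes \<open>ln 2 / (2 pi)\<close> times \<open>d\<theta>\<close>, and the rest of the kernel
  becomes the character.\<close>

lemma dyadic_cell_integral:
  "integral {0..2 * pi} (\<lambda>\<theta>. of_real (lag_sum (scaled (dyadic \<theta>) a)) * cis (real_of_int k * \<theta>))
     = of_real (2 * pi / ln 2) * (LINT t:dyadic_cell a|lborel. of_real (lag_sum t) * mellin_kernel k t)"
proof -
  let ?g = "\<lambda>t. complex_of_real (lag_sum t) * mellin_kernel k t"
  let ?\<tau> = "\<lambda>\<theta>. scaled (dyadic \<theta>) a"
  have ends: "?\<tau> 0 = scaled 1 a" "?\<tau> (2 * pi) = scaled 2 a" by (simp_all add: dyadic_def)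
  have pos: "scaled 1 a > 0" by (simp add: scaled_def)
  have cg: "continuous_on {0<..} ?g"
    by (intro continuous_intros continuous_on_lag_sum continuous_on_mellin_kernel)
  have "((\<lambda>\<theta>. (ln 2 / (2 * pi) * ?\<tau> \<theta>) *\<^sub>R ?g (?\<tau> \<theta>)) has_integral integral {?\<tau> 0..?\<tau> (2 * pi)} ?g) {0..2 * pi}"
  proof (rule has_integral_substitution)
    show "?\<tau> ` {0..2 * pi} \<subseteq> {?\<tau> 0..?\<tau> (2 * pi)}"
      by (auto simp: scaled_def intro!: divide_right_mono dyadic_mono)
    show "continuous_on {?\<tau> 0..?\<tau> (2 * pi)} ?g"
      by (rule continuous_on_subset[OF cg]) (use pos ends in auto)
    show "(?\<tau> has_real_derivative ln 2 / (2 * pi) * ?\<tau> \<theta>) (at \<theta> within {0..2 * pi})" for \<theta>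
      unfolding scaled_def dyadic_def by (auto intro!: derivative_eq_intros simp: mult_ac)
    show "?\<tau> 0 \<le> ?\<tau> (2 * pi)" unfolding ends by (simp add: scaled_def divide_right_mono)
  qed simp
  moreover have "(ln 2 / (2 * pi) * ?\<tau> \<theta>) *\<^sub>R ?g (?\<tau> \<theta>)
      = of_real (ln 2 / (2 * pi)) * (of_real (lag_sum (?\<tau> \<theta>)) * cis (real_of_int k * \<theta>))" for \<theta>
  proof -
    have "?\<tau> \<theta> > 0" by (simp add: scaled_pos' dyadic_pos)
    then have "of_real (?\<tau> \<theta>) * mellin_kernel k (?\<tau> \<theta>) = cis (real_of_int k * \<theta>)"
      by (simp add: mellin_kernel_def cpow_scaled_dyadic)
    then show ?thesis by (simp add: scaleR_conv_of_real mult_ac)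
  qed
  ultimately have "((\<lambda>\<theta>. of_real (ln 2 / (2 * pi)) * (of_real (lag_sum (?\<tau> \<theta>)) * cis (real_of_int k * \<theta>)))
      has_integral integral {scaled 1 a..scaled 2 a} ?g) {0..2 * pi}" unfolding ends by (simp only:)
  then have "integral {0..2 * pi} (\<lambda>\<theta>. of_real (ln 2 / (2 * pi)) * (of_real (lag_sum (?\<tau> \<theta>)) * cis (real_of_int k * \<theta>)))
      = integral {scaled 1 a..scaled 2 a} ?g" by (rule integral_unique)
  then have 1: "of_real (ln 2 / (2 * pi)) * integral {0..2 * pi} (\<lambda>\<theta>. of_real (lag_sum (?\<tau> \<theta>)) * cis (real_of_int k * \<theta>))
      = integral {scaled 1 a..scaled 2 a} ?g" by (simp only: integral_mult_right)
  have sub: "dyadic_cell a \<subseteq> {0<..}" using pos by (auto simp: dyadic_cell_def)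
  have si: "set_integrable lborel (dyadic_cell a) ?g"
    by (rule set_integrable_subset[OF mellin_lag_sum(1) _ sub]) (simp add: dyadic_cell_def)
  have "(LINT t:dyadic_cell a|lborel. ?g t) = integral (dyadic_cell a) ?g" by (rule set_borel_integral_eq_integral(2)[OF si])
  also have "\<dots> = integral {scaled 1 a..scaled 2 a} ?g"
    by (rule integral_spike_set; rule negligible_subset[of "{scaled 2 a}"]) (auto simp: dyadic_cell_def)
  finally have 2: "(LINT t:dyadic_cell a|lborel. ?g t) = integral {scaled 1 a..scaled 2 a} ?g" .
  have nz: "complex_of_real (2 * pi / ln 2) * of_real (ln 2 / (2 * pi)) = 1" by simp
  show ?thesis unfolding 2 1[symmetric] mult.assoc[symmetric] nz by simp
qed

text \<open>Unfolding: integrating all scaled copies of \<open>lag_sum\<close> over one period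
  amounts to integrating a single copy over all dyadic cells, that is, over the positive
  half-line.\<close>

lemma circle_fun_fourier:
  "integral {0..2 * pi} (\<lambda>\<theta>. circle_fun \<theta> * cis (real_of_int k * \<theta>)) = of_real (2 * pi / ln 2) * trie_G k"
proof -
  let ?f = "\<lambda>a \<theta>. complex_of_real (lag_sum (scaled (dyadic \<theta>) a)) * cis (real_of_int k * \<theta>)"
  let ?c = "\<lambda>a. integral {0..2 * pi} (?f a)"
  let ?g = "\<lambda>t. complex_of_real (lag_sum t) * mellin_kernel k t"
  have J: "(?c has_sum integral {0..2 * pi} (\<lambda>\<theta>. \<Sum>\<^sub>\<infinity>a. ?f a \<theta>)) UNIV"
  proof (rule continuous_integral_infsum(2)[OF _ _ summable_on_half_powers[of "105 * dyadic (2 * pi)"]])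
    show "continuous_on {0..2 * pi} (?f a)" for a
      by (intro continuous_on_mult continuous_on_circle_term continuous_on_cis_mult)
    show "norm (?f a \<theta>) \<le> (105 * dyadic (2 * pi)) * (1/2) ^ nat \<bar>a\<bar>" if "\<theta> \<in> {0..2 * pi}" for a \<theta>
      using circle_term_bound[of \<theta> "2 * pi" a] that by (simp add: norm_mult)
  qed
  \<comment> \<open>The countable additivity used below is indexed by naturals, so the levels are
    enumerated by \<open>int_decode\<close>.\<close>
  have "(?c \<circ> int_decode has_sum integral {0..2 * pi} (\<lambda>\<theta>. \<Sum>\<^sub>\<infinity>a. ?f a \<theta>)) UNIV"
    using J has_sum_reindex_bij_betw[OF bij_int_decode, of ?c] by (simp add: o_def)
  then have "(\<lambda>i. ?c (int_decode i)) sums integral {0..2 * pi} (\<lambda>\<theta>. \<Sum>\<^sub>\<infinity>a. ?f a \<theta>)"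
    by (auto dest: has_sum_imp_sums simp: o_def)
  then have "(\<lambda>i. of_real (ln 2 / (2 * pi)) * ?c (int_decode i)) sums
     (of_real (ln 2 / (2 * pi)) * integral {0..2 * pi} (\<lambda>\<theta>. \<Sum>\<^sub>\<infinity>a. ?f a \<theta>))" by (rule sums_mult)
  moreover have "of_real (ln 2 / (2 * pi)) * ?c a = (LINT t:dyadic_cell a|lborel. ?g t)" for a
    unfolding dyadic_cell_integral by simp
  ultimately have "(\<lambda>i. LINT t:dyadic_cell (int_decode i)|lborel. ?g t) sums
     (of_real (ln 2 / (2 * pi)) * integral {0..2 * pi} (\<lambda>\<theta>. \<Sum>\<^sub>\<infinity>a. ?f a \<theta>))" by (simp only:)
  from sums_unique[OF this]
  have s: "of_real (ln 2 / (2 * pi)) * integral {0..2 * pi} (\<lambda>\<theta>. \<Sum>\<^sub>\<infinity>a. ?f a \<theta>)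
      = (\<Sum>i. LINT t:dyadic_cell (int_decode i)|lborel. ?g t)" .
  have pos: "t > 0" if "t \<in> dyadic_cell a" for t a
  proof -
    have "scaled 1 a > 0" by (simp add: scaled_def)
    then show ?thesis using that by (auto simp: dyadic_cell_def)
  qed
  have U: "(\<Union>i. dyadic_cell (int_decode i)) = {0<..}"
  proof (intro equalityI subsetI)
    fix t :: real assume "t \<in> {0<..}"
    then have "t \<in> dyadic_cell (- \<lfloor>log 2 t\<rfloor>)" by (simp add: mem_dyadic_cell)
    then have "t \<in> dyadic_cell (int_decode (int_encode (- \<lfloor>log 2 t\<rfloor>)))" by simp
    then show "t \<in> (\<Union>i. dyadic_cell (int_decode i))" by blast
  qed (use pos in auto)
  have "(LINT t:{0<..}|lborel. ?g t) = (\<Sum>i. LINT t:dyadic_cell (int_decode i)|lborel. ?g t)"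
    unfolding U[symmetric]
  proof (rule lebesgue_integral_countable_add)
    fix i j :: nat assume ij: "i \<noteq> j"
    show "dyadic_cell (int_decode i) \<inter> dyadic_cell (int_decode j) = {}"
    proof (rule ccontr)
      assume "dyadic_cell (int_decode i) \<inter> dyadic_cell (int_decode j) \<noteq> {}"
      then obtain t where t: "t \<in> dyadic_cell (int_decode i)" "t \<in> dyadic_cell (int_decode j)" by blast
      then have "int_decode i = int_decode j" using mem_dyadic_cell[OF pos[OF t(1)]] by metis
      then show False using ij inj_int_decode[of UNIV] by (auto dest: injD)
    qed
  next
    show "set_integrable lborel (\<Union>i. dyadic_cell (int_decode i)) ?g" unfolding U by (rule mellin_lag_sum(1))
  qed (simp add: dyadic_cell_def)
  then have "of_real (ln 2 / (2 * pi)) * integral {0..2 * pi} (\<lambda>\<theta>. \<Sum>\<^sub>\<infinity>a. ?f a \<theta>) = trie_G k"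
    unfolding mellin_lag_sum(2) s by simp
  moreover have "(\<Sum>\<^sub>\<infinity>a. ?f a \<theta>) = circle_fun \<theta> * cis (real_of_int k * \<theta>)" for \<theta>
    unfolding circle_fun_def by (rule infsum_cmult_left')
  ultimately have "of_real (ln 2 / (2 * pi)) * integral {0..2 * pi} (\<lambda>\<theta>. circle_fun \<theta> * cis (real_of_int k * \<theta>)) = trie_G k"
    by simp
  then have "of_real (2 * pi / ln 2) * (of_real (ln 2 / (2 * pi)) * integral {0..2 * pi} (\<lambda>\<theta>. circle_fun \<theta> * cis (real_of_int k * \<theta>)))
     = of_real (2 * pi / ln 2) * trie_G k" by (rule arg_cong)
  moreover have nz: "complex_of_real (2 * pi / ln 2) * of_real (ln 2 / (2 * pi)) = 1" by simp
  ultimately show ?thesis unfolding mult.assoc[symmetric] nz by simp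
qed

section \<open>Identification of the limit with its Fourier series\<close>

definition circle_series :: "real \<Rightarrow> complex" where
  "circle_series \<theta> = (\<Sum>\<^sub>\<infinity>k::int. trie_G k * cis (- real_of_int k * \<theta>))"

lemma circle_series_periodic: "circle_series (\<theta> + 2 * pi) = circle_series \<theta>"
proof -
  have "cis (- real_of_int k * (\<theta> + 2 * pi)) = cis (- real_of_int k * \<theta>)" for k
  proof -
    have "cis (- real_of_int k * (\<theta> + 2 * pi)) = cis (- real_of_int k * \<theta>) * cis (2 * pi * real_of_int (- k))"
      by (simp add: cis_mult algebra_simps)
    then show ?thesis by (simp only: cis_multiple_2pi Ints_of_int mult_1_right)
  qed
  then show ?thesis by (simp only: circle_series_def)
qed

lemma continuous_on_circle_series: "continuous_on UNIV circle_series"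
proof -
  have "isCont circle_series \<theta>" for \<theta>
  proof -
    define m where "m = \<bar>\<theta>\<bar> + 1"
    have "continuous_on {- m..m} circle_series"
      unfolding circle_series_def[abs_def]
      by (rule continuous_integral_infsum(1)[OF _ _ trie_G_norm_summable])
         (intro continuous_on_mult continuous_on_const continuous_on_cis_mult, simp add: norm_mult)
    moreover have "\<theta> \<in> interior {- m..m}" by (auto simp: m_def)
    ultimately show ?thesis by (rule continuous_on_interior)
  qed
  then show ?thesis by (simp add: continuous_on_eq_continuous_at)
qed

lemma circle_series_fourier:
  "integral {0..2 * pi} (\<lambda>\<theta>. circle_series \<theta> * cis (real_of_int k * \<theta>)) = of_real (2 * pi) * trie_G k"
proof -
  let ?f = "\<lambda>m \<theta>. trie_G m * cis (- real_of_int m * \<theta>) * cis (real_of_int k * \<theta>)"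
  have eq: "?f m = (\<lambda>\<theta>. trie_G m * cis (real_of_int (k - m) * \<theta>))" for m
    by (auto simp: fun_eq_iff cis_mult algebra_simps)
  have J: "((\<lambda>m. integral {0..2 * pi} (?f m)) has_sum integral {0..2 * pi} (\<lambda>\<theta>. \<Sum>\<^sub>\<infinity>m. ?f m \<theta>)) UNIV"
    by (rule continuous_integral_infsum(2)[OF _ _ trie_G_norm_summable])
       (intro continuous_on_mult continuous_on_const continuous_on_cis_mult, simp add: norm_mult)
  have val: "integral {0..2 * pi} (?f m) = (if m = k then of_real (2 * pi) * trie_G k else 0)" for m
    unfolding eq integral_mult_right integral_cis_int by auto
  have "((\<lambda>m. integral {0..2 * pi} (?f m)) has_sum (of_real (2 * pi) * trie_G k)) UNIV"
    unfolding val by (rule has_sum_finite_neutralI[of "{k}"]) auto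
  from has_sum_unique[OF J this]
  have "integral {0..2 * pi} (\<lambda>\<theta>. \<Sum>\<^sub>\<infinity>m. ?f m \<theta>) = of_real (2 * pi) * trie_G k" .
  moreover have "(\<Sum>\<^sub>\<infinity>m. ?f m \<theta>) = circle_series \<theta> * cis (real_of_int k * \<theta>)" for \<theta>
    unfolding circle_series_def by (rule infsum_cmult_left')
  ultimately show ?thesis by simp
qed

theorem circle_fun_eq_series: "circle_fun \<theta> = 1 / of_real (ln 2) * circle_series \<theta>"
proof -
  let ?h = "\<lambda>\<theta>. circle_fun \<theta> - 1 / of_real (ln 2) * circle_series \<theta>"
  have c1: "continuous_on {0..2 * pi} circle_fun" using continuous_on_circle_fun by (rule continuous_on_subset) auto
  have c2: "continuous_on {0..2 * pi} circle_series" using continuous_on_circle_series by (rule continuous_on_subset) auto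
  have "?h \<theta> = 0"
  proof (rule fourier_null_eq_0[where \<gamma> = ?h])
    show "continuous_on UNIV ?h" by (intro continuous_intros continuous_on_circle_fun continuous_on_circle_series)
    show "?h (\<theta> + 2 * pi) = ?h \<theta>" for \<theta> by (simp only: circle_fun_periodic circle_series_periodic)
    fix k :: int
    have "integral {0..2 * pi} (\<lambda>\<theta>. ?h \<theta> * cis (real_of_int k * \<theta>))
       = integral {0..2 * pi} (\<lambda>\<theta>. circle_fun \<theta> * cis (real_of_int k * \<theta>) - 1 / of_real (ln 2) * (circle_series \<theta> * cis (real_of_int k * \<theta>)))"
      by (simp add: algebra_simps)
    also have "\<dots> = integral {0..2 * pi} (\<lambda>\<theta>. circle_fun \<theta> * cis (real_of_int k * \<theta>))
        - integral {0..2 * pi} (\<lambda>\<theta>. 1 / of_real (ln 2) * (circle_series \<theta> * cis (real_of_int k * \<theta>)))"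
      by (rule integral_diff) (intro integrable_continuous_interval continuous_on_mult continuous_on_const continuous_on_cis_mult c1 c2)+
    also have "\<dots> = 0"
      unfolding integral_mult_right circle_fun_fourier circle_series_fourier by simp
    finally show "integral {0..2 * pi} (\<lambda>\<theta>. ?h \<theta> * cis (real_of_int k * \<theta>)) = 0" .
  qed
  then show ?thesis by simp
qed

text \<open>At this angle \<open>dyadic\<close> takes the value \<open>n\<close> itself, and passing
  from \<open>n\<close> to \<open>x n\<close> shifts the level by \<open>N n\<close>, which does not
  affect a sum over all levels.\<close>

lemma circle_fun_eq_var_limit:
  assumes "dyadic_scaling N x" and n: "n \<ge> 1"
  shows "circle_fun (2 * pi * ln (real n) / ln 2) = of_real (var_limit (x n))"
proof -
  interpret dyadic_scaling N x by fact
  have x: "1 \<le> x n" "x n \<le> 2" using x_ge x_le n by auto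
  have d: "dyadic (2 * pi * ln (real n) / ln 2) = real n" using n by (simp add: dyadic_def)
  have sc: "scaled (real n) a = scaled (x n) (a - int (N n))" for a
    using x_eq[OF n] by (simp add: scaled_def power_int_diff)
  have "(\<lambda>a. norm (lag_sum (scaled (x n) a))) summable_on UNIV"
  proof (rule Infinite_Sum.abs_summable_on_comparison_test'[OF summable_on_half_powers[of "105 * 2"]])
    fix a
    show "norm (lag_sum (scaled (x n) a)) \<le> (105 * 2) * (1/2) ^ nat \<bar>a\<bar>"
      using lag_sum_scaled_bound[of "x n" 2 a] x by simp
  qed
  then have "(\<lambda>a. lag_sum (scaled (x n) a)) summable_on UNIV" by (rule abs_summable_summable)
  then have "((\<lambda>a. lag_sum (scaled (x n) a)) has_sum var_limit (x n)) UNIV"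
    unfolding var_limit_eq[OF x] by (rule has_sum_infsum)
  then have v: "(\<Sum>\<^sub>\<infinity>a. complex_of_real (lag_sum (scaled (x n) a))) = of_real (var_limit (x n))"
    by (intro infsumI has_sum_of_real)
  have "circle_fun (2 * pi * ln (real n) / ln 2) = (\<Sum>\<^sub>\<infinity>a. of_real (lag_sum (scaled (x n) (a - int (N n)))))"
    unfolding circle_fun_def d sc ..
  also have "\<dots> = (\<Sum>\<^sub>\<infinity>a. of_real (lag_sum (scaled (x n) a)))"
    by (rule infsum_reindex_bij_witness[where i = "\<lambda>a. a + int (N n)" and j = "\<lambda>a. a - int (N n)"]) auto
  finally show ?thesis using v by simp
qed

lemma of_nat_powr_chi:
  assumes "n \<ge> 1"
  shows "of_nat n powr (- trie_chi k) = cis (- real_of_int k * (2 * pi * ln (real n) / ln 2))"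
proof -
  have "of_nat n powr (- trie_chi k) = cpow (real n) (- trie_chi k)"
    using powr_eq_cpow[of "real n" "- trie_chi k"] assms by simp
  also have "- trie_chi k * of_real (ln (real n)) = \<i> * of_real (- real_of_int k * (2 * pi * ln (real n) / ln 2))"
    by (simp add: trie_chi_def)
  then have "cpow (real n) (- trie_chi k) = cis (- real_of_int k * (2 * pi * ln (real n) / ln 2))"
    unfolding cpow_def cis_conv_exp by (simp only:)
  finally show ?thesis .
qed

text \<open>The first conjunct gives the series its intended meaning, as \<open>infsum\<close> is 0
  for families that are not summable. The tolerance in the last one is half a unit of the final
  decimal digit.\<close>

theorem theorem5p1:
  fixes M :: "'a measure" and X X' I :: "nat \<Rightarrow> 'a \<Rightarrow> nat"
  assumes "symmetric_trie_size M X X' I"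
  shows "(\<forall>n\<ge>1. (\<lambda>k::int. trie_G k * of_nat n powr (- trie_chi k)) summable_on UNIV) \<and>
         (\<lambda>n. complex_of_real (prob_space.variance M (\<lambda>\<omega>. real (X n \<omega>)) / real n)
              - 1 / of_real (ln 2) * (\<Sum>\<^sub>\<infinity>k::int. trie_G k * of_nat n powr (- trie_chi k)))
           \<in> o(\<lambda>n. 1) \<and>
         \<bar>trie_G0 / ln 2 - 0.845858623076001\<bar> < 5 / 10 ^ 16"
proof (intro conjI allI impI)
  interpret symmetric_trie_size M X X' I by fact
  obtain N x where Nx: "dyadic_scaling N x" using ex_dyadic_scaling by blast
  interpret dyadic_scaling N x by fact
  let ?\<theta> = "\<lambda>n. 2 * pi * ln (real n) / ln 2"
  show "(\<lambda>k::int. trie_G k * of_nat n powr (- trie_chi k)) summable_on UNIV" if "n \<ge> 1" for n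
    unfolding of_nat_powr_chi[OF that]
    by (rule abs_summable_summable) (simp add: norm_mult trie_G_norm_summable)
  let ?d = "\<lambda>n. complex_of_real (variance (\<lambda>\<omega>. real (X n \<omega>)) / real n)
              - 1 / of_real (ln 2) * (\<Sum>\<^sub>\<infinity>k::int. trie_G k * of_nat n powr (- trie_chi k))"
  have eq: "?d n = of_real (trie_var n / real n - var_limit (x n))" if n: "n \<ge> 1" for n
  proof -
    have "1 / of_real (ln 2) * (\<Sum>\<^sub>\<infinity>k::int. trie_G k * of_nat n powr (- trie_chi k)) = circle_fun (?\<theta> n)"
      unfolding of_nat_powr_chi[OF n] circle_fun_eq_series circle_series_def ..
    then show ?thesis
      unfolding variance_eq_trie_var circle_fun_eq_var_limit[OF Nx n] by simp
  qed
  have ev: "eventually (\<lambda>n. of_real (trie_var n / real n - var_limit (x n)) = ?d n) sequentially"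
    by (rule eventually_mono[OF eventually_ge_at_top[of 1]]) (rule eq[symmetric])
  have "(\<lambda>n. complex_of_real (trie_var n / real n - var_limit (x n))) \<longlonglongrightarrow> of_real 0"
    by (intro tendsto_of_real trie_var_limit)
  then have "?d \<longlonglongrightarrow> of_real 0" by (rule Lim_transform_eventually[OF _ ev])
  then show "?d \<in> o(\<lambda>n. 1)" by (intro smalloI_tendsto) auto
  show "\<bar>trie_G0 / ln 2 - 0.845858623076001\<bar> < 5 / 10 ^ 16" by (rule trie_G0_numeric)
qed

end
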